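(* Let $\mathfrak M,\mathfrak N$ be separable Hilbert spaces, let $\Theta\in\mathbf S(\mathfrak M,\mathfrak N)$, and let $\{\Gamma_n\}_{n\ge0}$ be the Schur parameters of $\Theta$, where no $\Gamma_n$ is isometric or co-isometric. Then the systems $$\zeta_0=\{\mathcal U_0(\{\Gamma_n\}_{n\ge0});\mathfrak M,\mathfrak N,\mathfrak H_0(\{\Gamma_n\}_{n\ge0})\},\qquad \widetilde\zeta_0=\{\widetilde{\mathcal U}_0(\{\Gamma_n\}_{n\ge0});\mathfrak M,\mathfrak N,\widetilde{\mathfrak H}_0(\{\Gamma_n\}_{n\ge0})\}$$ are simple conservative realizations of $\Theta$ (i.e. simple conservative systems with transfer function $\Theta$). Moreover, for each natural number $k\ge1$ the $k$-th Schur iterate $\Theta_k$ of $\Theta$ is the transfer function of the simple conservative systems $$\{\mathcal U_0(\{\Gamma_n\}_{n\ge k});\mathfrak D_{\Gamma_{k-1}},\mathfrak D_{\Gamma_{k-1}^*},\mathfrak H_0(\{\Gamma_n\}_{n\ge k})\}\quad\text{and}\quad \{\widetilde{\mathcal U}_0(\{\Gamma_n\}_{n\ge k});\mathfrak D_{\Gamma_{k-1}},\mathfrak D_{\Gamma_{k-1}^*},\widetilde{\mathfrak H}_0(\{\Gamma_n\}_{n\ge k})\}.$$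
   Context: $\mathbf L(\mathfrak H_1,\mathfrak H_2)$ denotes the bounded linear operators from the complex Hilbert space $\mathfrak H_1$ to $\mathfrak H_2$. For a contraction $T\in\mathbf L(\mathfrak H_1,\mathfrak H_2)$: $D_T=(I-T^*T)^{1/2}$, $D_{T^*}=(I-TT^* )^{1/2}$, $\mathfrak D_T=\overline{\mathrm{ran}}\,D_T$, $\mathfrak D_{T^*}=\overline{\mathrm{ran}}\,D_{T^*}$. The elementary rotation of $T$ is the unitary operator $$\mathbf J_T=\begin{bmatrix}T&D_{T^*}\\ D_T&-T^*\end{bmatrix}:\mathfrak H_1\oplus\mathfrak D_{T^*}\to\mathfrak H_2\oplus\mathfrak D_T .$$ Schur class and Schur parameters. $\mathbf S(\mathfrak M,\mathfrak N)$ is the set of holomorphic functions on $\mathbb D=\{|\lambda|<1\}$ whose values are contractions in $\mathbf L(\mathfrak M,\mathfrak N)$. For $\Theta\in\mathbf S(\mathfrak M,\mathfrak N)$ put $\Theta_0=\Theta$, $\Gamma_0=\Theta(0)$; given $\Theta_n$ and $\Gamma_n=\Theta_n(0)$, let $\Theta_{n+1}\in\mathbf S(\mathfrak D_{\Gamma_n},\mathfrak D_{\Gamma_n^*})$ be the unique function with $$\Theta_n(\lambda)=\Gamma_n+\lambda D_{\Gamma_n^*}\Theta_{n+1}(\lambda)\bigl(I+\lambda\Gamma_n^*\Theta_{n+1}(\lambda)\bigr)^{-1}D_{\Gamma_n},\quad\lambda\in\mathbb D,$$ and $\Gamma_{n+1}=\Theta_{n+1}(0)$. $\Theta_n$ is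 the $n$-th Schur iterate and the $\Gamma_n$ are the Schur parameters of $\Theta$. They form a choice sequence: a sequence of contractions $\Gamma_0\in\mathbf L(\mathfrak M,\mathfrak N)$, $\Gamma_n\in\mathbf L(\mathfrak D_{\Gamma_{n-1}},\mathfrak D_{\Gamma_{n-1}^*})$, $n\ge1$. Block operator CMV matrices. For a choice sequence $\{\Gamma_n\}_{n\ge0}$ (starting from $\Gamma_0\in\mathbf L(\mathfrak M,\mathfrak N)$) let $$\mathfrak H_0=\mathfrak H_0(\{\Gamma_n\}_{n\ge0})=\bigoplus_{n\ge0}(\mathfrak D_{\Gamma_{2n}}\oplus\mathfrak D_{\Gamma^*_{2n+1}}),\qquad \widetilde{\mathfrak H}_0=\widetilde{\mathfrak H}_0(\{\Gamma_n\}_{n\ge0})=\bigoplus_{n\ge0}(\mathfrak D_{\Gamma^*_{2n}}\oplus\mathfrak D_{\Gamma_{2n+1}})$$ (Hilbert space orthogonal sums). Here $\mathbf J_{\Gamma_0}:\mathfrak M\oplus\mathfrak D_{\Gamma_0^*}\to\mathfrak N\oplus\mathfrak D_{\Gamma_0}$ and $\mathbf J_{\Gamma_k}:\mathfrak D_{\Gamma_{k-1}}\oplus\mathfrak D_{\Gamma_k^*}\to\mathfrak D_{\Gamma_{k-1}^*}\oplus\mathfrak D_{\Gamma_k}$, $k\ge1$. Writing $\mathfrak M\oplus\widetilde{\mathfrak H}_0=(\mathfrak M\oplus\mathfrak D_{\Gamma_0^*})\oplus\bigoplus_{n\ge1}(\mathfrak D_{\Gamma_{2n-1}}\oplus\mathfrak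 D_{\Gamma_{2n}^*})$ and $\mathfrak N\oplus\mathfrak H_0=(\mathfrak N\oplus\mathfrak D_{\Gamma_0})\oplus\bigoplus_{n\ge1}(\mathfrak D_{\Gamma_{2n-1}^*}\oplus\mathfrak D_{\Gamma_{2n}})$, define the unitary operators $$\mathcal L_0=\mathbf J_{\Gamma_0}\oplus\bigoplus_{n\ge1}\mathbf J_{\Gamma_{2n}}:\mathfrak M\oplus\widetilde{\mathfrak H}_0\to\mathfrak N\oplus\mathfrak H_0,\qquad \mathcal V_0=\bigoplus_{n\ge1}\mathbf J_{\Gamma_{2n-1}}:\mathfrak H_0\to\widetilde{\mathfrak H}_0,$$ $$\mathcal U_0(\{\Gamma_n\}_{n\ge0})=\mathcal L_0(I_{\mathfrak M}\oplus\mathcal V_0):\mathfrak M\oplus\mathfrak H_0\to\mathfrak N\oplus\mathfrak H_0,\qquad \widetilde{\mathcal U}_0(\{\Gamma_n\}_{n\ge0})=(I_{\mathfrak N}\oplus\mathcal V_0)\mathcal L_0:\mathfrak M\oplus\widetilde{\mathfrak H}_0\to\mathfrak N\oplus\widetilde{\mathfrak H}_0 .$$ For $k\ge1$, the objects built from $\{\Gamma_n\}_{n\ge k}$ are obtained by applying the same construction to the choice sequence $\Gamma^{(k)}_n=\Gamma_{n+k}$, $n\ge0$, with $\mathfrak M,\mathfrak N$ replaced by $\mathfrak D_{\Gamma_{k-1}},\mathfrak D_{\Gamma_{k-1}^*}$. Systems. A system $\tau=\{U_\tau;\mathfrak M,\mathfrak N,\mathfrak H\}$ is given by $U_\tau=\begin{bmatrix}D&C\\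 B&A\end{bmatrix}:\mathfrak M\oplus\mathfrak H\to\mathfrak N\oplus\mathfrak H$. It is conservative if $U_\tau$ is unitary, and simple if $\mathfrak H=\overline{\mathrm{span}}\{A^kB\mathfrak M,\ A^{*l}C^*\mathfrak N:\ k,l\ge0\}$. Its transfer function is $\Theta_\tau(\lambda)=D+\lambda C(I-\lambda A)^{-1}B$, $\lambda\in\mathbb D$. *)

theory Defs
  imports "HOL-Analysis.Analysis"
begin

section \<open>Complex Hilbert spaces\<close>

text \<open>
  The complex inner product is linear in its first argument. The underlying real Hilbert space
  structure, hence the norm and the topology, is that of \<^class>\<open>real_inner\<close>.
\<close>

class complex_inner = real_inner +
  fixes scaleC :: "complex \<Rightarrow> 'a \<Rightarrow> 'a"  (infixr \<open>*\<^sub>C\<close> 75)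
    and cinner :: "'a \<Rightarrow> 'a \<Rightarrow> complex"
  assumes scaleC_add_right: "a *\<^sub>C (x + y) = a *\<^sub>C x + a *\<^sub>C y"
    and scaleC_add_left: "(a + b) *\<^sub>C x = a *\<^sub>C x + b *\<^sub>C x"
    and scaleC_scaleC: "a *\<^sub>C b *\<^sub>C x = (a * b) *\<^sub>C x"
    and scaleC_one: "1 *\<^sub>C x = x"
    and scaleR_scaleC: "r *\<^sub>R x = complex_of_real r *\<^sub>C x"
    and cinner_commute: "cinner x y = cnj (cinner y x)"
    and cinner_add_left: "cinner (x + y) z = cinner x z + cinner y z"
    and cinner_scaleC_left: "cinner (a *\<^sub>C x) y = a * cinner x y"
    and Re_cinner: "Re (cinner x y) = inner x y"

class chilbert_space = complex_inner + complete_space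

global_interpretation complex_vector: vector_space "scaleC :: complex \<Rightarrow> 'a \<Rightarrow> 'a::complex_inner"
  by unfold_locales (auto simp: scaleC_add_right scaleC_add_left scaleC_scaleC scaleC_one)

abbreviation csubspace :: "'a::complex_inner set \<Rightarrow> bool"
  where "csubspace \<equiv> complex_vector.subspace"

abbreviation cspan :: "'a::complex_inner set \<Rightarrow> 'a set"
  where "cspan \<equiv> complex_vector.span"

lemma cinner_self: "cinner x x = complex_of_real ((norm x)\<^sup>2)" for x :: "'a::complex_inner"
proof (rule complex_eqI)
  show "Re (cinner x x) = Re (complex_of_real ((norm x)\<^sup>2))"
    by (simp add: Re_cinner power2_norm_eq_inner)
  have "Im (cinner x x) = - Im (cinner x x)"
    by (metis cinner_commute cnj.simps(2))
  then show "Im (cinner x x) = Im (complex_of_real ((norm x)\<^sup>2))"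
    by simp
qed

lemma norm_scaleC: "norm (a *\<^sub>C x) = cmod a * norm x" for x :: "'a::complex_inner"
proof -
  have "complex_of_real ((norm (a *\<^sub>C x))\<^sup>2) = a * cnj a * cinner x x"
    by (metis (no_types, lifting) cinner_self cinner_commute cinner_scaleC_left
        complex_cnj_mult mult.assoc mult.commute)
  also have "\<dots> = complex_of_real ((cmod a * norm x)\<^sup>2)"
    unfolding cinner_self power_mult_distrib of_real_mult by (simp only: complex_norm_square)
  finally have "(norm (a *\<^sub>C x))\<^sup>2 = (cmod a * norm x)\<^sup>2"
    using of_real_eq_iff by blast
  then show ?thesis
    by (simp add: power2_eq_iff_nonneg)
qed

lemma norm_cinner_le: "cmod (cinner x y) \<le> (norm x)\<^sup>2 + (norm y)\<^sup>2" for x y :: "'a::complex_inner"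
proof -
  have re: "\<bar>Re (cinner x y)\<bar> \<le> norm x * norm y"
    by (simp add: Re_cinner Cauchy_Schwarz_ineq2)
  have "Im (cinner x y) = Re (cinner ((-\<i>) *\<^sub>C x) y)"
    unfolding cinner_scaleC_left by simp
  then have "\<bar>Im (cinner x y)\<bar> \<le> norm ((-\<i>) *\<^sub>C x) * norm y"
    by (simp only: Re_cinner Cauchy_Schwarz_ineq2)
  then have im: "\<bar>Im (cinner x y)\<bar> \<le> norm x * norm y"
    by (simp only: norm_scaleC) simp
  have "2 * (norm x * norm y) \<le> (norm x)\<^sup>2 + (norm y)\<^sup>2"
    using sum_squares_bound[of "norm x" "norm y"] by simp
  then show ?thesis
    using cmod_le[of "cinner x y"] re im by linarith
qed

instantiation prod :: (complex_inner, complex_inner) complex_inner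
begin

definition scaleC_prod where "a *\<^sub>C p = (a *\<^sub>C fst p, a *\<^sub>C snd p)"

definition cinner_prod where "cinner p q = cinner (fst p) (fst q) + cinner (snd p) (snd q)"

instance
proof
  fix p q r :: "'a \<times> 'b" and a b :: complex and t :: real
  show "a *\<^sub>C (p + q) = a *\<^sub>C p + a *\<^sub>C q"
    by (simp add: scaleC_prod_def scaleC_add_right)
  show "(a + b) *\<^sub>C p = a *\<^sub>C p + b *\<^sub>C p"
    by (simp add: scaleC_prod_def scaleC_add_left)
  show "a *\<^sub>C b *\<^sub>C p = (a * b) *\<^sub>C p"
    by (simp add: scaleC_prod_def scaleC_scaleC)
  show "1 *\<^sub>C p = p"
    by (simp add: scaleC_prod_def scaleC_one)
  show "t *\<^sub>R p = complex_of_real t *\<^sub>C p"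
    by (simp add: scaleC_prod_def scaleR_prod_def scaleR_scaleC)
  show "cinner p q = cnj (cinner q p)"
    by (simp add: cinner_prod_def flip: cinner_commute)
  show "cinner (p + q) r = cinner p r + cinner q r"
    by (simp add: cinner_prod_def cinner_add_left)
  show "cinner (a *\<^sub>C p) q = a * cinner p q"
    by (simp add: cinner_prod_def scaleC_prod_def cinner_scaleC_left distrib_left)
  show "Re (cinner p q) = inner p q"
    by (simp add: cinner_prod_def inner_prod_def Re_cinner)
qed

end

instance prod :: (chilbert_space, chilbert_space) chilbert_space ..


section \<open>Square-summable sequences\<close>

typedef (overloaded) 'a ell2 = "{f :: nat \<Rightarrow> 'a::complex_inner. summable (\<lambda>n. (norm (f n))\<^sup>2)}"
  morphisms ell2_nth Abs_ell2
  by (rule exI[of _ "\<lambda>_. 0"]) simp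

setup_lifting type_definition_ell2

lemma summable_norm_add:
  assumes "summable (\<lambda>n. (norm (f n))\<^sup>2)" "summable (\<lambda>n. (norm (g n))\<^sup>2)"
  shows "summable (\<lambda>n. (norm (f n + g n :: 'a::real_normed_vector))\<^sup>2)"
proof (rule summable_comparison_test')
  show "summable (\<lambda>n. 2 * (norm (f n))\<^sup>2 + 2 * (norm (g n))\<^sup>2)"
    using assms by (intro summable_add summable_mult)
  fix n
  have "(norm (f n + g n))\<^sup>2 \<le> (norm (f n) + norm (g n))\<^sup>2"
    by (simp add: norm_triangle_ineq power_mono)
  also have "\<dots> \<le> 2 * (norm (f n))\<^sup>2 + 2 * (norm (g n))\<^sup>2"
    using sum_squares_bound[of "norm (f n)" "norm (g n)"] by (simp add: power2_sum)
  finally show "norm ((norm (f n + g n))\<^sup>2) \<le> 2 * (norm (f n))\<^sup>2 + 2 * (norm (g n))\<^sup>2"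
    by simp
qed

lemma summable_cinner:
  assumes "summable (\<lambda>n. (norm (f n))\<^sup>2)" "summable (\<lambda>n. (norm (g n))\<^sup>2)"
  shows "summable (\<lambda>n. cinner (f n) (g n :: 'a::complex_inner))"
  by (rule summable_comparison_test'[OF summable_add[OF assms]]) (rule norm_cinner_le)

lemma summable_norm_ell2: "summable (\<lambda>n. (norm (ell2_nth f n))\<^sup>2)"
  using ell2_nth[of f] by simp

instantiation ell2 :: (complex_inner) complex_inner
begin

lift_definition zero_ell2 :: "'a ell2" is "\<lambda>_. 0"
  by simp

lift_definition plus_ell2 :: "'a ell2 \<Rightarrow> 'a ell2 \<Rightarrow> 'a ell2" is "\<lambda>f g n. f n + g n"
  by (rule summable_norm_add)

lift_definition uminus_ell2 :: "'a ell2 \<Rightarrow> 'a ell2" is "\<lambda>f n. - f n"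
  by simp

lift_definition minus_ell2 :: "'a ell2 \<Rightarrow> 'a ell2 \<Rightarrow> 'a ell2" is "\<lambda>f g n. f n - g n"
  by (simp only: diff_conv_add_uminus, rule summable_norm_add) simp_all

lift_definition scaleC_ell2 :: "complex \<Rightarrow> 'a ell2 \<Rightarrow> 'a ell2" is "\<lambda>a f n. a *\<^sub>C f n"
  by (simp add: norm_scaleC power_mult_distrib summable_mult)

lift_definition scaleR_ell2 :: "real \<Rightarrow> 'a ell2 \<Rightarrow> 'a ell2" is "\<lambda>r f n. r *\<^sub>R f n"
  by (simp add: power_mult_distrib summable_mult)

definition cinner_ell2 :: "'a ell2 \<Rightarrow> 'a ell2 \<Rightarrow> complex"
  where "cinner_ell2 f g = (\<Sum>n. cinner (ell2_nth f n) (ell2_nth g n))"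

definition inner_ell2 :: "'a ell2 \<Rightarrow> 'a ell2 \<Rightarrow> real"
  where "inner_ell2 f g = (\<Sum>n. inner (ell2_nth f n) (ell2_nth g n))"

definition norm_ell2 :: "'a ell2 \<Rightarrow> real"
  where "norm_ell2 f = sqrt (\<Sum>n. (norm (ell2_nth f n))\<^sup>2)"

definition sgn_ell2 :: "'a ell2 \<Rightarrow> 'a ell2"
  where "sgn_ell2 f = inverse (norm f) *\<^sub>R f"

definition dist_ell2 :: "'a ell2 \<Rightarrow> 'a ell2 \<Rightarrow> real"
  where "dist_ell2 f g = norm (f - g)"

definition uniformity_ell2 :: "('a ell2 \<times> 'a ell2) filter"
  where "uniformity_ell2 = (INF e\<in>{0<..}. principal {(f, g). dist f g < e})"

definition open_ell2 :: "'a ell2 set \<Rightarrow> bool"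
  where "open_ell2 U \<longleftrightarrow> (\<forall>x\<in>U. \<forall>\<^sub>F (x', y) in uniformity. x' = x \<longrightarrow> y \<in> U)"

instance
proof
  fix f g h :: "'a ell2" and a b :: complex and r s :: real
  note sc = summable_cinner[OF summable_norm_ell2 summable_norm_ell2]
  have si: "summable (\<lambda>n. inner (ell2_nth u n) (ell2_nth v n))" for u v :: "'a ell2"
    using summable_Re[OF sc[of u v]] by (simp add: Re_cinner)
  show "f + g + h = f + (g + h)" "f + g = g + f" "0 + f = f" "- f + f = 0" "f - g = f + - g"
    by (transfer; simp add: algebra_simps)+
  show "r *\<^sub>R (f + g) = r *\<^sub>R f + r *\<^sub>R g" "(r + s) *\<^sub>R f = r *\<^sub>R f + s *\<^sub>R f"
    "r *\<^sub>R s *\<^sub>R f = (r * s) *\<^sub>R f" "1 *\<^sub>R f = f"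
    by (transfer; simp add: algebra_simps)+
  show "a *\<^sub>C (f + g) = a *\<^sub>C f + a *\<^sub>C g" "(a + b) *\<^sub>C f = a *\<^sub>C f + b *\<^sub>C f"
    "a *\<^sub>C b *\<^sub>C f = (a * b) *\<^sub>C f" "1 *\<^sub>C f = f"
    by (transfer; simp add: scaleC_add_right scaleC_add_left scaleC_scaleC scaleC_one)+
  show "r *\<^sub>R f = complex_of_real r *\<^sub>C f"
    by (transfer; simp add: scaleR_scaleC)
  show "sgn f = inverse (norm f) *\<^sub>R f" "dist f g = norm (f - g)"
    by (simp_all add: sgn_ell2_def dist_ell2_def)
  show "uniformity = (INF e\<in>{0<..}. principal {(f::'a ell2, g). dist f g < e})"
    by (rule uniformity_ell2_def)
  show "open U \<longleftrightarrow> (\<forall>x\<in>U. \<forall>\<^sub>F (x', y) in uniformity. x' = x \<longrightarrow> y \<in> U)" for U :: "'a ell2 set"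
    by (rule open_ell2_def)
  show "inner f g = inner g f"
    by (simp add: inner_ell2_def inner_commute)
  show "inner (f + g) h = inner f h + inner g h"
    by (simp add: inner_ell2_def plus_ell2.rep_eq inner_add_left suminf_add si)
  show "inner (r *\<^sub>R f) g = r * inner f g"
    by (simp add: inner_ell2_def scaleR_ell2.rep_eq suminf_mult si)
  show "0 \<le> inner f f"
    by (simp add: inner_ell2_def suminf_nonneg si)
  show "inner f f = 0 \<longleftrightarrow> f = 0"
  proof -
    have "inner f f = 0 \<longleftrightarrow> (\<forall>n. inner (ell2_nth f n) (ell2_nth f n) = 0)"
      unfolding inner_ell2_def by (rule suminf_eq_zero_iff[OF si]) simp
    also have "\<dots> \<longleftrightarrow> f = 0"
      by (auto simp: zero_ell2.rep_eq simp flip: ell2_nth_inject)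
    finally show ?thesis .
  qed
  show "norm f = sqrt (inner f f)"
    by (simp add: norm_ell2_def inner_ell2_def power2_norm_eq_inner)
  have "cnj (cinner g f) = (\<Sum>n. cnj (cinner (ell2_nth g n) (ell2_nth f n)))"
    unfolding cinner_ell2_def by (rule bounded_linear.suminf[OF bounded_linear_cnj sc])
  also have "\<dots> = cinner f g"
    unfolding cinner_ell2_def by (simp only: cinner_commute[symmetric])
  finally show "cinner f g = cnj (cinner g f)" ..
  show "cinner (f + g) h = cinner f h + cinner g h"
    by (simp add: cinner_ell2_def plus_ell2.rep_eq cinner_add_left suminf_add sc)
  show "cinner (a *\<^sub>C f) g = a * cinner f g"
    by (simp add: cinner_ell2_def scaleC_ell2.rep_eq cinner_scaleC_left suminf_mult sc)
  show "Re (cinner f g) = inner f g"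
    unfolding cinner_ell2_def inner_ell2_def Re_cinner[symmetric]
    by (rule bounded_linear.suminf[OF bounded_linear_Re sc])
qed

end

lemma norm_ell2_sq: "(norm f)\<^sup>2 = (\<Sum>n. (norm (ell2_nth f n))\<^sup>2)"
  by (simp add: norm_ell2_def suminf_nonneg summable_norm_ell2)

lemma norm_ell2_nth_le: "norm (ell2_nth f n) \<le> norm f"
proof -
  have "(\<Sum>k\<in>{n}. (norm (ell2_nth f k))\<^sup>2) \<le> (norm f)\<^sup>2"
    unfolding norm_ell2_sq by (rule sum_le_suminf[OF summable_norm_ell2]) auto
  then show ?thesis
    by (auto intro: power2_le_imp_le)
qed

instance ell2 :: (chilbert_space) chilbert_space
proof
  fix X :: "nat \<Rightarrow> 'a ell2"
  assume X: "Cauchy X"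
  have "Cauchy (\<lambda>k. ell2_nth (X k) n)" for n
  proof (rule metric_CauchyI)
    fix e :: real assume "0 < e"
    then obtain M where M: "\<And>j k. j \<ge> M \<Longrightarrow> k \<ge> M \<Longrightarrow> dist (X j) (X k) < e"
      using X unfolding Cauchy_def by blast
    have "dist (ell2_nth (X j) n) (ell2_nth (X k) n) \<le> dist (X j) (X k)" for j k
      using norm_ell2_nth_le[of "X j - X k" n] by (simp add: dist_norm minus_ell2.rep_eq)
    then show "\<exists>M. \<forall>j\<ge>M. \<forall>k\<ge>M. dist (ell2_nth (X j) n) (ell2_nth (X k) n) < e"
      using M by (meson le_less_trans)
  qed
  then have "\<forall>n. \<exists>l. (\<lambda>k. ell2_nth (X k) n) \<longlonglongrightarrow> l"
    unfolding Cauchy_convergent_iff convergent_def by blast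
  from choice[OF this] obtain g where g: "\<And>n. (\<lambda>k. ell2_nth (X k) n) \<longlonglongrightarrow> g n"
    by blast
  have part: "\<exists>M. \<forall>j\<ge>M. \<forall>K. (\<Sum>n<K. (norm (ell2_nth (X j) n - g n))\<^sup>2) \<le> e\<^sup>2" if "0 < e" for e :: real
  proof -
    obtain M where M: "\<And>j k. j \<ge> M \<Longrightarrow> k \<ge> M \<Longrightarrow> dist (X j) (X k) < e"
      using X \<open>0 < e\<close> unfolding Cauchy_def by blast
    have "(\<Sum>n<K. (norm (ell2_nth (X j) n - g n))\<^sup>2) \<le> e\<^sup>2" if "j \<ge> M" for j K
    proof (rule LIMSEQ_le_const2)
      show "(\<lambda>k. \<Sum>n<K. (norm (ell2_nth (X j) n - ell2_nth (X k) n))\<^sup>2)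
          \<longlonglongrightarrow> (\<Sum>n<K. (norm (ell2_nth (X j) n - g n))\<^sup>2)"
        by (intro tendsto_intros g)
      have "(\<Sum>n<K. (norm (ell2_nth (X j) n - ell2_nth (X k) n))\<^sup>2) \<le> e\<^sup>2" if "k \<ge> M" for k
      proof -
        have "(\<Sum>n<K. (norm (ell2_nth (X j - X k) n))\<^sup>2) \<le> (norm (X j - X k))\<^sup>2"
          unfolding norm_ell2_sq by (rule sum_le_suminf[OF summable_norm_ell2]) auto
        also have "\<dots> \<le> e\<^sup>2"
          using M[OF \<open>j \<ge> M\<close> \<open>k \<ge> M\<close>] by (intro power_mono) (auto simp: dist_norm)
        finally show ?thesis
          by (simp add: minus_ell2.rep_eq)
      qed
      then show "\<exists>N. \<forall>k\<ge>N. (\<Sum>n<K. (norm (ell2_nth (X j) n - ell2_nth (X k) n))\<^sup>2) \<le> e\<^sup>2"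
        by blast
    qed
    then show ?thesis by blast
  qed
  have sum_diff: "summable (\<lambda>n. (norm (ell2_nth (X j) n - g n))\<^sup>2)"
    if "\<And>K. (\<Sum>n<K. (norm (ell2_nth (X j) n - g n))\<^sup>2) \<le> B" for j B
    by (rule bounded_imp_summable[where B = B]) (simp_all only: zero_le_power2 that flip: lessThan_Suc_atMost)
  obtain M where M: "\<And>K. (\<Sum>n<K. (norm (ell2_nth (X M) n - g n))\<^sup>2) \<le> 1"
    using part[of 1] by auto
  have "summable (\<lambda>n. (norm (- (ell2_nth (X M) n - g n) + ell2_nth (X M) n))\<^sup>2)"
    by (intro summable_norm_add summable_norm_ell2) (simp only: norm_minus_cancel sum_diff[OF M])
  then have G: "ell2_nth (Abs_ell2 g) = g"
    by (simp add: Abs_ell2_inverse)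
  have "X \<longlonglongrightarrow> Abs_ell2 g"
  proof (rule metric_LIMSEQ_I)
    fix e :: real assume "0 < e"
    then obtain M where M: "\<And>j K. j \<ge> M \<Longrightarrow> (\<Sum>n<K. (norm (ell2_nth (X j) n - g n))\<^sup>2) \<le> (e/2)\<^sup>2"
      using part[of "e/2"] by auto
    have "dist (X j) (Abs_ell2 g) < e" if "j \<ge> M" for j
    proof -
      have "(\<Sum>n. (norm (ell2_nth (X j) n - g n))\<^sup>2) \<le> (e/2)\<^sup>2"
        using sum_diff[OF M[OF that]] M[OF that] by (rule suminf_le_const)
      then have "(norm (X j - Abs_ell2 g))\<^sup>2 \<le> (e/2)\<^sup>2"
        by (simp add: norm_ell2_sq minus_ell2.rep_eq G)
      then show ?thesis
        using \<open>0 < e\<close> power2_le_imp_le[of "norm (X j - Abs_ell2 g)" "e/2"] by (simp add: dist_norm)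
    qed
    then show "\<exists>M. \<forall>j\<ge>M. dist (X j) (Abs_ell2 g) < e"
      by blast
  qed
  then show "convergent X"
    by (auto simp: convergent_def)
qed


section \<open>Operators between closed subspaces\<close>

text \<open>
  Hilbert spaces are closed subspaces of types of class \<^class>\<open>chilbert_space\<close>, and an operator
  from \<open>S\<close> to \<open>R\<close> is represented by a function of which only the values on \<open>S\<close> matter. In this way
  the defect spaces of a contraction from \<open>S\<close> to \<open>R\<close> are again subspaces of the same types.
\<close>

definition closed_csubspace :: "'a::complex_inner set \<Rightarrow> bool"
  where "closed_csubspace S \<longleftrightarrow> csubspace S \<and> closed S"

definition bounded_ops ::
    "'a::complex_inner set \<Rightarrow> 'b::complex_inner set \<Rightarrow> ('a \<Rightarrow> 'b) set"
  where "bounded_ops S R = {T.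
    (\<forall>x\<in>S. T x \<in> R) \<and>
    (\<forall>x\<in>S. \<forall>y\<in>S. T (x + y) = T x + T y) \<and>
    (\<forall>a. \<forall>x\<in>S. T (a *\<^sub>C x) = a *\<^sub>C T x) \<and>
    (\<exists>K. \<forall>x\<in>S. norm (T x) \<le> K * norm x)}"

definition op_norm :: "'a::complex_inner set \<Rightarrow> ('a \<Rightarrow> 'b::complex_inner) \<Rightarrow> real"
  where "op_norm S T = (SUP x\<in>{x\<in>S. norm x \<le> 1}. norm (T x))"

definition adj ::
    "'a::complex_inner set \<Rightarrow> 'b::complex_inner set \<Rightarrow> ('a \<Rightarrow> 'b) \<Rightarrow> 'b \<Rightarrow> 'a"
  where "adj S R T y = (THE x. x \<in> S \<and> (\<forall>z\<in>S. cinner (T z) y = cinner z x))"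

definition contraction ::
    "'a::complex_inner set \<Rightarrow> 'b::complex_inner set \<Rightarrow> ('a \<Rightarrow> 'b) \<Rightarrow> bool"
  where "contraction S R T \<longleftrightarrow> T \<in> bounded_ops S R \<and> (\<forall>x\<in>S. norm (T x) \<le> norm x)"

definition isometric :: "'a::complex_inner set \<Rightarrow> ('a \<Rightarrow> 'b::complex_inner) \<Rightarrow> bool"
  where "isometric S T \<longleftrightarrow> (\<forall>x\<in>S. norm (T x) = norm x)"

definition coisometric ::
    "'a::complex_inner set \<Rightarrow> 'b::complex_inner set \<Rightarrow> ('a \<Rightarrow> 'b) \<Rightarrow> bool"
  where "coisometric S R T \<longleftrightarrow> isometric R (adj S R T)"

definition unitary ::
    "'a::complex_inner set \<Rightarrow> 'b::complex_inner set \<Rightarrow> ('a \<Rightarrow> 'b) \<Rightarrow> bool"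
  where "unitary S R U \<longleftrightarrow> U \<in> bounded_ops S R \<and>
    (\<forall>x\<in>S. adj S R U (U x) = x) \<and> (\<forall>y\<in>R. U (adj S R U y) = y)"

definition positive_op :: "'a::complex_inner set \<Rightarrow> ('a \<Rightarrow> 'a) \<Rightarrow> bool"
  where "positive_op S A \<longleftrightarrow> A \<in> bounded_ops S S \<and> (\<forall>x\<in>S. cinner (A x) x \<in> \<real>\<^sub>\<ge>\<^sub>0)"

text \<open>
  Extensionality only fixes the irrelevant values outside \<open>S\<close>, so that the positive square root
  is unique as a function.
\<close>

definition sqrt_op :: "'a::complex_inner set \<Rightarrow> ('a \<Rightarrow> 'a) \<Rightarrow> 'a \<Rightarrow> 'a"
  where "sqrt_op S A =
    (THE B. B \<in> extensional S \<and> positive_op S B \<and> (\<forall>x\<in>S. B (B x) = A x))"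

text \<open>\<open>D\<^sub>T\<close> and \<open>D\<^sub>T\<^sub>*\<close>, and the closures of their ranges, for a contraction \<open>T\<close> from \<open>S\<close> to \<open>R\<close>.\<close>

definition defect ::
    "'a::complex_inner set \<Rightarrow> 'b::complex_inner set \<Rightarrow> ('a \<Rightarrow> 'b) \<Rightarrow> 'a \<Rightarrow> 'a"
  where "defect S R T = sqrt_op S (\<lambda>x. x - adj S R T (T x))"

definition defect_adj ::
    "'a::complex_inner set \<Rightarrow> 'b::complex_inner set \<Rightarrow> ('a \<Rightarrow> 'b) \<Rightarrow> 'b \<Rightarrow> 'b"
  where "defect_adj S R T = sqrt_op R (\<lambda>y. y - T (adj S R T y))"

definition defect_space ::
    "'a::complex_inner set \<Rightarrow> 'b::complex_inner set \<Rightarrow> ('a \<Rightarrow> 'b) \<Rightarrow> 'a set"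
  where "defect_space S R T = closure (defect S R T ` S)"

definition defect_adj_space ::
    "'a::complex_inner set \<Rightarrow> 'b::complex_inner set \<Rightarrow> ('a \<Rightarrow> 'b) \<Rightarrow> 'b set"
  where "defect_adj_space S R T = closure (defect_adj S R T ` R)"

definition elementary_rotation ::
    "'a::complex_inner set \<Rightarrow> 'b::complex_inner set \<Rightarrow> ('a \<Rightarrow> 'b) \<Rightarrow> 'a \<times> 'b \<Rightarrow> 'b \<times> 'a"
  where "elementary_rotation S R T =
    (\<lambda>(x, y). (T x + defect_adj S R T y, defect S R T x - adj S R T y))"


section \<open>Schur class and Schur parameters\<close>

text \<open>Holomorphy is complex differentiability with respect to the operator norm.\<close>

definition schur_class ::
    "'a::complex_inner set \<Rightarrow> 'b::complex_inner set \<Rightarrow> (complex \<Rightarrow> 'a \<Rightarrow> 'b) set"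
  where "schur_class S R = {\<Theta>.
    (\<forall>z\<in>ball 0 1. contraction S R (\<Theta> z)) \<and>
    (\<forall>z\<in>ball 0 1. \<exists>E\<in>bounded_ops S R.
      ((\<lambda>w. op_norm S (\<lambda>x. inverse (w - z) *\<^sub>C (\<Theta> w x - \<Theta> z x) - E x)) \<longlongrightarrow> 0) (at z))}"

text \<open>
  The spaces between which the members of a choice sequence act: \<open>\<Gamma> n\<close> is an operator from
  \<open>par_dom M N \<Gamma> n\<close> to \<open>par_cod M N \<Gamma> n\<close>. Thus \<open>par_dom M N \<Gamma> (Suc n)\<close> is the defect space of
  \<open>\<Gamma> n\<close>, and \<open>par_cod M N \<Gamma> (Suc n)\<close> is the defect space of its adjoint.
\<close>

primrec par_spaces ::
    "'a::complex_inner set \<Rightarrow> 'b::complex_inner set \<Rightarrow> (nat \<Rightarrow> 'a \<Rightarrow> 'b) \<Rightarrow> nat \<Rightarrow> 'a set \<times> 'b set"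
  where
    "par_spaces M N \<Gamma> 0 = (M, N)"
  | "par_spaces M N \<Gamma> (Suc n) =
      (let (S, R) = par_spaces M N \<Gamma> n
       in (defect_space S R (\<Gamma> n), defect_adj_space S R (\<Gamma> n)))"

definition par_dom ::
    "'a::complex_inner set \<Rightarrow> 'b::complex_inner set \<Rightarrow> (nat \<Rightarrow> 'a \<Rightarrow> 'b) \<Rightarrow> nat \<Rightarrow> 'a set"
  where "par_dom M N \<Gamma> n = fst (par_spaces M N \<Gamma> n)"

definition par_cod ::
    "'a::complex_inner set \<Rightarrow> 'b::complex_inner set \<Rightarrow> (nat \<Rightarrow> 'a \<Rightarrow> 'b) \<Rightarrow> nat \<Rightarrow> 'b set"
  where "par_cod M N \<Gamma> n = snd (par_spaces M N \<Gamma> n)"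

text \<open>
  One step of the Schur algorithm: \<open>\<Psi>\<close> is the successor of \<open>\<Theta>\<close>.
  The inverse is that of an operator on the defect space of \<open>\<Theta> 0\<close>, which is invertible because
  \<open>\<Psi> z\<close> and \<open>\<Theta> 0\<close> are contractions and \<open>\<bar>z\<bar> < 1\<close>.
\<close>

definition schur_step ::
    "'a::complex_inner set \<Rightarrow> 'b::complex_inner set \<Rightarrow>
     (complex \<Rightarrow> 'a \<Rightarrow> 'b) \<Rightarrow> (complex \<Rightarrow> 'a \<Rightarrow> 'b) \<Rightarrow> bool"
  where "schur_step S R \<Theta> \<Psi> \<longleftrightarrow>
    \<Psi> \<in> schur_class (defect_space S R (\<Theta> 0)) (defect_adj_space S R (\<Theta> 0)) \<and>
    (\<forall>z\<in>ball 0 1. \<forall>x\<in>S. \<Theta> z x = \<Theta> 0 x +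
      z *\<^sub>C defect_adj S R (\<Theta> 0)
        (\<Psi> z (inv_into (defect_space S R (\<Theta> 0)) (\<lambda>v. v + z *\<^sub>C adj S R (\<Theta> 0) (\<Psi> z v))
          (defect S R (\<Theta> 0) x))))"

text \<open>
  The Schur algorithm is stated as a relation: that every \<open>\<Theta>\<close> in the Schur class has exactly one
  sequence \<open>\<Theta>s\<close> of Schur iterates (as functions on the disk) is a theorem.
\<close>

definition schur_algorithm ::
    "'a::complex_inner set \<Rightarrow> 'b::complex_inner set \<Rightarrow> (complex \<Rightarrow> 'a \<Rightarrow> 'b) \<Rightarrow>
     (nat \<Rightarrow> complex \<Rightarrow> 'a \<Rightarrow> 'b) \<Rightarrow> (nat \<Rightarrow> 'a \<Rightarrow> 'b) \<Rightarrow> bool"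
  where "schur_algorithm M N \<Theta> \<Theta>s \<Gamma> \<longleftrightarrow>
    \<Theta>s 0 = \<Theta> \<and> (\<forall>n. \<Gamma> n = \<Theta>s n 0) \<and>
    (\<forall>n. schur_step (par_dom M N \<Gamma> n) (par_cod M N \<Gamma> n) (\<Theta>s n) (\<Theta>s (Suc n)))"


section \<open>Block operator CMV matrices\<close>

definition cmv_space ::
    "'a::complex_inner set \<Rightarrow> 'b::complex_inner set \<Rightarrow> (nat \<Rightarrow> 'a \<Rightarrow> 'b) \<Rightarrow> ('a \<times> 'b) ell2 set"
  where "cmv_space M N \<Gamma> = {x. \<forall>n. ell2_nth x n \<in>
    defect_space (par_dom M N \<Gamma> (2*n)) (par_cod M N \<Gamma> (2*n)) (\<Gamma> (2*n)) \<times>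
    defect_adj_space (par_dom M N \<Gamma> (2*n+1)) (par_cod M N \<Gamma> (2*n+1)) (\<Gamma> (2*n+1))}"

definition cmv_space' ::
    "'a::complex_inner set \<Rightarrow> 'b::complex_inner set \<Rightarrow> (nat \<Rightarrow> 'a \<Rightarrow> 'b) \<Rightarrow> ('b \<times> 'a) ell2 set"
  where "cmv_space' M N \<Gamma> = {y. \<forall>n. ell2_nth y n \<in>
    defect_adj_space (par_dom M N \<Gamma> (2*n)) (par_cod M N \<Gamma> (2*n)) (\<Gamma> (2*n)) \<times>
    defect_space (par_dom M N \<Gamma> (2*n+1)) (par_cod M N \<Gamma> (2*n+1)) (\<Gamma> (2*n+1))}"

definition par_rotation ::
    "'a::complex_inner set \<Rightarrow> 'b::complex_inner set \<Rightarrow> (nat \<Rightarrow> 'a \<Rightarrow> 'b) \<Rightarrow> nat \<Rightarrow>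
     'a \<times> 'b \<Rightarrow> 'b \<times> 'a"
  where "par_rotation M N \<Gamma> k =
    elementary_rotation (par_dom M N \<Gamma> k) (par_cod M N \<Gamma> k) (\<Gamma> k)"

text \<open>
  The operator \<open>cmv_L\<close> regroups its argument \<open>(m, y)\<close> as the sequence of pairs
  \<open>(m, fst y\<^sub>0), (snd y\<^sub>0, fst y\<^sub>1), (snd y\<^sub>1, fst y\<^sub>2), \<dots>\<close>, applies the rotations of
  \<open>\<Gamma> 0, \<Gamma> 2, \<Gamma> 4, \<dots>\<close> to these, and regroups the resulting sequence of pairs
  \<open>w\<^sub>0, w\<^sub>1, w\<^sub>2, \<dots>\<close> in the same way as \<open>fst w\<^sub>0\<close> and \<open>(snd w\<^sub>0, fst w\<^sub>1), (snd w\<^sub>1, fst w\<^sub>2), \<dots>\<close>.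
\<close>

definition cmv_L ::
    "'a::complex_inner set \<Rightarrow> 'b::complex_inner set \<Rightarrow> (nat \<Rightarrow> 'a \<Rightarrow> 'b) \<Rightarrow>
     'a \<times> ('b \<times> 'a) ell2 \<Rightarrow> 'b \<times> ('a \<times> 'b) ell2"
  where "cmv_L M N \<Gamma> = (\<lambda>(m, y).
    let w = (\<lambda>n. par_rotation M N \<Gamma> (2*n)
              ((case n of 0 \<Rightarrow> m | Suc j \<Rightarrow> snd (ell2_nth y j)), fst (ell2_nth y n)))
    in (fst (w 0), Abs_ell2 (\<lambda>n. (snd (w n), fst (w (Suc n))))))"

definition cmv_V ::
    "'a::complex_inner set \<Rightarrow> 'b::complex_inner set \<Rightarrow> (nat \<Rightarrow> 'a \<Rightarrow> 'b) \<Rightarrow>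
     ('a \<times> 'b) ell2 \<Rightarrow> ('b \<times> 'a) ell2"
  where "cmv_V M N \<Gamma> x = Abs_ell2 (\<lambda>n. par_rotation M N \<Gamma> (2*n+1) (ell2_nth x n))"

definition cmv_U ::
    "'a::complex_inner set \<Rightarrow> 'b::complex_inner set \<Rightarrow> (nat \<Rightarrow> 'a \<Rightarrow> 'b) \<Rightarrow>
     'a \<times> ('a \<times> 'b) ell2 \<Rightarrow> 'b \<times> ('a \<times> 'b) ell2"
  where "cmv_U M N \<Gamma> = cmv_L M N \<Gamma> \<circ> map_prod id (cmv_V M N \<Gamma>)"

definition cmv_U' ::
    "'a::complex_inner set \<Rightarrow> 'b::complex_inner set \<Rightarrow> (nat \<Rightarrow> 'a \<Rightarrow> 'b) \<Rightarrow>
     'a \<times> ('b \<times> 'a) ell2 \<Rightarrow> 'b \<times> ('b \<times> 'a) ell2"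
  where "cmv_U' M N \<Gamma> = map_prod id (cmv_V M N \<Gamma>) \<circ> cmv_L M N \<Gamma>"


section \<open>Systems\<close>

text \<open>
  A system is given by an operator \<open>U\<close> from \<open>M \<times> H\<close> to \<open>N \<times> H\<close>, with input space \<open>M\<close>, output
  space \<open>N\<close> and state space \<open>H\<close>.
\<close>

definition is_system ::
    "('a::complex_inner \<times> 'h::complex_inner \<Rightarrow> 'b::complex_inner \<times> 'h) \<Rightarrow>
     'a set \<Rightarrow> 'b set \<Rightarrow> 'h set \<Rightarrow> bool"
  where "is_system U M N H \<longleftrightarrow>
    closed_csubspace M \<and> closed_csubspace N \<and> closed_csubspace H \<and>
    U \<in> bounded_ops (M \<times> H) (N \<times> H)"

definition sys_D :: "('a::zero \<times> 'h::zero \<Rightarrow> 'b \<times> 'h) \<Rightarrow> 'a \<Rightarrow> 'b"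
  where "sys_D U x = fst (U (x, 0))"

definition sys_C :: "('a::zero \<times> 'h::zero \<Rightarrow> 'b \<times> 'h) \<Rightarrow> 'h \<Rightarrow> 'b"
  where "sys_C U h = fst (U (0, h))"

definition sys_B :: "('a::zero \<times> 'h::zero \<Rightarrow> 'b \<times> 'h) \<Rightarrow> 'a \<Rightarrow> 'h"
  where "sys_B U x = snd (U (x, 0))"

definition sys_A :: "('a::zero \<times> 'h::zero \<Rightarrow> 'b \<times> 'h) \<Rightarrow> 'h \<Rightarrow> 'h"
  where "sys_A U h = snd (U (0, h))"

definition conservative ::
    "('a::complex_inner \<times> 'h::complex_inner \<Rightarrow> 'b::complex_inner \<times> 'h) \<Rightarrow>
     'a set \<Rightarrow> 'b set \<Rightarrow> 'h set \<Rightarrow> bool"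
  where "conservative U M N H \<longleftrightarrow> is_system U M N H \<and> unitary (M \<times> H) (N \<times> H) U"

definition simple ::
    "('a::complex_inner \<times> 'h::complex_inner \<Rightarrow> 'b::complex_inner \<times> 'h) \<Rightarrow>
     'a set \<Rightarrow> 'b set \<Rightarrow> 'h set \<Rightarrow> bool"
  where "simple U M N H \<longleftrightarrow>
    H = closure (cspan
      ({(sys_A U ^^ k) (sys_B U x) | k x. x \<in> M} \<union>
       {(adj H H (sys_A U) ^^ l) (adj H N (sys_C U) y) | l y. y \<in> N}))"

definition transfer_function ::
    "('a::complex_inner \<times> 'h::complex_inner \<Rightarrow> 'b::complex_inner \<times> 'h) \<Rightarrow>
     'h set \<Rightarrow> complex \<Rightarrow> 'a \<Rightarrow> 'b"
  where "transfer_function U H z x =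
    sys_D U x + z *\<^sub>C sys_C U (inv_into H (\<lambda>h. h - z *\<^sub>C sys_A U h) (sys_B U x))"

definition simple_conservative_realization ::
    "('a::complex_inner \<times> 'h::complex_inner \<Rightarrow> 'b::complex_inner \<times> 'h) \<Rightarrow>
     'a set \<Rightarrow> 'b set \<Rightarrow> 'h set \<Rightarrow> (complex \<Rightarrow> 'a \<Rightarrow> 'b) \<Rightarrow> bool"
  where "simple_conservative_realization U M N H \<Theta> \<longleftrightarrow>
    conservative U M N H \<and> simple U M N H \<and>
    (\<forall>z\<in>ball 0 1. \<forall>x\<in>M. transfer_function U H z x = \<Theta> z x)"

end

theory Submission
  imports Defs
begin

text \<open>
  A block operator CMV matrix is a product of two layers of elementary rotations, one for the even
  and one for the odd parameters, and rotations are unitary (\<open>elementary_rotation_unitary\<close>). Both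
  the transfer function and simplicity are read off by following vectors through single rotations.

  For the transfer function fix \<open>z\<close> with \<open>cmod z < 1\<close> and an input \<open>x\<close>. The formula that defines a
  Schur step says that the rotation of \<open>\<Gamma> n\<close> maps \<open>(x\<^sub>n, z y\<^sub>n\<^sub>+\<^sub>1)\<close> to \<open>(y\<^sub>n, x\<^sub>n\<^sub>+\<^sub>1)\<close>, where
  \<open>y\<^sub>n = \<Theta>\<^sub>n(z) x\<^sub>n\<close> and \<open>x\<^sub>0 = x\<close> (\<open>schur_step_rotation\<close>). On the other hand, \<open>y\<close> is the value of
  the transfer function of \<open>U\<close> at \<open>x\<close> as soon as some state \<open>h\<close> satisfies \<open>U (x, z h) = (y, h)\<close>
  (\<open>transfer_function_eqI\<close>). The vectors \<open>x\<^sub>n\<close> and \<open>y\<^sub>n\<close>, multiplied by suitable powers of \<open>z\<close>, are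
  the components of such a state with \<open>y = y\<^sub>0 = \<Theta>(z) x\<close> (\<open>cmv_U_solution\<close>). It is square summable
  because the powers decay and the \<open>x\<^sub>n\<close> and \<open>y\<^sub>n\<close> are bounded: as rotations are isometric, \<open>\<parallel>x\<^sub>n\<parallel>\<^sup>2 - \<parallel>y\<^sub>n\<parallel>\<^sup>2\<close> decreases by
  \<open>(1 - \<bar>z\<bar>\<^sup>2) \<parallel>y\<^sub>n\<^sub>+\<^sub>1\<parallel>\<^sup>2\<close> in each step.

  For simplicity, the orthogonal complement of the controllable and observable vectors reduces the
  main operator to a unitary operator and is invisible from outside, so it suffices that only the
  zero subspace has these properties (\<open>simpleI\<close>). A vector of such a subspace has zero output,
  and so have all its images and preimages under the main operator. Running through the rotations
  one at a time, this kills one component after the other, since \<open>D\<^sub>\<Gamma>\<^sub>*\<close> is injective on the closure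
  of its range (\<open>cmv_U_completely_nonunitary\<close>).

  The second CMV matrix arises from the first one by the unitary change \<open>\<V>\<^sub>0\<close> of the state space,
  and the statement on the iterates is the first one for the shifted sequence of iterates
  (\<open>schur_sequence_shift\<close>).

  The preparatory part supplies Hilbert space theory on closed subspaces: adjoints from the Riesz
  representation theorem, and the square root of \<open>I - A\<close> for a selfadjoint contraction \<open>A\<close> as a
  limit of polynomials in \<open>A\<close>. The latter makes the intertwining relation \<open>T D\<^sub>T = D\<^sub>T\<^sub>* T\<close> immediate,
  on which the unitarity of the rotations rests.
\<close>


section \<open>Complex inner products\<close>

lemma cinner_add_right: "cinner x (y + z) = cinner x y + cinner x z"
  by (metis cinner_add_left cinner_commute complex_cnj_add)

lemma cinner_scaleC_right: "cinner x (a *\<^sub>C y) = cnj a * cinner x y"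
  by (metis cinner_scaleC_left cinner_commute complex_cnj_mult)

lemma cinner_zero [simp]: "cinner 0 x = 0" "cinner x 0 = 0"
  using cinner_scaleC_left[of 0 x x] cinner_scaleC_right[of x 0 x] by simp_all

lemma cinner_diff_left: "cinner (x - y) z = cinner x z - cinner y z"
  using cinner_add_left[of "x - y" y z] by simp

lemma cinner_diff_right: "cinner x (y - z) = cinner x y - cinner x z"
  using cinner_add_right[of x "y - z" z] by simp

lemma cinner_scaleR_left: "cinner (r *\<^sub>R x) y = of_real r * cinner x y"
  by (simp add: scaleR_scaleC cinner_scaleC_left)

lemma cinner_scaleR_right: "cinner x (r *\<^sub>R y) = of_real r * cinner x y"
  by (simp add: scaleR_scaleC cinner_scaleC_right)

lemma cinner_eq_zero_iff: "cinner x x = 0 \<longleftrightarrow> x = 0"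
  by (simp add: cinner_self)

lemma cinner_zero_commute: "cinner x y = 0 \<Longrightarrow> cinner y x = 0"
  by (metis cinner_commute complex_cnj_zero)

lemma cinner_eq_Complex: "cinner x y = Complex (inner x y) (inner x (\<i> *\<^sub>C y))"
  by (simp add: complex_eq_iff cinner_scaleC_right flip: Re_cinner)

lemma bounded_linear_scaleC: "bounded_linear (\<lambda>x. a *\<^sub>C x :: 'a::complex_inner)"
proof (rule bounded_linear_intro)
  show "a *\<^sub>C (r *\<^sub>R x) = r *\<^sub>R (a *\<^sub>C x)" for r and x :: 'a
    by (simp add: scaleR_scaleC scaleC_scaleC mult.commute)
  show "norm (a *\<^sub>C x) \<le> norm x * cmod a" for x :: 'a
    by (simp add: norm_scaleC mult.commute)
qed (simp add: scaleC_add_right)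

lemma tendsto_cinner:
  assumes "(f \<longlongrightarrow> a) F" "(g \<longlongrightarrow> b) F"
  shows "((\<lambda>x. cinner (f x) (g x)) \<longlongrightarrow> cinner a b) F"
  unfolding cinner_eq_Complex
  by (intro tendsto_Complex tendsto_inner assms bounded_linear.tendsto[OF bounded_linear_scaleC])


section \<open>Closed subspaces and bounded operators\<close>

lemma csubspace_mem:
  assumes "csubspace S"
  shows "0 \<in> S" "x \<in> S \<Longrightarrow> y \<in> S \<Longrightarrow> x + y \<in> S" "x \<in> S \<Longrightarrow> a *\<^sub>C x \<in> S"
    "x \<in> S \<Longrightarrow> r *\<^sub>R x \<in> S" "x \<in> S \<Longrightarrow> y \<in> S \<Longrightarrow> x - y \<in> S" "x \<in> S \<Longrightarrow> - x \<in> S"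
  using assms
  by (auto simp: scaleR_scaleC complex_vector.subspace_0 complex_vector.subspace_add
      complex_vector.subspace_scale complex_vector.subspace_diff complex_vector.subspace_neg)

lemma csubspaceI:
  assumes "0 \<in> S" "\<And>x y. x \<in> S \<Longrightarrow> y \<in> S \<Longrightarrow> x + y \<in> S" "\<And>a x. x \<in> S \<Longrightarrow> a *\<^sub>C x \<in> S"
  shows "csubspace S"
  using assms unfolding complex_vector.subspace_def by blast

lemma closed_csubspaceD:
  assumes "closed_csubspace S"
  shows "csubspace S" "closed S"
  using assms by (auto simp: closed_csubspace_def)

lemma csubspace_closure:
  assumes S: "csubspace S"
  shows "csubspace (closure S)"
proof (rule csubspaceI)
  show "0 \<in> closure S"
    using csubspace_mem(1)[OF S] closure_subset by blast
  show "x + y \<in> closure S" if "x \<in> closure S" "y \<in> closure S" for x y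
  proof -
    obtain f where "\<And>n. f n \<in> S" "f \<longlonglongrightarrow> x"
      using \<open>x \<in> closure S\<close> unfolding closure_sequential by blast
    moreover obtain g where "\<And>n. g n \<in> S" "g \<longlonglongrightarrow> y"
      using \<open>y \<in> closure S\<close> unfolding closure_sequential by blast
    ultimately show ?thesis
      unfolding closure_sequential
      by (intro exI[of _ "\<lambda>n. f n + g n"]) (auto intro: csubspace_mem(2)[OF S] tendsto_add)
  qed
  show "a *\<^sub>C x \<in> closure S" if "x \<in> closure S" for a x
  proof -
    obtain f where "\<And>n. f n \<in> S" "f \<longlonglongrightarrow> x"
      using \<open>x \<in> closure S\<close> unfolding closure_sequential by blast
    then show ?thesis
      unfolding closure_sequential
      by (intro exI[of _ "\<lambda>n. a *\<^sub>C f n"])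
        (auto intro: csubspace_mem(3)[OF S] bounded_linear.tendsto[OF bounded_linear_scaleC])
  qed
qed

lemma closed_csubspace_closure: "csubspace S \<Longrightarrow> closed_csubspace (closure S)"
  by (simp add: closed_csubspace_def csubspace_closure)

lemma closed_csubspace_Times:
  assumes "closed_csubspace S" "closed_csubspace R"
  shows "closed_csubspace (S \<times> R)"
  unfolding closed_csubspace_def
proof
  note mem = csubspace_mem[OF closed_csubspaceD(1)[OF assms(1)]]
    csubspace_mem[OF closed_csubspaceD(1)[OF assms(2)]]
  show "csubspace (S \<times> R)"
    by (rule csubspaceI) (auto simp: mem scaleC_prod_def zero_prod_def)
  show "closed (S \<times> R)"
    using assms by (intro closed_Times closed_csubspaceD)
qed

lemma bounded_opsI:
  assumes "\<And>x. x \<in> S \<Longrightarrow> T x \<in> R"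
    and "\<And>x y. x \<in> S \<Longrightarrow> y \<in> S \<Longrightarrow> T (x + y) = T x + T y"
    and "\<And>a x. x \<in> S \<Longrightarrow> T (a *\<^sub>C x) = a *\<^sub>C T x"
    and "\<And>x. x \<in> S \<Longrightarrow> norm (T x) \<le> K * norm x"
  shows "T \<in> bounded_ops S R"
  using assms unfolding bounded_ops_def by blast

lemma bounded_ops_mem: "T \<in> bounded_ops S R \<Longrightarrow> x \<in> S \<Longrightarrow> T x \<in> R"
  by (simp add: bounded_ops_def)

lemma bounded_ops_add: "T \<in> bounded_ops S R \<Longrightarrow> x \<in> S \<Longrightarrow> y \<in> S \<Longrightarrow> T (x + y) = T x + T y"
  by (simp add: bounded_ops_def)

lemma bounded_ops_scaleC: "T \<in> bounded_ops S R \<Longrightarrow> x \<in> S \<Longrightarrow> T (a *\<^sub>C x) = a *\<^sub>C T x"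
  by (simp add: bounded_ops_def)

lemma bounded_ops_scaleR: "T \<in> bounded_ops S R \<Longrightarrow> x \<in> S \<Longrightarrow> T (r *\<^sub>R x) = r *\<^sub>R T x"
  by (simp add: scaleR_scaleC bounded_ops_scaleC)

lemma bounded_ops_diff:
  assumes "T \<in> bounded_ops S R" "csubspace S" "x \<in> S" "y \<in> S"
  shows "T (x - y) = T x - T y"
  using bounded_ops_add[OF assms(1) csubspace_mem(5)[OF assms(2-4)] assms(4)] by simp

lemma bounded_ops_zero: "T \<in> bounded_ops S R \<Longrightarrow> csubspace S \<Longrightarrow> T 0 = 0"
  using bounded_ops_diff[of T S R 0 0] csubspace_mem(1)[of S] by simp

lemma bounded_ops_bound:
  assumes "T \<in> bounded_ops S R"
  obtains K where "K \<ge> 0" "\<And>x. x \<in> S \<Longrightarrow> norm (T x) \<le> K * norm x"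
proof -
  obtain K where K: "\<And>x. x \<in> S \<Longrightarrow> norm (T x) \<le> K * norm x"
    using assms unfolding bounded_ops_def by blast
  have "norm (T x) \<le> max 0 K * norm x" if "x \<in> S" for x
    using K[OF that] by (meson max.cobounded2 mult_right_mono norm_ge_zero order_trans)
  then show thesis
    using that[of "max 0 K"] by simp
qed

lemma bounded_ops_tendsto:
  assumes T: "T \<in> bounded_ops S R" and S: "csubspace S"
    and f: "\<And>n. f n \<in> S" "l \<in> S" "(f \<longlongrightarrow> l) F"
  shows "((\<lambda>n. T (f n)) \<longlongrightarrow> T l) F"
proof -
  obtain K where K: "K \<ge> 0" "\<And>x. x \<in> S \<Longrightarrow> norm (T x) \<le> K * norm x"
    using bounded_ops_bound[OF T] by blast
  have "((\<lambda>n. T (f n) - T l) \<longlongrightarrow> 0) F"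
  proof (rule Lim_null_comparison)
    show "\<forall>\<^sub>F n in F. norm (T (f n) - T l) \<le> K * norm (f n - l)"
      using K(2)[OF csubspace_mem(5)[OF S f(1,2)]]
      by (simp add: bounded_ops_diff[OF T S f(1,2)])
    show "((\<lambda>n. K * norm (f n - l)) \<longlongrightarrow> 0) F"
      using f(3) by (intro tendsto_mult_right_zero tendsto_norm_zero) (simp add: LIM_zero)
  qed
  then show ?thesis
    by (simp add: LIM_zero_cancel)
qed

lemma bounded_ops_closure:
  assumes "T \<in> bounded_ops S R" "closed_csubspace S" "X \<subseteq> S" "T ` X \<subseteq> Y" "x \<in> closure X"
  shows "T x \<in> closure Y"
proof -
  obtain f where f: "\<And>n. f n \<in> X" "f \<longlonglongrightarrow> x"
    using assms(5) unfolding closure_sequential by blast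
  have "x \<in> S"
    using assms(2,3,5) closure_minimal[of X S] by (auto simp: closed_csubspace_def)
  then have "(\<lambda>n. T (f n)) \<longlonglongrightarrow> T x"
    using f assms(3) closed_csubspaceD(1)[OF assms(2)]
    by (intro bounded_ops_tendsto[OF assms(1)]) auto
  moreover have "T (f n) \<in> Y" for n
    using f(1) assms(4) by blast
  ultimately show ?thesis
    unfolding closure_sequential by (intro exI[of _ "\<lambda>n. T (f n)"]) auto
qed

lemma csubspace_image:
  assumes "T \<in> bounded_ops S R" "csubspace S"
  shows "csubspace (T ` S)"
proof (rule csubspaceI)
  show "0 \<in> T ` S"
    using bounded_ops_zero[OF assms] csubspace_mem(1)[OF assms(2)] by force
  show "x + y \<in> T ` S" if "x \<in> T ` S" "y \<in> T ` S" for x y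
    using that bounded_ops_add[OF assms(1)] csubspace_mem(2)[OF assms(2)]
    by (smt (verit) imageE imageI)
  show "a *\<^sub>C x \<in> T ` S" if "x \<in> T ` S" for a x
    using that bounded_ops_scaleC[OF assms(1)] csubspace_mem(3)[OF assms(2)]
    by (smt (verit) imageE imageI)
qed

lemma contractionD:
  assumes "contraction S R T"
  shows "T \<in> bounded_ops S R" "x \<in> S \<Longrightarrow> norm (T x) \<le> norm x"
  using assms by (auto simp: contraction_def)

text \<open>
  Banach's fixed point theorem for the affine map \<open>x \<mapsto> y + T x\<close>.
\<close>

lemma neumann_solution:
  fixes S :: "'a::chilbert_space set"
  assumes S: "closed_csubspace S" and T: "T \<in> bounded_ops S S"
    and q: "0 \<le> q" "q < 1" "\<And>x. x \<in> S \<Longrightarrow> norm (T x) \<le> q * norm x" and y: "y \<in> S"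
  shows "\<exists>!x. x \<in> S \<and> x - T x = y"
proof -
  note sub = closed_csubspaceD[OF S]
  have "\<exists>!x. x \<in> S \<and> y + T x = x"
  proof (rule Banach_fix[OF _ _ q(1,2)])
    show "complete S"
      using sub(2) by (simp add: complete_eq_closed)
    show "S \<noteq> {}"
      using y by blast
    show "(\<lambda>x. y + T x) ` S \<subseteq> S"
      using y bounded_ops_mem[OF T] csubspace_mem(2)[OF sub(1)] by blast
    show "dist (y + T u) (y + T v) \<le> q * dist u v" if "u \<in> S" "v \<in> S" for u v
      using q(3)[OF csubspace_mem(5)[OF sub(1) that]]
      by (simp add: dist_norm bounded_ops_diff[OF T sub(1) that])
  qed
  moreover have "y + T x = x \<longleftrightarrow> x - T x = y" for x
    by (auto simp: algebra_simps)
  ultimately show ?thesis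
    by simp
qed


section \<open>Riesz representation and adjoints\<close>

lemma quadratic_nonneg_imp_zero:
  fixes c n :: real
  assumes "\<And>t. 0 \<le> 2 * t * c + t\<^sup>2 * n" "0 \<le> n"
  shows "c = 0"
proof -
  define d where "d = n + 1"
  have "0 < d"
    using assms(2) by (simp add: d_def)
  have "0 \<le> 2 * (- c / d) * c + (- c / d)\<^sup>2 * n"
    by (rule assms(1))
  also have "\<dots> = - (c\<^sup>2 * (d + 1)) / d\<^sup>2"
    using \<open>0 < d\<close> by (simp add: d_def[symmetric] eq_diff_eq[THEN iffD2, OF d_def[symmetric]]
        field_simps power2_eq_square)
  finally have "c\<^sup>2 * (d + 1) \<le> 0"
    using \<open>0 < d\<close> by (simp add: divide_le_0_iff)
  then show ?thesis
    using \<open>0 < d\<close> by (simp add: mult_le_0_iff)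
qed

text \<open>
  The representing vector minimises \<open>norm x ^ 2 - 2 * \<phi> x\<close>: minimising sequences converge by the
  parallelogram law, and at the minimum the derivative in every direction of \<open>S\<close> vanishes.
\<close>

lemma riesz_real:
  fixes S :: "'a::chilbert_space set" and \<phi> :: "'a \<Rightarrow> real"
  assumes S: "closed_csubspace S"
    and add: "\<And>x y. x \<in> S \<Longrightarrow> y \<in> S \<Longrightarrow> \<phi> (x + y) = \<phi> x + \<phi> y"
    and scale: "\<And>r x. x \<in> S \<Longrightarrow> \<phi> (r *\<^sub>R x) = r * \<phi> x"
    and bound: "\<And>x. x \<in> S \<Longrightarrow> \<bar>\<phi> x\<bar> \<le> K * norm x"
  shows "\<exists>x\<in>S. \<forall>z\<in>S. \<phi> z = inner z x"
proof -
  note mem = csubspace_mem[OF closed_csubspaceD(1)[OF S]]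
  define F where "F x = (norm x)\<^sup>2 - 2 * \<phi> x" for x
  have lower: "- K\<^sup>2 \<le> F x" if "x \<in> S" for x
  proof -
    have "0 \<le> (norm x - K)\<^sup>2" by simp
    also have "\<dots> \<le> F x + K\<^sup>2"
      using bound[OF that] by (simp add: F_def power2_diff mult.commute)
    finally show ?thesis by simp
  qed
  define I where "I = Inf (F ` S)"
  have bdd: "bdd_below (F ` S)"
    using lower by (intro bdd_belowI[of _ "- K\<^sup>2"]) auto
  have ne: "F ` S \<noteq> {}"
    using mem(1) by blast
  have I: "I \<le> F x" if "x \<in> S" for x
    unfolding I_def using that bdd by (intro cInf_lower) auto
  have "\<exists>x\<in>S. F x < I + 1 / real (Suc n)" for n
    using cInf_lessD[OF ne, of "I + 1 / real (Suc n)"] by (auto simp: I_def)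
  then obtain f where f: "\<And>n. f n \<in> S" "\<And>n. F (f n) < I + 1 / real (Suc n)"
    by metis
  have para: "(norm (x - y))\<^sup>2 \<le> 2 * (F x - I) + 2 * (F y - I)" if "x \<in> S" "y \<in> S" for x y
  proof -
    have "F ((1/2) *\<^sub>R (x + y)) = (norm (x + y))\<^sup>2 / 4 - \<phi> x - \<phi> y"
      unfolding F_def using that mem by (simp add: scale add power_divide add_divide_distrib)
    moreover have "(norm (x + y))\<^sup>2 + (norm (x - y))\<^sup>2 = 2 * (norm x)\<^sup>2 + 2 * (norm y)\<^sup>2"
      by (simp add: power2_norm_eq_inner inner_simps inner_commute)
    ultimately show ?thesis
      using I[of "(1/2) *\<^sub>R (x + y)"] that mem by (simp add: F_def)
  qed
  have "Cauchy f"
  proof (rule metric_CauchyI)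
    fix e :: real assume "0 < e"
    then obtain N where N: "4 / real (Suc N) < e\<^sup>2"
      using reals_Archimedean[of "e\<^sup>2 / 4"] by (auto simp: field_simps)
    have "dist (f m) (f n) < e" if "m \<ge> N" "n \<ge> N" for m n
    proof -
      have le: "F (f k) - I \<le> 1 / real (Suc N)" if "k \<ge> N" for k
      proof -
        have "1 / real (Suc k) \<le> 1 / real (Suc N)"
          using that by (intro divide_left_mono) auto
        then show ?thesis using f(2)[of k] by linarith
      qed
      have "(norm (f m - f n))\<^sup>2 < e\<^sup>2"
        using para[OF f(1) f(1), of m n] le[OF that(1)] le[OF that(2)] N by simp
      then show ?thesis
        using \<open>0 < e\<close> power2_less_imp_less[of "norm (f m - f n)" e] by (simp add: dist_norm)
    qed
    then show "\<exists>N. \<forall>m\<ge>N. \<forall>n\<ge>N. dist (f m) (f n) < e" by blast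
  qed
  then obtain x where x: "f \<longlonglongrightarrow> x"
    by (auto simp: Cauchy_convergent_iff convergent_def)
  have "x \<in> S"
    using closed_sequentially[OF closed_csubspaceD(2)[OF S] _ x] f(1) by blast
  have "(\<lambda>n. \<phi> (f n) - \<phi> x) \<longlonglongrightarrow> 0"
  proof (rule Lim_null_comparison)
    have "\<phi> (f n) - \<phi> x = \<phi> (f n - x)" for n
      using add[of "f n - x" x] f(1) \<open>x \<in> S\<close> mem(5) by simp
    then show "\<forall>\<^sub>F n in sequentially. norm (\<phi> (f n) - \<phi> x) \<le> K * norm (f n - x)"
      using bound f(1) \<open>x \<in> S\<close> mem(5) by simp
    show "(\<lambda>n. K * norm (f n - x)) \<longlonglongrightarrow> 0"
      using x by (intro tendsto_mult_right_zero tendsto_norm_zero) (simp add: LIM_zero)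
  qed
  then have "(\<lambda>n. F (f n)) \<longlonglongrightarrow> F x"
    unfolding F_def by (intro tendsto_intros x) (simp add: LIM_zero_iff)
  moreover have "(\<lambda>n. I + 1 / real (Suc n)) \<longlonglongrightarrow> I + 0"
    by (intro tendsto_intros lim_1_over_n[THEN LIMSEQ_Suc])
  ultimately have "F x \<le> I"
    using f(2) by (intro LIMSEQ_le[where X = "\<lambda>n. F (f n)"]) (auto intro: less_imp_le)
  have "\<phi> z = inner z x" if "z \<in> S" for z
  proof -
    have "inner z x - \<phi> z = 0"
    proof (rule quadratic_nonneg_imp_zero)
      fix t :: real
      have "F x \<le> F (x + t *\<^sub>R z)"
        using \<open>F x \<le> I\<close> I mem \<open>x \<in> S\<close> that by (meson order_trans)
      also have "\<dots> = F x + (2 * t * (inner z x - \<phi> z) + t\<^sup>2 * (norm z)\<^sup>2)"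
        using mem \<open>x \<in> S\<close> that
        by (simp add: F_def add scale power2_norm_eq_inner inner_simps inner_commute[of x z])
          (simp add: algebra_simps power2_eq_square)
      finally show "0 \<le> 2 * t * (inner z x - \<phi> z) + t\<^sup>2 * (norm z)\<^sup>2" by simp
    qed simp
    then show ?thesis by simp
  qed
  then show ?thesis
    using \<open>x \<in> S\<close> by blast
qed

lemma riesz:
  fixes S :: "'a::chilbert_space set" and \<phi> :: "'a \<Rightarrow> complex"
  assumes S: "closed_csubspace S"
    and add: "\<And>x y. x \<in> S \<Longrightarrow> y \<in> S \<Longrightarrow> \<phi> (x + y) = \<phi> x + \<phi> y"
    and scale: "\<And>a x. x \<in> S \<Longrightarrow> \<phi> (a *\<^sub>C x) = a * \<phi> x"
    and bound: "\<And>x. x \<in> S \<Longrightarrow> \<bar>Re (\<phi> x)\<bar> \<le> K * norm x"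
  shows "\<exists>x\<in>S. \<forall>z\<in>S. \<phi> z = cinner z x"
proof -
  note mem = csubspace_mem[OF closed_csubspaceD(1)[OF S]]
  obtain x where x: "x \<in> S" "\<And>z. z \<in> S \<Longrightarrow> Re (\<phi> z) = inner z x"
    using riesz_real[OF S, of "\<lambda>x. Re (\<phi> x)" K] add scale bound by (auto simp: scaleR_scaleC)
  \<comment> \<open>The imaginary part is read off from the real part at \<open>- \<i> z\<close>.\<close>
  have "\<phi> z = cinner z x" if "z \<in> S" for z
  proof (rule complex_eqI)
    show "Re (\<phi> z) = Re (cinner z x)"
      by (simp add: x(2) that Re_cinner)
    have "Re (\<phi> ((- \<i>) *\<^sub>C z)) = Re (cinner ((- \<i>) *\<^sub>C z) x)"
      unfolding Re_cinner by (rule x(2)[OF mem(3)[OF that]])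
    then show "Im (\<phi> z) = Im (cinner z x)"
      by (simp only: scale[OF that] cinner_scaleC_left) simp
  qed
  then show ?thesis
    using x(1) by blast
qed

lemma cinner_eq_imp_eq:
  assumes "csubspace S" "x \<in> S" "y \<in> S" "\<And>z. z \<in> S \<Longrightarrow> cinner z x = cinner z y"
  shows "x = y"
proof -
  have "cinner (x - y) (x - y) = 0"
    using assms(4)[OF csubspace_mem(5)[OF assms(1-3)]] by (simp add: cinner_diff_right)
  then show ?thesis
    by (simp add: cinner_eq_zero_iff)
qed

lemma closed_csubspace_eqI:
  fixes L :: "'a::chilbert_space set"
  assumes L: "closed_csubspace L" and H: "csubspace H" and "L \<subseteq> H"
    and orth: "\<And>h. h \<in> H \<Longrightarrow> (\<And>x. x \<in> L \<Longrightarrow> cinner h x = 0) \<Longrightarrow> h = 0"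
  shows "L = H"
proof
  show "H \<subseteq> L"
  proof
    fix h assume h: "h \<in> H"
    have "\<exists>x\<in>L. \<forall>z\<in>L. cinner z h = cinner z x"
    proof (rule riesz[OF L])
      show "\<bar>Re (cinner x h)\<bar> \<le> norm h * norm x" for x
        using Cauchy_Schwarz_ineq2[of x h] by (simp add: Re_cinner mult.commute)
    qed (auto simp: cinner_add_left cinner_scaleC_left)
    then obtain x where x: "x \<in> L" "\<And>z. z \<in> L \<Longrightarrow> cinner z h = cinner z x"
      by blast
    have "h - x = 0"
    proof (rule orth)
      show "h - x \<in> H"
        using csubspace_mem(5)[OF H h] x(1) \<open>L \<subseteq> H\<close> by blast
      show "cinner (h - x) z = 0" if "z \<in> L" for z
        by (rule cinner_zero_commute) (simp add: cinner_diff_right x(2)[OF that])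
    qed
    then show "h \<in> L"
      using x(1) by simp
  qed
qed fact

lemma adj_unique:
  assumes "csubspace S" "x \<in> S" "\<And>z. z \<in> S \<Longrightarrow> cinner (T z) y = cinner z x"
  shows "adj S R T y = x"
  unfolding adj_def using assms by (intro the_equality) (auto intro: cinner_eq_imp_eq)

lemma adj_exists:
  fixes S :: "'a::chilbert_space set"
  assumes S: "closed_csubspace S" and T: "T \<in> bounded_ops S R"
  shows adj_mem: "adj S R T y \<in> S"
    and adj_cinner: "z \<in> S \<Longrightarrow> cinner (T z) y = cinner z (adj S R T y)"
proof -
  obtain K where K: "K \<ge> 0" "\<And>x. x \<in> S \<Longrightarrow> norm (T x) \<le> K * norm x"
    using bounded_ops_bound[OF T] by blast
  have "\<exists>x\<in>S. \<forall>z\<in>S. cinner (T z) y = cinner z x"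
  proof (rule riesz[OF S])
    show "\<bar>Re (cinner (T x) y)\<bar> \<le> (K * norm y) * norm x" if "x \<in> S" for x
    proof -
      have "\<bar>Re (cinner (T x) y)\<bar> \<le> norm (T x) * norm y"
        by (simp add: Re_cinner Cauchy_Schwarz_ineq2)
      also have "\<dots> \<le> (K * norm x) * norm y"
        by (intro mult_right_mono K that) simp
      finally show ?thesis by (simp add: ac_simps)
    qed
  qed (auto simp: bounded_ops_add[OF T] bounded_ops_scaleC[OF T] cinner_add_left cinner_scaleC_left)
  then obtain x where x: "x \<in> S" "\<And>z. z \<in> S \<Longrightarrow> cinner (T z) y = cinner z x"
    by blast
  have "adj S R T y = x"
    by (rule adj_unique[OF closed_csubspaceD(1)[OF S] x])
  then show "adj S R T y \<in> S" "z \<in> S \<Longrightarrow> cinner (T z) y = cinner z (adj S R T y)"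
    using x by auto
qed

lemma adj_cinner':
  fixes S :: "'a::chilbert_space set"
  assumes "closed_csubspace S" "T \<in> bounded_ops S R" "z \<in> S"
  shows "cinner (adj S R T y) z = cinner y (T z)"
  using adj_cinner[OF assms] by (metis cinner_commute)

lemma norm_le_of_power2_le:
  fixes a c :: real
  assumes "a\<^sup>2 \<le> c * a" "0 \<le> a" "0 \<le> c"
  shows "a \<le> c"
  using assms by (cases "a = 0") (auto simp: power2_eq_square mult_le_cancel_right)

lemma adj_norm_bound:
  fixes S :: "'a::chilbert_space set"
  assumes S: "closed_csubspace S" and T: "T \<in> bounded_ops S R"
    and K: "K \<ge> 0" "\<And>x. x \<in> S \<Longrightarrow> norm (T x) \<le> K * norm x"
  shows "norm (adj S R T y) \<le> K * norm y"
proof (rule norm_le_of_power2_le)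
  let ?x = "adj S R T y"
  have "(norm ?x)\<^sup>2 = inner (T ?x) y"
    using arg_cong[OF adj_cinner[OF S T adj_mem[OF S T], of y y], of Re]
    by (simp add: Re_cinner power2_norm_eq_inner)
  also have "\<dots> \<le> norm (T ?x) * norm y"
    by (rule norm_cauchy_schwarz)
  also have "\<dots> \<le> (K * norm ?x) * norm y"
    by (intro mult_right_mono K adj_mem[OF S T]) simp
  finally show "(norm ?x)\<^sup>2 \<le> (K * norm y) * norm ?x"
    by (simp add: ac_simps)
qed (use K in auto)

lemma adj_bounded_ops:
  fixes S :: "'a::chilbert_space set"
  assumes S: "closed_csubspace S" and T: "T \<in> bounded_ops S R"
  shows "adj S R T \<in> bounded_ops R S"
proof -
  note sub = closed_csubspaceD(1)[OF S]
  note mem = csubspace_mem[OF sub]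
  obtain K where K: "K \<ge> 0" "\<And>x. x \<in> S \<Longrightarrow> norm (T x) \<le> K * norm x"
    using bounded_ops_bound[OF T] by blast
  show ?thesis
  proof (rule bounded_opsI)
    show "adj S R T (x + y) = adj S R T x + adj S R T y" for x y
      by (rule adj_unique[OF sub])
        (auto simp: mem adj_mem[OF S T] adj_cinner[OF S T] cinner_add_right)
    show "adj S R T (a *\<^sub>C x) = a *\<^sub>C adj S R T x" for a x
      by (rule adj_unique[OF sub])
        (auto simp: mem adj_mem[OF S T] adj_cinner[OF S T] cinner_scaleC_right)
    show "norm (adj S R T y) \<le> K * norm y" for y
      by (rule adj_norm_bound[OF S T K])
  qed (rule adj_mem[OF S T])
qed

lemma adj_adj:
  fixes S :: "'a::chilbert_space set" and R :: "'b::chilbert_space set"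
  assumes "closed_csubspace S" "closed_csubspace R" "T \<in> bounded_ops S R" "x \<in> S"
  shows "adj R S (adj S R T) x = T x"
  using assms
  by (intro adj_unique) (auto simp: closed_csubspaceD adj_cinner' bounded_ops_mem)

lemma contraction_adj:
  fixes S :: "'a::chilbert_space set"
  assumes "closed_csubspace S" "contraction S R T"
  shows "contraction R S (adj S R T)"
  using adj_bounded_ops[OF assms(1) contractionD(1)[OF assms(2)]]
    adj_norm_bound[OF assms(1) contractionD(1)[OF assms(2)], of 1] contractionD(2)[OF assms(2)]
  by (simp add: contraction_def)


section \<open>Positive square roots\<close>

text \<open>
  If \<open>Y\<close> is the square root of \<open>I - A\<close>, then \<open>X = I - Y\<close> satisfies \<open>2 X = A + X\<^sup>2\<close>; the
  fixed point iteration for this equation starts at \<open>0\<close>. The numbers \<open>sqrt_rate n\<close> are the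
  iterates for \<open>A = 1\<close>. Their increments dominate those of the operator iterates, which
  therefore converge because the bounded increasing sequence \<open>sqrt_rate\<close> does.
\<close>

primrec sqrt_iter :: "('a::complex_inner \<Rightarrow> 'a) \<Rightarrow> nat \<Rightarrow> 'a \<Rightarrow> 'a" where
  "sqrt_iter A 0 = (\<lambda>x. 0)"
| "sqrt_iter A (Suc n) = (\<lambda>x. (1/2) *\<^sub>R (A x + sqrt_iter A n (sqrt_iter A n x)))"

primrec sqrt_rate :: "nat \<Rightarrow> real" where
  "sqrt_rate 0 = 0"
| "sqrt_rate (Suc n) = (1 + (sqrt_rate n)\<^sup>2) / 2"

definition sqrt_lim :: "('a::complex_inner \<Rightarrow> 'a) \<Rightarrow> 'a \<Rightarrow> 'a"
  where "sqrt_lim A x = lim (\<lambda>n. sqrt_iter A n x)"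

lemma sqrt_rate_bounds: "0 \<le> sqrt_rate n" "sqrt_rate n \<le> 1"
proof -
  have "0 \<le> sqrt_rate n \<and> sqrt_rate n \<le> 1"
  proof (induction n)
    case (Suc n)
    then have "(sqrt_rate n)\<^sup>2 \<le> 1"
      by (simp add: power_le_one)
    then show ?case by simp
  qed simp
  then show "0 \<le> sqrt_rate n" "sqrt_rate n \<le> 1" by auto
qed

lemma sqrt_rate_increment:
  "sqrt_rate (Suc (Suc n)) - sqrt_rate (Suc n) =
    (1/2) * (sqrt_rate (Suc n) * (sqrt_rate (Suc n) - sqrt_rate n)
      + (sqrt_rate (Suc n) - sqrt_rate n) * sqrt_rate n)"
proof -
  have "sqrt_rate (Suc (Suc n)) - sqrt_rate (Suc n) = (1/2) * ((sqrt_rate (Suc n))\<^sup>2 - (sqrt_rate n)\<^sup>2)"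
    by (simp only: sqrt_rate.simps(2)[of "Suc n"] sqrt_rate.simps(2)[of n]) (simp add: field_simps)
  then show ?thesis
    by (simp only: algebra_simps power2_eq_square)
qed

lemma incseq_sqrt_rate: "incseq sqrt_rate"
proof (rule incseq_SucI)
  show "sqrt_rate n \<le> sqrt_rate (Suc n)" for n
  proof -
    have "0 \<le> (1 - sqrt_rate n)\<^sup>2" by simp
    then show ?thesis by (simp add: power2_diff)
  qed
qed

lemma Cauchy_sqrt_rate: "Cauchy sqrt_rate"
  using incseq_sqrt_rate sqrt_rate_bounds(2) incseq_convergent[of sqrt_rate 1]
  by (metis LIMSEQ_imp_Cauchy)

locale selfadjoint_contraction =
  fixes S :: "'a::chilbert_space set" and A :: "'a \<Rightarrow> 'a"
  assumes closed_csubspace: "closed_csubspace S"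
    and contraction: "contraction S S A"
    and symmetric: "\<And>x y. x \<in> S \<Longrightarrow> y \<in> S \<Longrightarrow> cinner (A x) y = cinner x (A y)"
begin

lemmas subspace = closed_csubspaceD(1)[OF closed_csubspace]
lemmas mem = csubspace_mem[OF subspace]
lemmas A_bounded = contractionD(1)[OF contraction]
lemmas A_simps = bounded_ops_mem[OF A_bounded] bounded_ops_add[OF A_bounded]
  bounded_ops_scaleC[OF A_bounded]

lemma sqrt_iter_linear:
  shows sqrt_iter_mem: "x \<in> S \<Longrightarrow> sqrt_iter A n x \<in> S"
    and sqrt_iter_add: "x \<in> S \<Longrightarrow> y \<in> S \<Longrightarrow> sqrt_iter A n (x + y) = sqrt_iter A n x + sqrt_iter A n y"
    and sqrt_iter_scaleC: "x \<in> S \<Longrightarrow> sqrt_iter A n (a *\<^sub>C x) = a *\<^sub>C sqrt_iter A n x"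
    and sqrt_iter_symmetric: "x \<in> S \<Longrightarrow> y \<in> S \<Longrightarrow>
      cinner (sqrt_iter A n x) y = cinner x (sqrt_iter A n y)"
proof (induction n arbitrary: x y)
  case 0
  { case 1 show ?case by (simp add: mem)
  next case 2 show ?case by simp
  next case 3 show ?case by simp
  next case 4 show ?case by simp }
next
  case (Suc n)
  { case 1 then show ?case by (simp add: Suc A_simps mem)
  next case 2 then show ?case by (simp add: Suc A_simps mem algebra_simps)
  next case 3 then show ?case
      by (simp add: Suc A_simps mem scaleR_scaleC scaleC_scaleC flip: scaleC_add_right)
  next case 4 then show ?case
      by (simp add: Suc symmetric A_simps mem cinner_scaleR_left cinner_scaleR_right
          cinner_add_left cinner_add_right) }
qed

lemma norm_sqrt_iter: "x \<in> S \<Longrightarrow> norm (sqrt_iter A n x) \<le> sqrt_rate n * norm x"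
proof (induction n arbitrary: x)
  case (Suc n)
  let ?X = "sqrt_iter A n"
  have "norm (A x + ?X (?X x)) \<le> norm (A x) + norm (?X (?X x))"
    by (rule norm_triangle_ineq)
  also have "norm (?X (?X x)) \<le> sqrt_rate n * norm (?X x)"
    by (intro Suc sqrt_iter_mem)
  also have "\<dots> \<le> sqrt_rate n * (sqrt_rate n * norm x)"
    by (intro mult_left_mono Suc sqrt_rate_bounds)
  also have "norm (A x) \<le> norm x"
    by (rule contractionD(2)[OF contraction Suc.prems])
  finally have "norm (A x + ?X (?X x)) \<le> 2 * (sqrt_rate (Suc n) * norm x)"
    by (simp add: power2_eq_square algebra_simps)
  then show ?case
    by (simp only: sqrt_iter.simps norm_scaleR)
qed simp

lemma sqrt_iter_diff: "x \<in> S \<Longrightarrow> y \<in> S \<Longrightarrow> sqrt_iter A n (x - y) = sqrt_iter A n x - sqrt_iter A n y"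
  using sqrt_iter_add[of "x - y" y n] mem by simp

text \<open>
  The increment of the squares is \<open>X\<^sup>2 - Y\<^sup>2 = X (X - Y) + (X - Y) Y\<close>. Bounding each factor by
  its scalar counterpart gives the same expression in \<open>sqrt_rate\<close>.
\<close>

lemma norm_sqrt_iter_increment:
  "x \<in> S \<Longrightarrow> norm (sqrt_iter A (Suc n) x - sqrt_iter A n x) \<le> (sqrt_rate (Suc n) - sqrt_rate n) * norm x"
proof (induction n arbitrary: x)
  case 0
  then show ?case using contractionD(2)[OF contraction] by simp
next
  case (Suc n)
  let ?X = "sqrt_iter A (Suc n)" and ?Y = "sqrt_iter A n"
  let ?r = "sqrt_rate (Suc n)" and ?s = "sqrt_rate n"
  have X: "?X u \<in> S" and Y: "?Y u \<in> S" if "u \<in> S" for u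
    by (rule sqrt_iter_mem[OF that])+
  have r: "0 \<le> ?r - ?s"
    using incseq_SucD[OF incseq_sqrt_rate, of n] by simp
  have expand: "sqrt_iter A (Suc m) = (\<lambda>x. (1/2) *\<^sub>R (A x + sqrt_iter A m (sqrt_iter A m x)))" for m
    by simp
  have "sqrt_iter A (Suc (Suc n)) x - ?X x = (1/2) *\<^sub>R (?X (?X x) - ?Y (?Y x))"
    by (subst expand, subst (3) expand) (simp only: algebra_simps)
  also have "?X (?X x) - ?Y (?Y x) = ?X (?X x - ?Y x) + (?X (?Y x) - ?Y (?Y x))"
    using Suc.prems X Y by (simp add: sqrt_iter_diff del: sqrt_iter.simps)
  finally have "norm (sqrt_iter A (Suc (Suc n)) x - ?X x)
      \<le> (1/2) * (norm (?X (?X x - ?Y x)) + norm (?X (?Y x) - ?Y (?Y x)))"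
    using norm_triangle_ineq[of "?X (?X x - ?Y x)" "?X (?Y x) - ?Y (?Y x)"]
    by (simp only: norm_scaleR) simp
  also have "\<dots> \<le> (1/2) * (?r * ((?r - ?s) * norm x) + (?r - ?s) * (?s * norm x))"
  proof (intro mult_left_mono add_mono)
    have "norm (?X (?X x - ?Y x)) \<le> ?r * norm (?X x - ?Y x)"
      by (intro norm_sqrt_iter mem(5) X Y Suc.prems)
    also have "\<dots> \<le> ?r * ((?r - ?s) * norm x)"
      by (intro mult_left_mono Suc sqrt_rate_bounds)
    finally show "norm (?X (?X x - ?Y x)) \<le> ?r * ((?r - ?s) * norm x)" .
    have "norm (?X (?Y x) - ?Y (?Y x)) \<le> (?r - ?s) * norm (?Y x)"
      by (intro Suc.IH Y Suc.prems)
    also have "\<dots> \<le> (?r - ?s) * (?s * norm x)"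
      by (intro mult_left_mono norm_sqrt_iter Suc.prems r)
    finally show "norm (?X (?Y x) - ?Y (?Y x)) \<le> (?r - ?s) * (?s * norm x)" .
  qed simp
  also have "\<dots> = (sqrt_rate (Suc (Suc n)) - ?r) * norm x"
    unfolding sqrt_rate_increment by (simp only: algebra_simps)
  finally show ?case .
qed

lemma norm_sqrt_iter_diff:
  assumes "x \<in> S" "m \<le> n"
  shows "norm (sqrt_iter A n x - sqrt_iter A m x) \<le> (sqrt_rate n - sqrt_rate m) * norm x"
  using assms(2)
proof (induction n rule: dec_induct)
  case (step n)
  have "norm (sqrt_iter A (Suc n) x - sqrt_iter A m x)
      \<le> norm (sqrt_iter A (Suc n) x - sqrt_iter A n x) + norm (sqrt_iter A n x - sqrt_iter A m x)"
    using norm_triangle_ineq[of "sqrt_iter A (Suc n) x - sqrt_iter A n x"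
        "sqrt_iter A n x - sqrt_iter A m x"] by simp
  also have "\<dots> \<le> (sqrt_rate (Suc n) - sqrt_rate n) * norm x + (sqrt_rate n - sqrt_rate m) * norm x"
    by (intro add_mono norm_sqrt_iter_increment assms(1) step.IH)
  finally show ?case
    by (simp only: algebra_simps)
qed simp

lemma sqrt_iter_tendsto:
  assumes x: "x \<in> S"
  shows "(\<lambda>n. sqrt_iter A n x) \<longlonglongrightarrow> sqrt_lim A x"
proof -
  have "Cauchy (\<lambda>n. sqrt_iter A n x)"
  proof (rule CauchyI')
    fix e :: real assume "0 < e"
    then have "0 < e / (norm x + 1)"
      by (simp add: add_nonneg_pos)
    then obtain M where M: "\<And>m n. m \<ge> M \<Longrightarrow> n \<ge> M \<Longrightarrow> dist (sqrt_rate m) (sqrt_rate n) < e / (norm x + 1)"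
      using Cauchy_sqrt_rate unfolding Cauchy_def by blast
    have "dist (sqrt_iter A m x) (sqrt_iter A n x) < e" if "m \<ge> M" "m < n" for m n
    proof -
      have "norm (sqrt_iter A n x - sqrt_iter A m x) \<le> (sqrt_rate n - sqrt_rate m) * norm x"
        using that by (intro norm_sqrt_iter_diff x) simp
      also have "\<dots> \<le> (e / (norm x + 1)) * norm x"
        using M[of n m] that by (intro mult_right_mono) (auto simp: dist_real_def)
      also have "\<dots> < e"
        using \<open>0 < e\<close> by (simp add: pos_divide_less_eq add_nonneg_pos distrib_left)
      finally show ?thesis
        by (simp add: dist_norm norm_minus_commute)
    qed
    then show "\<exists>M. \<forall>m\<ge>M. \<forall>n>m. dist (sqrt_iter A m x) (sqrt_iter A n x) < e"
      by blast
  qed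
  then show ?thesis
    unfolding sqrt_lim_def by (simp add: Cauchy_convergent_iff convergent_LIMSEQ_iff)
qed

lemma sqrt_lim_mem: "x \<in> S \<Longrightarrow> sqrt_lim A x \<in> S"
  using closed_sequentially[OF closed_csubspaceD(2)[OF closed_csubspace] _ sqrt_iter_tendsto]
    sqrt_iter_mem by blast

lemma norm_sqrt_lim:
  assumes x: "x \<in> S"
  shows "norm (sqrt_lim A x) \<le> norm x"
proof (rule Lim_bounded[OF tendsto_norm[OF sqrt_iter_tendsto[OF x]]], intro allI impI)
  show "norm (sqrt_iter A n x) \<le> norm x" for n
    using norm_sqrt_iter[OF x, of n] mult_right_mono[OF sqrt_rate_bounds(2)[of n], of "norm x"]
    by simp
qed

lemma sqrt_lim_bounded: "sqrt_lim A \<in> bounded_ops S S"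
proof (rule bounded_opsI[where K = 1])
  show "sqrt_lim A (x + y) = sqrt_lim A x + sqrt_lim A y" if "x \<in> S" "y \<in> S" for x y
  proof (rule LIMSEQ_unique)
    show "(\<lambda>n. sqrt_iter A n (x + y)) \<longlonglongrightarrow> sqrt_lim A (x + y)"
      by (intro sqrt_iter_tendsto mem that)
    show "(\<lambda>n. sqrt_iter A n (x + y)) \<longlonglongrightarrow> sqrt_lim A x + sqrt_lim A y"
      using that by (simp add: sqrt_iter_add tendsto_add sqrt_iter_tendsto)
  qed
  show "sqrt_lim A (a *\<^sub>C x) = a *\<^sub>C sqrt_lim A x" if "x \<in> S" for a x
  proof (rule LIMSEQ_unique)
    show "(\<lambda>n. sqrt_iter A n (a *\<^sub>C x)) \<longlonglongrightarrow> sqrt_lim A (a *\<^sub>C x)"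
      by (intro sqrt_iter_tendsto mem that)
    show "(\<lambda>n. sqrt_iter A n (a *\<^sub>C x)) \<longlonglongrightarrow> a *\<^sub>C sqrt_lim A x"
      using that
      by (simp add: sqrt_iter_scaleC bounded_linear.tendsto[OF bounded_linear_scaleC] sqrt_iter_tendsto)
  qed
qed (auto intro: sqrt_lim_mem norm_sqrt_lim)

lemma sqrt_lim_symmetric:
  assumes "x \<in> S" "y \<in> S"
  shows "cinner (sqrt_lim A x) y = cinner x (sqrt_lim A y)"
proof (rule LIMSEQ_unique)
  show "(\<lambda>n. cinner (sqrt_iter A n x) y) \<longlonglongrightarrow> cinner (sqrt_lim A x) y"
    by (intro tendsto_cinner sqrt_iter_tendsto assms tendsto_intros)
  show "(\<lambda>n. cinner (sqrt_iter A n x) y) \<longlonglongrightarrow> cinner x (sqrt_lim A y)"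
    by (simp only: sqrt_iter_symmetric[OF assms])
      (intro tendsto_cinner sqrt_iter_tendsto assms tendsto_intros)
qed

lemma sqrt_lim_fixpoint:
  assumes x: "x \<in> S"
  shows "2 *\<^sub>R sqrt_lim A x = A x + sqrt_lim A (sqrt_lim A x)"
proof -
  let ?X = "sqrt_iter A" and ?L = "sqrt_lim A"
  have "(\<lambda>n. ?X n (?X n x - ?L x)) \<longlonglongrightarrow> 0"
  proof (rule Lim_null_comparison)
    have "norm (?X n u) \<le> norm u" if "u \<in> S" for u n
      using norm_sqrt_iter[OF that, of n] mult_right_mono[OF sqrt_rate_bounds(2)[of n], of "norm u"]
      by simp
    then show "\<forall>\<^sub>F n in sequentially. norm (?X n (?X n x - ?L x)) \<le> norm (?X n x - ?L x)"
      using x by (intro always_eventually allI) (simp add: mem sqrt_iter_mem sqrt_lim_mem)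
    show "(\<lambda>n. norm (?X n x - ?L x)) \<longlonglongrightarrow> 0"
      using sqrt_iter_tendsto[OF x] by (intro tendsto_norm_zero) (simp add: LIM_zero)
  qed
  then have "(\<lambda>n. ?X n (?X n x - ?L x) + ?X n (?L x)) \<longlonglongrightarrow> 0 + ?L (?L x)"
    by (intro tendsto_add sqrt_iter_tendsto sqrt_lim_mem x)
  then have "(\<lambda>n. ?X n (?X n x)) \<longlonglongrightarrow> ?L (?L x)"
    using x by (simp add: sqrt_iter_diff sqrt_iter_mem sqrt_lim_mem)
  then have "(\<lambda>n. 2 *\<^sub>R ?X (Suc n) x) \<longlonglongrightarrow> A x + ?L (?L x)"
    by (auto intro: tendsto_intros)
  moreover have "(\<lambda>n. 2 *\<^sub>R ?X (Suc n) x) \<longlonglongrightarrow> 2 *\<^sub>R ?L x"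
    by (intro tendsto_intros LIMSEQ_Suc sqrt_iter_tendsto x)
  ultimately show ?thesis
    by (rule LIMSEQ_unique[rotated])
qed

end

text \<open>
  The square root of \<open>I - A\<close> is a limit of polynomials in \<open>A\<close>, so whatever intertwines two
  operators also intertwines their square roots.
\<close>

lemma sqrt_lim_intertwines:
  assumes A: "selfadjoint_contraction S A" and A': "selfadjoint_contraction R A'"
    and T: "T \<in> bounded_ops S R" and comm: "\<And>x. x \<in> S \<Longrightarrow> T (A x) = A' (T x)" and x: "x \<in> S"
  shows "T (sqrt_lim A x) = sqrt_lim A' (T x)"
proof -
  interpret A: selfadjoint_contraction S A by fact
  interpret A': selfadjoint_contraction R A' by fact
  have iter: "T (sqrt_iter A n u) = sqrt_iter A' n (T u)" if "u \<in> S" for n u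
    using that
  proof (induction n arbitrary: u)
    case 0
    then show ?case using bounded_ops_zero[OF T A.subspace] by simp
  next
    case (Suc n)
    then show ?case
      by (simp add: bounded_ops_add[OF T] bounded_ops_scaleR[OF T] A.mem A.A_simps A.sqrt_iter_mem comm)
  qed
  show ?thesis
  proof (rule LIMSEQ_unique)
    show "(\<lambda>n. T (sqrt_iter A n x)) \<longlonglongrightarrow> T (sqrt_lim A x)"
      by (intro bounded_ops_tendsto[OF T A.subspace] A.sqrt_iter_mem A.sqrt_lim_mem
          A.sqrt_iter_tendsto x)
    show "(\<lambda>n. T (sqrt_iter A n x)) \<longlonglongrightarrow> sqrt_lim A' (T x)"
      by (simp only: iter[OF x]) (intro A'.sqrt_iter_tendsto bounded_ops_mem[OF T x])
  qed
qed

lemma positive_op_symmetric: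
  assumes S: "csubspace S" and B: "positive_op S B" and x: "x \<in> S" and y: "y \<in> S"
  shows "cinner (B x) y = cinner x (B y)"
proof -
  have Bb: "B \<in> bounded_ops S S"
    using B by (simp add: positive_op_def)
  note mem = csubspace_mem[OF S]
  have real: "cinner (B u) u = cinner u (B u)" if "u \<in> S" for u
  proof -
    have "cinner (B u) u \<in> \<real>"
      using B that by (auto simp: positive_op_def complex_nonneg_Reals_iff complex_is_Real_iff)
    then show ?thesis
      by (metis Reals_cnj_iff cinner_commute)
  qed
  define f where "f u v = cinner (B u) v - cinner u (B v)" for u v
  have f0: "f u u = 0" if "u \<in> S" for u
    using real[OF that] by (simp add: f_def)
  have add: "f (u + v) (u + v) = f u u + f u v + f v u + f v v" if "u \<in> S" "v \<in> S" for u v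
    using that by (simp add: f_def bounded_ops_add[OF Bb] cinner_add_left cinner_add_right)
  have anti: "f x y + f y x = 0"
    using add[OF x y] f0 mem x y by simp
  \<comment> \<open>Replacing \<open>y\<close> by \<open>\<i> y\<close> turns the sum of the two mixed terms into their difference.\<close>
  have "f x (\<i> *\<^sub>C y) + f (\<i> *\<^sub>C y) x = 0"
    using add[OF x mem(3)[OF y]] f0 mem x y by simp
  then have "- \<i> * f x y + \<i> * f y x = 0"
    using y by (simp add: f_def bounded_ops_scaleC[OF Bb] cinner_scaleC_left cinner_scaleC_right algebra_simps)
  then have "\<i> * (f y x - f x y) = 0"
    by (simp add: algebra_simps)
  then have "f x y = 0"
    using anti by (simp add: eq_neg_iff_add_eq_0)
  then show ?thesis
    by (simp add: f_def)
qed

lemma positive_op_null: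
  assumes S: "csubspace S" and B: "positive_op S B" and y: "y \<in> S" and 0: "Re (cinner (B y) y) = 0"
  shows "B y = 0"
proof -
  have Bb: "B \<in> bounded_ops S S"
    using B by (simp add: positive_op_def)
  have By: "B y \<in> S"
    by (rule bounded_ops_mem[OF Bb y])
  have pos: "0 \<le> Re (cinner (B u) u)" if "u \<in> S" for u
    using B that by (auto simp: positive_op_def complex_nonneg_Reals_iff)
  have "(norm (B y))\<^sup>2 = 0"
  proof (rule quadratic_nonneg_imp_zero)
    fix t :: real
    have "0 \<le> Re (cinner (B (y + t *\<^sub>R B y)) (y + t *\<^sub>R B y))"
      by (intro pos csubspace_mem[OF S] y By)
    also have "\<dots> = 2 * t * (norm (B y))\<^sup>2 + t\<^sup>2 * Re (cinner (B (B y)) (B y))"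
      using 0 positive_op_symmetric[OF S B By y]
      by (simp add: bounded_ops_add[OF Bb] bounded_ops_scaleR[OF Bb] csubspace_mem[OF S] y By
          cinner_add_left cinner_add_right cinner_scaleR_left cinner_scaleR_right cinner_self
          power2_eq_square algebra_simps)
    finally show "0 \<le> 2 * t * (norm (B y))\<^sup>2 + t\<^sup>2 * Re (cinner (B (B y)) (B y))" .
  qed (rule pos[OF By])
  then show ?thesis by simp
qed

context selfadjoint_contraction
begin

lemma sqrt_exists:
  shows positive_sqrt: "positive_op S (\<lambda>x. x - sqrt_lim A x)"
    and sqrt_squared: "x \<in> S \<Longrightarrow>
      (x - sqrt_lim A x) - sqrt_lim A (x - sqrt_lim A x) = x - A x"
proof -
  note L = sqrt_lim_bounded
  show "positive_op S (\<lambda>x. x - sqrt_lim A x)"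
    unfolding positive_op_def
  proof (intro conjI ballI)
    show "(\<lambda>x. x - sqrt_lim A x) \<in> bounded_ops S S"
    proof (rule bounded_opsI[where K = 2])
      show "norm (x - sqrt_lim A x) \<le> 2 * norm x" if "x \<in> S" for x
        using norm_triangle_ineq4[of x "sqrt_lim A x"] norm_sqrt_lim[OF that] by simp
    qed (auto simp: mem sqrt_lim_mem bounded_ops_add[OF L] bounded_ops_scaleC[OF L]
        complex_vector.scale_right_diff_distrib)
    fix x assume x: "x \<in> S"
    have "cinner (sqrt_lim A x) x = cnj (cinner (sqrt_lim A x) x)"
      using sqrt_lim_symmetric[OF x x] by (metis cinner_commute)
    moreover have "inner (sqrt_lim A x) x \<le> (norm x)\<^sup>2"
      using norm_cauchy_schwarz[of "sqrt_lim A x" x] mult_right_mono[OF norm_sqrt_lim[OF x], of "norm x"]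
      by (simp add: power2_eq_square)
    ultimately show "cinner (x - sqrt_lim A x) x \<in> \<real>\<^sub>\<ge>\<^sub>0"
      by (simp add: complex_nonneg_Reals_iff cinner_diff_left cinner_self Re_cinner complex_eq_iff)
  qed
  show "(x - sqrt_lim A x) - sqrt_lim A (x - sqrt_lim A x) = x - A x" if x: "x \<in> S"
    using sqrt_lim_fixpoint[OF x]
    by (simp add: bounded_ops_diff[OF L subspace x sqrt_lim_mem[OF x]] algebra_simps scaleR_2)
qed

text \<open>
  A second square root \<open>C\<close> commutes with its square, hence with the root \<open>B\<close> that is a limit of
  polynomials in it. With \<open>y = (B - C) x\<close> this gives \<open>(B + C) y = 0\<close>, so \<open>B y = C y = 0\<close> by
  positivity, and then \<open>(norm y)\<^sup>2\<close> is the inner product of \<open>(B - C) y = 0\<close> with \<open>x\<close>.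
\<close>

lemma sqrt_unique:
  assumes C: "positive_op S C" and sq: "\<And>x. x \<in> S \<Longrightarrow> C (C x) = x - A x" and x: "x \<in> S"
  shows "C x = x - sqrt_lim A x"
proof -
  define B where "B = (\<lambda>x. x - sqrt_lim A x)"
  have B: "positive_op S B"
    unfolding B_def by (rule positive_sqrt)
  have Bb: "B \<in> bounded_ops S S" and Cb: "C \<in> bounded_ops S S"
    using B C by (auto simp: positive_op_def)
  note Bm = bounded_ops_mem[OF Bb] and Cm = bounded_ops_mem[OF Cb]
  have "C (A u) = A (C u)" if u: "u \<in> S" for u
    using sq[OF u] sq[OF Cm[OF u]] bounded_ops_diff[OF Cb subspace u A_simps(1)[OF u]] by simp
  then have comm: "C (B u) = B (C u)" if "u \<in> S" for u
    using that sqrt_lim_intertwines[OF selfadjoint_contraction_axioms selfadjoint_contraction_axioms Cb]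
    by (simp add: B_def bounded_ops_diff[OF Cb subspace] sqrt_lim_mem)
  have Bsq: "B (B u) = C (C u)" if "u \<in> S" for u
    using sqrt_squared[OF that] sq[OF that] by (simp add: B_def)
  define y where "y = B x - C x"
  have y: "y \<in> S"
    unfolding y_def by (intro mem Bm Cm x)
  have "B y + C y = 0"
    using x by (simp add: y_def bounded_ops_diff[OF Bb subspace] bounded_ops_diff[OF Cb subspace]
        Bm Cm comm Bsq)
  then have "Re (cinner (B y) y) + Re (cinner (C y) y) = 0"
    by (metis cinner_add_left cinner_zero(1) plus_complex.sel(1) zero_complex.sel(1))
  moreover have "0 \<le> Re (cinner (B y) y)" "0 \<le> Re (cinner (C y) y)"
    using B C y by (auto simp: positive_op_def complex_nonneg_Reals_iff)
  ultimately have "B y = 0" "C y = 0"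
    by (auto intro!: positive_op_null[OF subspace _ y] B C)
  then have "cinner y (B x) = 0" "cinner y (C x) = 0"
    using positive_op_symmetric[OF subspace B y x] positive_op_symmetric[OF subspace C y x] by simp_all
  then have "cinner y y = 0"
    by (subst (2) y_def) (simp add: cinner_diff_right)
  then show ?thesis
    by (simp add: cinner_eq_zero_iff y_def B_def)
qed

lemma sqrt_op_eq:
  assumes "\<And>x. x \<in> S \<Longrightarrow> F x = x - A x"
  shows "sqrt_op S F = restrict (\<lambda>x. x - sqrt_lim A x) S"
  unfolding sqrt_op_def
proof (rule the_equality)
  have "positive_op S (restrict (\<lambda>x. x - sqrt_lim A x) S)"
    using positive_sqrt by (simp add: positive_op_def bounded_ops_def mem)
  then show "restrict (\<lambda>x. x - sqrt_lim A x) S \<in> extensional S \<and>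
      positive_op S (restrict (\<lambda>x. x - sqrt_lim A x) S) \<and>
      (\<forall>x\<in>S. restrict (\<lambda>x. x - sqrt_lim A x) S (restrict (\<lambda>x. x - sqrt_lim A x) S x) = F x)"
    using sqrt_squared assms by (simp add: mem sqrt_lim_mem)
next
  fix C assume C: "C \<in> extensional S \<and> positive_op S C \<and> (\<forall>x\<in>S. C (C x) = F x)"
  show "C = restrict (\<lambda>x. x - sqrt_lim A x) S"
  proof (rule extensionalityI[of _ S])
    show "C x = restrict (\<lambda>x. x - sqrt_lim A x) S x" if "x \<in> S" for x
      using sqrt_unique[of C x] C assms that by simp
  qed (use C in auto)
qed

end


section \<open>Unitary operators\<close>

lemma norm_eq_imp_cinner_eq:
  assumes S: "csubspace S" and U: "U \<in> bounded_ops S R"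
    and norm: "\<And>x. x \<in> S \<Longrightarrow> norm (U x) = norm x" and x: "x \<in> S" and y: "y \<in> S"
  shows "cinner (U x) (U y) = cinner x y"
proof -
  have inner: "inner (U u) (U v) = inner u v" if "u \<in> S" "v \<in> S" for u v
    using that norm[OF csubspace_mem(2)[OF S that]] by (simp add: dot_norm norm bounded_ops_add[OF U])
  show ?thesis
    using inner[OF x y] inner[OF x csubspace_mem(3)[OF S y, of \<i>]]
    by (simp add: cinner_eq_Complex bounded_ops_scaleC[OF U y])
qed

lemma unitaryI:
  fixes S :: "'a::chilbert_space set"
  assumes S: "closed_csubspace S" and U: "U \<in> bounded_ops S R"
    and norm: "\<And>x. x \<in> S \<Longrightarrow> norm (U x) = norm x"
    and surj: "\<And>y. y \<in> R \<Longrightarrow> \<exists>x\<in>S. U x = y"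
  shows "unitary S R U"
proof -
  note sub = closed_csubspaceD(1)[OF S]
  have inv: "adj S R U (U x) = x" if "x \<in> S" for x
    using that by (intro adj_unique[OF sub]) (auto intro: norm_eq_imp_cinner_eq[OF sub U norm])
  moreover have "U (adj S R U y) = y" if "y \<in> R" for y
    using surj[OF that] inv by auto
  ultimately show ?thesis
    using U by (simp add: unitary_def)
qed

lemma unitaryD:
  fixes S :: "'a::chilbert_space set"
  assumes S: "closed_csubspace S" and U: "unitary S R U"
  shows unitary_bounded: "U \<in> bounded_ops S R"
    and unitary_cinner: "x \<in> S \<Longrightarrow> y \<in> S \<Longrightarrow> cinner (U x) (U y) = cinner x y"
    and unitary_norm: "x \<in> S \<Longrightarrow> norm (U x) = norm x"
    and unitary_surj: "z \<in> R \<Longrightarrow> \<exists>x\<in>S. U x = z"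
    and unitary_inj: "x \<in> S \<Longrightarrow> y \<in> S \<Longrightarrow> U x = U y \<Longrightarrow> x = y"
proof -
  show Ub: "U \<in> bounded_ops S R"
    using U by (simp add: unitary_def)
  show cin: "cinner (U x) (U y) = cinner x y" if "x \<in> S" "y \<in> S" for x y
    using adj_cinner[OF S Ub \<open>x \<in> S\<close>, of "U y"] U that by (simp add: unitary_def)
  show "norm (U x) = norm x" if "x \<in> S"
    using cin[OF that that] by (simp only: cinner_self of_real_eq_iff) (simp add: power2_eq_iff_nonneg)
  show "\<exists>x\<in>S. U x = z" if "z \<in> R"
    using U that adj_mem[OF S Ub] unfolding unitary_def by blast
  show "x = y" if "x \<in> S" "y \<in> S" "U x = U y"
    using U that unfolding unitary_def by metis
qed

lemma bounded_ops_comp: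
  assumes T: "T \<in> bounded_ops S R" and T': "T' \<in> bounded_ops R Q"
  shows "(\<lambda>x. T' (T x)) \<in> bounded_ops S Q"
proof -
  obtain K where K: "K \<ge> 0" "\<And>x. x \<in> S \<Longrightarrow> norm (T x) \<le> K * norm x"
    using bounded_ops_bound[OF T] by blast
  obtain K' where K': "K' \<ge> 0" "\<And>x. x \<in> R \<Longrightarrow> norm (T' x) \<le> K' * norm x"
    using bounded_ops_bound[OF T'] by blast
  show ?thesis
  proof (rule bounded_opsI)
    show "norm (T' (T x)) \<le> (K' * K) * norm x" if "x \<in> S" for x
      using K'(2)[OF bounded_ops_mem[OF T that]] mult_left_mono[OF K(2)[OF that] K'(1)]
      by (simp add: mult.assoc)
  qed (auto simp: bounded_ops_mem[OF T] bounded_ops_mem[OF T'] bounded_ops_add[OF T]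
      bounded_ops_add[OF T'] bounded_ops_scaleC[OF T] bounded_ops_scaleC[OF T'])
qed

lemma unitary_comp:
  fixes S :: "'a::chilbert_space set" and R :: "'b::chilbert_space set"
  assumes S: "closed_csubspace S" and R: "closed_csubspace R"
    and U: "unitary S R U" and V: "unitary R Q V"
  shows "unitary S Q (\<lambda>x. V (U x))"
proof (rule unitaryI[OF S])
  note Ub = unitary_bounded[OF S U] and Vb = unitary_bounded[OF R V]
  show "(\<lambda>x. V (U x)) \<in> bounded_ops S Q"
    by (rule bounded_ops_comp[OF Ub Vb])
  show "norm (V (U x)) = norm x" if "x \<in> S" for x
    using that by (simp add: unitary_norm[OF R V] unitary_norm[OF S U] bounded_ops_mem[OF Ub])
  show "\<exists>x\<in>S. V (U x) = y" if "y \<in> Q" for y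
    using unitary_surj[OF R V that] unitary_surj[OF S U] by metis
qed

lemma unitary_cong:
  fixes S :: "'a::chilbert_space set"
  assumes S: "closed_csubspace S" and U: "unitary S R U" and eq: "\<And>x. x \<in> S \<Longrightarrow> V x = U x"
  shows "unitary S R V"
proof (rule unitaryI[OF S])
  note Ub = unitary_bounded[OF S U] and mem = csubspace_mem[OF closed_csubspaceD(1)[OF S]]
  show "V \<in> bounded_ops S R"
    by (rule bounded_opsI[where K = 1])
      (simp_all add: eq mem bounded_ops_mem[OF Ub] bounded_ops_add[OF Ub] bounded_ops_scaleC[OF Ub]
        unitary_norm[OF S U])
  show "norm (V x) = norm x" if "x \<in> S" for x
    using that by (simp add: eq unitary_norm[OF S U])
  show "\<exists>x\<in>S. V x = y" if "y \<in> R" for y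
    using unitary_surj[OF S U that] eq by metis
qed

lemma unitary_inverse:
  fixes S :: "'a::chilbert_space set" and R :: "'b::chilbert_space set"
  assumes S: "closed_csubspace S" and R: "closed_csubspace R" and U: "unitary S R U"
    and V: "\<And>y. y \<in> R \<Longrightarrow> V y \<in> S" "\<And>y. y \<in> R \<Longrightarrow> U (V y) = y"
  shows "unitary R S V"
proof (rule unitary_cong[OF R])
  note Ub = unitary_bounded[OF S U]
  show "V y = adj S R U y" if "y \<in> R" for y
    using U V[OF that] unfolding unitary_def by metis
  show "unitary R S (adj S R U)"
  proof (rule unitaryI[OF R adj_bounded_ops[OF S Ub]])
    show "norm (adj S R U y) = norm y" if "y \<in> R" for y
      using U that unitary_norm[OF S U adj_mem[OF S Ub, of y]] by (simp add: unitary_def)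
    show "\<exists>y\<in>R. adj S R U y = x" if "x \<in> S" for x
      using U that bounded_ops_mem[OF Ub that] unfolding unitary_def by metis
  qed
qed

lemma norm_prod_sq: "(norm p)\<^sup>2 = (norm (fst p))\<^sup>2 + (norm (snd p))\<^sup>2"
  for p :: "'a::real_normed_vector \<times> 'b::real_normed_vector"
  by (simp add: norm_prod_def)

lemma norm_prod_eqI:
  fixes p :: "'a::real_normed_vector \<times> 'b::real_normed_vector"
    and q :: "'c::real_normed_vector \<times> 'd::real_normed_vector"
  assumes "(norm (fst p))\<^sup>2 + (norm (snd p))\<^sup>2 = (norm (fst q))\<^sup>2 + (norm (snd q))\<^sup>2"
  shows "norm p = norm q"
  using assms by (simp add: norm_prod_def)

lemma unitary_map_prod_id:
  fixes S :: "'a::chilbert_space set" and P :: "'c::chilbert_space set"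
  assumes P: "closed_csubspace P" and S: "closed_csubspace S" and U: "unitary S R U"
  shows "unitary (P \<times> S) (P \<times> R) (map_prod id U)"
proof (rule unitaryI[OF closed_csubspace_Times[OF P S]])
  note Ub = unitary_bounded[OF S U]
  have norm: "norm (map_prod id U p) = norm p" if "p \<in> P \<times> S" for p
    using that by (intro norm_prod_eqI) (auto simp: unitary_norm[OF S U])
  then show "norm (map_prod id U p) = norm p" if "p \<in> P \<times> S" for p
    using that .
  show "map_prod id U \<in> bounded_ops (P \<times> S) (P \<times> R)"
    by (rule bounded_opsI[where K = 1])
      (auto simp: norm bounded_ops_mem[OF Ub] bounded_ops_add[OF Ub] bounded_ops_scaleC[OF Ub]
        scaleC_prod_def)
  show "\<exists>x\<in>P \<times> S. map_prod id U x = y" if "y \<in> P \<times> R" for y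
    using that unitary_surj[OF S U, of "snd y"] by (cases y) force
qed


section \<open>Defect operators and elementary rotations\<close>

lemma sqrt_op_cong: "(\<And>x. x \<in> S \<Longrightarrow> F x = G x) \<Longrightarrow> sqrt_op S F = sqrt_op S G"
  by (simp add: sqrt_op_def)

locale hilbert_contraction =
  fixes S :: "'a::chilbert_space set" and R :: "'b::chilbert_space set" and T :: "'a \<Rightarrow> 'b"
  assumes S: "closed_csubspace S" and R: "closed_csubspace R" and T: "contraction S R T"
begin

abbreviation "Tadj \<equiv> adj S R T"
abbreviation "D \<equiv> defect S R T"
abbreviation "Dadj \<equiv> defect_adj S R T"

lemmas subspaces = closed_csubspaceD(1)[OF S] closed_csubspaceD(1)[OF R]
lemmas S_mem = csubspace_mem[OF subspaces(1)]
lemmas R_mem = csubspace_mem[OF subspaces(2)]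
lemmas T_bounded = contractionD(1)[OF T]
lemmas Tadj_contraction = contraction_adj[OF S T]
lemmas Tadj_bounded = contractionD(1)[OF Tadj_contraction]
lemmas T_mem = bounded_ops_mem[OF T_bounded]
lemmas Tadj_mem = adj_mem[OF S T_bounded]

lemma dual: "hilbert_contraction R S Tadj"
  by (simp add: hilbert_contraction_def S R Tadj_contraction)

lemma defect_adj_eq_defect: "Dadj = defect R S Tadj"
  unfolding defect_def defect_adj_def
  by (rule sqrt_op_cong) (simp add: adj_adj[OF S R T_bounded] Tadj_mem)

lemma defect_adj_space_eq_defect_space: "defect_adj_space S R T = defect_space R S Tadj"
  by (simp add: defect_adj_space_def defect_space_def defect_adj_eq_defect)

lemma defect_dual_eq_defect_adj: "defect_adj R S Tadj = D"
  unfolding defect_def defect_adj_def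
  by (rule sqrt_op_cong) (simp add: adj_adj[OF S R T_bounded])

lemma defect_adj_space_dual: "defect_adj_space R S Tadj = defect_space S R T"
  by (simp add: defect_adj_space_def defect_space_def defect_dual_eq_defect_adj)

sublocale gram: selfadjoint_contraction S "\<lambda>x. Tadj (T x)"
proof
  show "contraction S S (\<lambda>x. Tadj (T x))"
    unfolding contraction_def
  proof (intro conjI ballI)
    show "(\<lambda>x. Tadj (T x)) \<in> bounded_ops S S"
      by (rule bounded_ops_comp[OF T_bounded Tadj_bounded])
    show "norm (Tadj (T x)) \<le> norm x" if "x \<in> S" for x
      using contractionD(2)[OF Tadj_contraction T_mem[OF that]] contractionD(2)[OF T that] by simp
  qed
  show "cinner (Tadj (T x)) y = cinner x (Tadj (T y))" if "x \<in> S" "y \<in> S" for x y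
    using that by (simp add: adj_cinner'[OF S T_bounded] flip: adj_cinner[OF S T_bounded])
qed (rule S)

lemma defect_eq: "x \<in> S \<Longrightarrow> D x = x - sqrt_lim (\<lambda>x. Tadj (T x)) x"
  unfolding defect_def by (subst gram.sqrt_op_eq) auto

lemma defect_positive: "positive_op S D"
  using gram.positive_sqrt by (simp add: positive_op_def bounded_ops_def defect_eq S_mem)

lemma defect_bounded: "D \<in> bounded_ops S S"
  using defect_positive by (simp add: positive_op_def)

lemmas defect_mem = bounded_ops_mem[OF defect_bounded]

lemma defect_symmetric: "x \<in> S \<Longrightarrow> y \<in> S \<Longrightarrow> cinner (D x) y = cinner x (D y)"
  by (rule positive_op_symmetric[OF subspaces(1) defect_positive])

lemma defect_squared: "x \<in> S \<Longrightarrow> D (D x) = x - Tadj (T x)"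
  using gram.sqrt_squared[of x] defect_mem[of x] by (simp add: defect_eq)

lemma defect_norm:
  assumes x: "x \<in> S"
  shows "(norm (T x))\<^sup>2 + (norm (D x))\<^sup>2 = (norm x)\<^sup>2"
proof -
  have "complex_of_real ((norm (T x))\<^sup>2 + (norm (D x))\<^sup>2) = cinner (T x) (T x) + cinner (D x) (D x)"
    by (simp add: cinner_self)
  also have "\<dots> = cinner x (Tadj (T x)) + cinner x (D (D x))"
    using x by (simp add: adj_cinner[OF S T_bounded] defect_symmetric defect_mem)
  also have "\<dots> = cinner x x"
    using x by (simp add: defect_squared flip: cinner_add_right)
  finally show ?thesis
    by (simp only: cinner_self of_real_eq_iff)
qed

lemma closed_defect_space: "closed_csubspace (defect_space S R T)"
  unfolding defect_space_def
  by (intro closed_csubspace_closure csubspace_image[OF defect_bounded subspaces(1)])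

lemma defect_space_subset: "defect_space S R T \<subseteq> S"
  unfolding defect_space_def
  by (intro closure_minimal closed_csubspaceD(2)[OF S]) (auto intro: defect_mem)

lemma defect_in_defect_space: "x \<in> S \<Longrightarrow> D x \<in> defect_space S R T"
  unfolding defect_space_def using closure_subset by fast

text \<open>
  A vector in the closure of the range of the selfadjoint operator \<open>D\<close> that \<open>D\<close>
  annihilates is orthogonal to the range of \<open>D\<close>, hence to itself.
\<close>

lemma defect_injective:
  assumes x: "x \<in> defect_space S R T" and 0: "D x = 0"
  shows "x = 0"
proof -
  have xS: "x \<in> S"
    using x defect_space_subset by blast
  obtain f where f: "\<And>n. f n \<in> D ` S" "f \<longlonglongrightarrow> x"
    using x unfolding defect_space_def closure_sequential by blast
  have "cinner (f n) x = 0" for n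
    using f(1)[of n] xS 0 by (auto simp: defect_symmetric)
  moreover have "(\<lambda>n. cinner (f n) x) \<longlonglongrightarrow> cinner x x"
    by (intro tendsto_cinner f tendsto_const)
  ultimately have "cinner x x = 0"
    by (simp add: LIMSEQ_const_iff)
  then show ?thesis
    by (simp add: cinner_eq_zero_iff)
qed

lemma defect_intertwines: "x \<in> S \<Longrightarrow> T (D x) = Dadj (T x)"
proof -
  assume x: "x \<in> S"
  interpret dual: hilbert_contraction R S Tadj by (rule dual)
  have "T (sqrt_lim (\<lambda>x. Tadj (T x)) x) = sqrt_lim (\<lambda>y. adj R S Tadj (Tadj y)) (T x)"
    using x
    by (intro sqrt_lim_intertwines[OF gram.selfadjoint_contraction_axioms
          dual.gram.selfadjoint_contraction_axioms T_bounded])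
      (simp_all add: adj_adj[OF S R T_bounded] Tadj_mem)
  then show ?thesis
    using x by (simp add: defect_adj_eq_defect defect_eq dual.defect_eq T_mem
        bounded_ops_diff[OF T_bounded subspaces(1)] gram.sqrt_lim_mem)
qed

lemma maps_defect_space:
  assumes x: "x \<in> defect_space S R T"
  shows "T x \<in> defect_adj_space S R T"
  unfolding defect_adj_space_def
proof (rule bounded_ops_closure[OF T_bounded S])
  show "x \<in> closure (D ` S)"
    using x by (simp add: defect_space_def)
qed (auto simp: defect_mem defect_intertwines T_mem)

lemma closed_defect_adj_space: "closed_csubspace (defect_adj_space S R T)"
  using hilbert_contraction.closed_defect_space[OF dual]
  by (simp add: defect_adj_space_eq_defect_space)

lemma defect_adj_space_subset: "defect_adj_space S R T \<subseteq> R"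
  using hilbert_contraction.defect_space_subset[OF dual]
  by (simp add: defect_adj_space_eq_defect_space)

lemma defect_adj_intertwines: "y \<in> R \<Longrightarrow> Tadj (Dadj y) = D (Tadj y)"
  using hilbert_contraction.defect_intertwines[OF dual]
  by (simp add: defect_dual_eq_defect_adj defect_adj_eq_defect)

lemma adj_maps_defect_space: "y \<in> defect_adj_space S R T \<Longrightarrow> Tadj y \<in> defect_space S R T"
  using hilbert_contraction.maps_defect_space[OF dual, of y]
  by (simp add: defect_adj_space_eq_defect_space defect_adj_space_dual)

lemma defect_adj_bounded: "Dadj \<in> bounded_ops R R"
  using hilbert_contraction.defect_bounded[OF dual] by (simp add: defect_adj_eq_defect)

lemma defect_adj_squared: "y \<in> R \<Longrightarrow> Dadj (Dadj y) = y - T (Tadj y)"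
  using hilbert_contraction.defect_squared[OF dual, of y]
  by (simp add: defect_adj_eq_defect adj_adj[OF S R T_bounded] Tadj_mem)

lemma defect_adj_symmetric: "x \<in> R \<Longrightarrow> y \<in> R \<Longrightarrow> cinner (Dadj x) y = cinner x (Dadj y)"
  using hilbert_contraction.defect_symmetric[OF dual] by (simp add: defect_adj_eq_defect)

lemma defect_adj_norm: "y \<in> R \<Longrightarrow> (norm (Tadj y))\<^sup>2 + (norm (Dadj y))\<^sup>2 = (norm y)\<^sup>2"
  using hilbert_contraction.defect_norm[OF dual] by (simp add: defect_adj_eq_defect)

lemma defect_adj_injective: "y \<in> defect_adj_space S R T \<Longrightarrow> Dadj y = 0 \<Longrightarrow> y = 0"
  using hilbert_contraction.defect_injective[OF dual]
  by (simp add: defect_adj_space_eq_defect_space defect_adj_eq_defect)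

lemma defect_adj_in_space: "y \<in> R \<Longrightarrow> Dadj y \<in> defect_adj_space S R T"
  unfolding defect_adj_space_def using closure_subset by fast

text \<open>
  The rotation is unitary because \<open>D\<^sub>T\<^sup>2 + T\<^sup>* T = I\<close>, the same holds for \<open>T\<^sup>*\<close>, and \<open>T\<close>
  intertwines the two defect operators. The preimage in the proof is the value of the adjoint.
\<close>

lemma elementary_rotation_unitary:
  "unitary (S \<times> defect_adj_space S R T) (R \<times> defect_space S R T) (elementary_rotation S R T)"
proof -
  let ?J = "elementary_rotation S R T"
  note adj_sub = subsetD[OF defect_adj_space_subset] and sub = subsetD[OF defect_space_subset]
  note mems = T_mem Tadj_mem defect_mem bounded_ops_mem[OF defect_adj_bounded] R_mem S_mem
  have norm: "norm (?J p) = norm p" if "p \<in> S \<times> defect_adj_space S R T" for p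
  proof (rule norm_prod_eqI)
    obtain x y where p: "p = (x, y)" and x: "x \<in> S" and y: "y \<in> R"
      using \<open>p \<in> S \<times> defect_adj_space S R T\<close> adj_sub by (cases p) auto
    have "cinner (T x) (Dadj y) = cinner (D x) (Tadj y)"
      using x y mems by (simp add: defect_intertwines flip: defect_adj_symmetric adj_cinner[OF S T_bounded])
    then have "inner (T x) (Dadj y) = inner (D x) (Tadj y)"
      by (metis Re_cinner)
    then have "(norm (T x + Dadj y))\<^sup>2 + (norm (D x - Tadj y))\<^sup>2 =
        ((norm (T x))\<^sup>2 + (norm (D x))\<^sup>2) + ((norm (Tadj y))\<^sup>2 + (norm (Dadj y))\<^sup>2)"
      by (simp add: power2_norm_eq_inner inner_simps inner_commute)
    then show "(norm (fst (?J p)))\<^sup>2 + (norm (snd (?J p)))\<^sup>2 = (norm (fst p))\<^sup>2 + (norm (snd p))\<^sup>2"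
      using x y by (simp add: p elementary_rotation_def defect_norm defect_adj_norm)
  qed
  show ?thesis
  proof (rule unitaryI[OF closed_csubspace_Times[OF S closed_defect_adj_space] _ norm])
    show "?J \<in> bounded_ops (S \<times> defect_adj_space S R T) (R \<times> defect_space S R T)"
    proof (rule bounded_opsI[where K = 1])
      show "?J p \<in> R \<times> defect_space S R T" if "p \<in> S \<times> defect_adj_space S R T" for p
        using that csubspace_mem(5)[OF closed_csubspaceD(1)[OF closed_defect_space]] adj_sub
        by (auto simp: elementary_rotation_def mems defect_in_defect_space adj_maps_defect_space)
      show "norm (?J p) \<le> 1 * norm p" if "p \<in> S \<times> defect_adj_space S R T" for p
        using norm[OF that] by simp
    qed (auto dest!: adj_sub simp: elementary_rotation_def scaleC_prod_def
        scaleC_add_right complex_vector.scale_right_diff_distrib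
        bounded_ops_add[OF T_bounded] bounded_ops_add[OF Tadj_bounded]
        bounded_ops_add[OF defect_bounded] bounded_ops_add[OF defect_adj_bounded]
        bounded_ops_scaleC[OF T_bounded] bounded_ops_scaleC[OF Tadj_bounded]
        bounded_ops_scaleC[OF defect_bounded] bounded_ops_scaleC[OF defect_adj_bounded])
    show "\<exists>p\<in>S \<times> defect_adj_space S R T. ?J p = q" if "q \<in> R \<times> defect_space S R T" for q
    proof -
      obtain r d where q: "q = (r, d)" and r: "r \<in> R" and d': "d \<in> defect_space S R T"
        using \<open>q \<in> R \<times> defect_space S R T\<close> by (cases q) auto
      have d: "d \<in> S" by (rule sub[OF d'])
      let ?p = "(Tadj r + D d, Dadj r - T d)"
      have "?p \<in> S \<times> defect_adj_space S R T"
        using r d maps_defect_space[OF d'] defect_adj_in_space[OF r]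
          csubspace_mem(5)[OF closed_csubspaceD(1)[OF closed_defect_adj_space]]
        by (simp add: mems)
      moreover have "?J ?p = q"
        using r d
        by (simp add: q elementary_rotation_def mems bounded_ops_add[OF T_bounded]
            bounded_ops_add[OF defect_bounded] bounded_ops_diff[OF Tadj_bounded subspaces(2)]
            bounded_ops_diff[OF defect_adj_bounded subspaces(2)]
            defect_intertwines defect_adj_intertwines defect_squared defect_adj_squared)
      ultimately show ?thesis by blast
    qed
  qed
qed

lemma elementary_rotation_fst_eq_0:
  assumes "y \<in> defect_adj_space S R T" "fst (elementary_rotation S R T (0, y)) = 0"
  shows "y = 0"
  using assms bounded_ops_zero[OF T_bounded subspaces(1)]
  by (auto simp: elementary_rotation_def intro: defect_adj_injective)

end


section \<open>Operators on square-summable sequences\<close>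

lemma ell2_eqI: "(\<And>n. ell2_nth x n = ell2_nth y n) \<Longrightarrow> x = y"
  by (metis ell2_nth_inject ext)

lemmas ell2_nth_simps = zero_ell2.rep_eq plus_ell2.rep_eq scaleC_ell2.rep_eq

lemma bounded_linear_ell2_nth: "bounded_linear (\<lambda>x. ell2_nth x n)"
proof (rule bounded_linear_intro)
  show "norm (ell2_nth x n) \<le> norm x * 1" for x :: "'a ell2"
    using norm_ell2_nth_le[of x n] by simp
qed (simp_all add: plus_ell2.rep_eq scaleR_ell2.rep_eq)

lemma closed_csubspace_ell2:
  fixes S :: "nat \<Rightarrow> 'a::complex_inner set"
  assumes S: "\<And>n. closed_csubspace (S n)"
  shows "closed_csubspace {x. \<forall>n. ell2_nth x n \<in> S n}"
  unfolding closed_csubspace_def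
proof
  show "csubspace {x. \<forall>n. ell2_nth x n \<in> S n}"
    by (rule csubspaceI) (auto simp: ell2_nth_simps csubspace_mem[OF closed_csubspaceD(1)[OF S]])
  have "closed ((\<lambda>x. ell2_nth x n) -` S n)" for n
    by (intro closed_vimage closed_csubspaceD(2)[OF S] linear_continuous_on bounded_linear_ell2_nth)
  then have "closed (\<Inter>n. (\<lambda>x. ell2_nth x n) -` S n)"
    by blast
  also have "(\<Inter>n. (\<lambda>x. ell2_nth x n) -` S n) = {x. \<forall>n. ell2_nth x n \<in> S n}"
    by auto
  finally show "closed {x. \<forall>n. ell2_nth x n \<in> S n}" .
qed

lemma ell2_nth_Abs: "summable (\<lambda>n. (norm (f n))\<^sup>2) \<Longrightarrow> ell2_nth (Abs_ell2 f) = f"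
  by (simp add: Abs_ell2_inverse)

definition ell2_map :: "(nat \<Rightarrow> 'a::complex_inner \<Rightarrow> 'b::complex_inner) \<Rightarrow> 'a ell2 \<Rightarrow> 'b ell2"
  where "ell2_map F x = Abs_ell2 (\<lambda>n. F n (ell2_nth x n))"

context
  fixes S :: "nat \<Rightarrow> 'a::chilbert_space set" and R :: "nat \<Rightarrow> 'b::chilbert_space set" and F
  assumes S: "\<And>n. closed_csubspace (S n)" and R: "\<And>n. closed_csubspace (R n)"
    and F: "\<And>n. unitary (S n) (R n) (F n)"
begin

lemma ell2_nth_map:
  assumes "\<And>n. ell2_nth x n \<in> S n"
  shows "ell2_nth (ell2_map F x) n = F n (ell2_nth x n)"
  unfolding ell2_map_def
  by (subst ell2_nth_Abs) (simp_all add: unitary_norm[OF S F assms] summable_norm_ell2)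

lemma unitary_ell2_map:
  "unitary {x. \<forall>n. ell2_nth x n \<in> S n} {y. \<forall>n. ell2_nth y n \<in> R n} (ell2_map F)"
proof (rule unitaryI[OF closed_csubspace_ell2[OF S]])
  note Fb = unitary_bounded[OF S F]
  note mem = csubspace_mem[OF closed_csubspaceD(1)[OF S]]
  have norm: "norm (ell2_map F x) = norm x" if "x \<in> {x. \<forall>n. ell2_nth x n \<in> S n}" for x
    using that by (simp add: norm_ell2_def ell2_nth_map unitary_norm[OF S F])
  then show "norm (ell2_map F x) = norm x" if "x \<in> {x. \<forall>n. ell2_nth x n \<in> S n}" for x
    using that .
  show "ell2_map F \<in> bounded_ops {x. \<forall>n. ell2_nth x n \<in> S n} {y. \<forall>n. ell2_nth y n \<in> R n}"
  proof (rule bounded_opsI[where K = 1])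
    show "norm (ell2_map F x) \<le> 1 * norm x" if "x \<in> {x. \<forall>n. ell2_nth x n \<in> S n}" for x
      using norm[OF that] by simp
  qed (auto intro!: ell2_eqI simp: ell2_nth_map ell2_nth_simps mem bounded_ops_mem[OF Fb]
      bounded_ops_add[OF Fb] bounded_ops_scaleC[OF Fb])
  show "\<exists>x\<in>{x. \<forall>n. ell2_nth x n \<in> S n}. ell2_map F x = y"
    if y: "y \<in> {y. \<forall>n. ell2_nth y n \<in> R n}" for y
  proof -
    have "\<exists>u\<in>S n. F n u = ell2_nth y n" for n
      using unitary_surj[OF S F] y by blast
    then obtain f where f: "\<And>n. f n \<in> S n" "\<And>n. F n (f n) = ell2_nth y n"
      by metis
    have "norm (f n) = norm (ell2_nth y n)" for n
      using unitary_norm[OF S F f(1)] f(2) by metis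
    then have nth: "ell2_nth (Abs_ell2 f) = f"
      using summable_norm_ell2[of y] by (intro ell2_nth_Abs) simp
    show ?thesis
      by (rule bexI[of _ "Abs_ell2 f"]) (auto intro!: ell2_eqI simp: ell2_nth_map nth f)
  qed
qed

end

text \<open>
  The two regroupings between which the block diagonal operator of the rotations of
  \<open>\<Gamma> 0, \<Gamma> 2, \<Gamma> 4, \<dots>\<close> acts.
\<close>

definition regroup :: "'p::complex_inner \<times> ('q::complex_inner \<times> 'p) ell2 \<Rightarrow> ('p \<times> 'q) ell2"
  where "regroup = (\<lambda>(m, y).
    Abs_ell2 (\<lambda>n. ((case n of 0 \<Rightarrow> m | Suc j \<Rightarrow> snd (ell2_nth y j)), fst (ell2_nth y n))))"

definition ungroup :: "('p::complex_inner \<times> 'q::complex_inner) ell2 \<Rightarrow> 'p \<times> ('q \<times> 'p) ell2"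
  where "ungroup x = (fst (ell2_nth x 0),
    Abs_ell2 (\<lambda>n. (snd (ell2_nth x n), fst (ell2_nth x (Suc n)))))"

lemma summable_fst_snd_ell2:
  shows summable_fst_ell2: "summable (\<lambda>n. (norm (fst (ell2_nth x n)))\<^sup>2)"
    and summable_snd_ell2: "summable (\<lambda>n. (norm (snd (ell2_nth x n)))\<^sup>2)"
  by (rule summable_comparison_test'[OF summable_norm_ell2[of x]], simp add: norm_prod_sq)+

lemma regroup_sums:
  fixes m :: "'p::complex_inner" and y :: "('q::complex_inner \<times> 'p) ell2"
  defines "f \<equiv> \<lambda>n. ((case n of 0 \<Rightarrow> m | Suc j \<Rightarrow> snd (ell2_nth y j)), fst (ell2_nth y n))"
  shows "(\<lambda>n. (norm (f n))\<^sup>2) sums (norm (m, y))\<^sup>2"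
proof -
  let ?a = "\<lambda>n. (norm (case n of 0 \<Rightarrow> m | Suc j \<Rightarrow> snd (ell2_nth y j)))\<^sup>2"
  let ?b = "\<lambda>n. (norm (fst (ell2_nth y n)))\<^sup>2" and ?c = "\<lambda>n. (norm (snd (ell2_nth y n)))\<^sup>2"
  have "(\<lambda>n. ?a (Suc n)) sums (\<Sum>n. ?c n)"
    using summable_snd_ell2[of y] by (simp add: summable_sums)
  then have "?a sums ((\<Sum>n. ?c n) + (norm m)\<^sup>2)"
    by (subst (asm) sums_Suc_iff) simp
  then have "(\<lambda>n. ?a n + ?b n) sums ((\<Sum>n. ?c n) + (norm m)\<^sup>2 + (\<Sum>n. ?b n))"
    by (intro sums_add summable_sums summable_fst_ell2)
  also have "(\<Sum>n. ?c n) + (norm m)\<^sup>2 + (\<Sum>n. ?b n) = (norm (m, y))\<^sup>2"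
    by (simp add: norm_prod_sq norm_ell2_sq suminf_add[symmetric] summable_fst_ell2 summable_snd_ell2)
  finally show ?thesis
    by (simp add: f_def norm_prod_sq)
qed

lemma ell2_nth_regroup:
  "ell2_nth (regroup (m, y)) n =
    ((case n of 0 \<Rightarrow> m | Suc j \<Rightarrow> snd (ell2_nth y j)), fst (ell2_nth y n))"
  unfolding regroup_def using ell2_nth_Abs[OF sums_summable[OF regroup_sums[of m y]]] by simp

lemma norm_regroup: "norm (regroup p) = norm p"
proof -
  obtain m y where p: "p = (m, y)" by fastforce
  have "(norm (regroup p))\<^sup>2 = (norm p)\<^sup>2"
    using sums_unique[OF regroup_sums[of m y]] by (simp add: p norm_ell2_sq ell2_nth_regroup)
  then show ?thesis
    by (simp add: power2_eq_iff_nonneg)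
qed

lemma ell2_nth_snd_ungroup:
  "ell2_nth (snd (ungroup x)) n = (snd (ell2_nth x n), fst (ell2_nth x (Suc n)))"
proof -
  have "summable (\<lambda>n. (norm (snd (ell2_nth x n)))\<^sup>2 + (norm (fst (ell2_nth x (Suc n))))\<^sup>2)"
    by (intro summable_add summable_snd_ell2) (simp add: summable_fst_ell2 summable_Suc_iff[where f = "\<lambda>n. (norm (fst (ell2_nth x n)))\<^sup>2"])
  then show ?thesis
    unfolding ungroup_def by (simp add: ell2_nth_Abs norm_prod_sq)
qed

lemma regroup_ungroup: "regroup (ungroup x) = x"
proof (rule ell2_eqI)
  have "regroup (ungroup x) = regroup (fst (ungroup x), snd (ungroup x))" by simp
  also have "ell2_nth \<dots> n = ell2_nth x n" for n
    by (simp only: ell2_nth_regroup ell2_nth_snd_ungroup)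
      (simp add: ungroup_def prod_eq_iff split: nat.split)
  finally show "ell2_nth (regroup (ungroup x)) n = ell2_nth x n" for n .
qed

context
  fixes P :: "nat \<Rightarrow> 'p::chilbert_space set" and Q :: "nat \<Rightarrow> 'q::chilbert_space set"
  assumes P: "\<And>n. closed_csubspace (P n)" and Q: "\<And>n. closed_csubspace (Q n)"
begin

lemma ungroup_mem:
  assumes "x \<in> {x. \<forall>n. ell2_nth x n \<in> P n \<times> Q n}"
  shows "ungroup x \<in> P 0 \<times> {y. \<forall>n. ell2_nth y n \<in> Q n \<times> P (Suc n)}"
  using assms by (simp add: mem_Times_iff ell2_nth_snd_ungroup) (simp add: ungroup_def)

lemma unitary_regroup:
  "unitary (P 0 \<times> {y. \<forall>n. ell2_nth y n \<in> Q n \<times> P (Suc n)}) {x. \<forall>n. ell2_nth x n \<in> P n \<times> Q n}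
    regroup"
proof (rule unitaryI)
  show "closed_csubspace (P 0 \<times> {y. \<forall>n. ell2_nth y n \<in> Q n \<times> P (Suc n)})"
    by (intro closed_csubspace_Times closed_csubspace_ell2 P Q)
  show "regroup \<in> bounded_ops (P 0 \<times> {y. \<forall>n. ell2_nth y n \<in> Q n \<times> P (Suc n)})
      {x. \<forall>n. ell2_nth x n \<in> P n \<times> Q n}"
  proof (rule bounded_opsI[where K = 1])
    show "norm (regroup p) \<le> 1 * norm p" for p :: "'p \<times> ('q \<times> 'p) ell2"
      by (simp add: norm_regroup)
  qed (auto intro!: ell2_eqI simp: ell2_nth_regroup ell2_nth_simps scaleC_prod_def mem_Times_iff
      split: nat.split)
  show "norm (regroup p) = norm p" for p :: "'p \<times> ('q \<times> 'p) ell2"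
    by (rule norm_regroup)
  show "\<exists>p\<in>P 0 \<times> {y. \<forall>n. ell2_nth y n \<in> Q n \<times> P (Suc n)}. regroup p = x"
    if "x \<in> {x. \<forall>n. ell2_nth x n \<in> P n \<times> Q n}" for x
    by (rule bexI[of _ "ungroup x"]) (rule regroup_ungroup ungroup_mem[OF that])+
qed

lemma unitary_ungroup:
  "unitary {x. \<forall>n. ell2_nth x n \<in> P n \<times> Q n} (P 0 \<times> {y. \<forall>n. ell2_nth y n \<in> Q n \<times> P (Suc n)})
    ungroup"
proof (rule unitary_inverse[OF _ _ unitary_regroup])
  show "closed_csubspace (P 0 \<times> {y. \<forall>n. ell2_nth y n \<in> Q n \<times> P (Suc n)})"
    by (intro closed_csubspace_Times closed_csubspace_ell2 P Q)
  show "closed_csubspace {x. \<forall>n. ell2_nth x n \<in> P n \<times> Q n}"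
    by (intro closed_csubspace_Times closed_csubspace_ell2 P Q)
qed (auto simp: regroup_ungroup intro: ungroup_mem simp del: mem_Sigma_iff)

end


section \<open>Choice sequences and the unitarity of block operator CMV matrices\<close>

locale choice_sequence =
  fixes M :: "'a::chilbert_space set" and N :: "'b::chilbert_space set" and \<Gamma> :: "nat \<Rightarrow> 'a \<Rightarrow> 'b"
  assumes M: "closed_csubspace M" and N: "closed_csubspace N"
    and contractions: "\<And>n. contraction (par_dom M N \<Gamma> n) (par_cod M N \<Gamma> n) (\<Gamma> n)"
begin

abbreviation "pdom \<equiv> par_dom M N \<Gamma>"
abbreviation "pcod \<equiv> par_cod M N \<Gamma>"
abbreviation "J \<equiv> par_rotation M N \<Gamma>"

lemma par_0 [simp]: "pdom 0 = M" "pcod 0 = N"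
  by (simp_all add: par_dom_def par_cod_def)

lemma par_Suc:
  "pdom (Suc n) = defect_space (pdom n) (pcod n) (\<Gamma> n)"
  "pcod (Suc n) = defect_adj_space (pdom n) (pcod n) (\<Gamma> n)"
  by (simp_all add: par_dom_def par_cod_def Let_def split_beta)

lemma closed_par: shows closed_dom: "closed_csubspace (pdom n)" and closed_cod: "closed_csubspace (pcod n)"
proof (induction n)
  case 0
  { case 1 show ?case by (simp add: M)
  next case 2 show ?case by (simp add: N) }
next
  case (Suc n)
  interpret hilbert_contraction "pdom n" "pcod n" "\<Gamma> n"
    by (intro hilbert_contraction.intro Suc contractions)
  { case 1 show ?case by (simp add: par_Suc closed_defect_space)
  next case 2 show ?case by (simp add: par_Suc closed_defect_adj_space) }
qed

lemma hilbert_contraction_par: "hilbert_contraction (pdom n) (pcod n) (\<Gamma> n)"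
  by (intro hilbert_contraction.intro closed_dom closed_cod contractions)

lemma unitary_J: "unitary (pdom n \<times> pcod (Suc n)) (pcod n \<times> pdom (Suc n)) (J n)"
  using hilbert_contraction.elementary_rotation_unitary[OF hilbert_contraction_par]
  by (simp add: par_rotation_def par_Suc)

lemma J_fst_eq_0: "y \<in> pcod (Suc n) \<Longrightarrow> fst (J n (0, y)) = 0 \<Longrightarrow> y = 0"
  using hilbert_contraction.elementary_rotation_fst_eq_0[OF hilbert_contraction_par]
  by (simp add: par_rotation_def par_Suc)

lemmas J_dom_closed = closed_csubspace_Times[OF closed_dom closed_cod]
lemmas J_cod_closed = closed_csubspace_Times[OF closed_cod closed_dom]
lemmas J_bounded = unitary_bounded[OF J_dom_closed unitary_J]
lemmas J_norm = unitary_norm[OF J_dom_closed unitary_J]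

lemma J_0 [simp]: "J n (0, 0) = (0, 0)"
  using bounded_ops_zero[OF J_bounded closed_csubspaceD(1)[OF J_dom_closed], of n]
  by (simp add: zero_prod_def)

lemma cmv_space_eq:
  "cmv_space M N \<Gamma> = {x. \<forall>n. ell2_nth x n \<in> pdom (2*n+1) \<times> pcod (2*n+2)}"
  "cmv_space' M N \<Gamma> = {y. \<forall>n. ell2_nth y n \<in> pcod (2*n+1) \<times> pdom (2*n+2)}"
  unfolding cmv_space_def cmv_space'_def by (simp_all add: par_Suc numeral_2_eq_2)

lemma closed_cmv_space: "closed_csubspace (cmv_space M N \<Gamma>)" "closed_csubspace (cmv_space' M N \<Gamma>)"
  unfolding cmv_space_eq
  by (intro closed_csubspace_ell2 closed_csubspace_Times closed_dom closed_cod)+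

lemma unitary_J_odd: "unitary (pdom (2*n+1) \<times> pcod (2*n+2)) (pcod (2*n+1) \<times> pdom (2*n+2)) (J (2*n+1))"
  using unitary_J[of "2*n+1"] by simp

lemma unitary_V: "unitary (cmv_space M N \<Gamma>) (cmv_space' M N \<Gamma>) (cmv_V M N \<Gamma>)"
  using unitary_ell2_map[where F = "\<lambda>n. J (2*n+1)", OF J_dom_closed J_cod_closed unitary_J_odd]
  unfolding cmv_space_eq by (simp add: cmv_V_def[abs_def] ell2_map_def[abs_def])

lemma V_nth:
  assumes "x \<in> cmv_space M N \<Gamma>"
  shows "ell2_nth (cmv_V M N \<Gamma> x) n = J (2*n+1) (ell2_nth x n)"
  using ell2_nth_map[where F = "\<lambda>n. J (2*n+1)", OF J_dom_closed J_cod_closed unitary_J_odd, of x n] assms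
  unfolding cmv_space_eq by (simp add: cmv_V_def ell2_map_def)

lemma unitary_J_even: "unitary (pdom (2*n) \<times> pcod (2*n+1)) (pcod (2*n) \<times> pdom (2*n+1)) (J (2*n))"
  using unitary_J[of "2*n"] by simp

abbreviation "even_rotations \<equiv> ell2_map (\<lambda>n. J (2 * n))"

lemma unitary_even_rotations:
  "unitary {x. \<forall>n. ell2_nth x n \<in> pdom (2*n) \<times> pcod (2*n+1)}
    {x. \<forall>n. ell2_nth x n \<in> pcod (2*n) \<times> pdom (2*n+1)} even_rotations"
  using unitary_ell2_map[where F = "\<lambda>n. J (2*n)", OF J_dom_closed J_cod_closed unitary_J_even] .

lemma unitary_regroup_cmv:
  "unitary (M \<times> cmv_space' M N \<Gamma>) {x. \<forall>n. ell2_nth x n \<in> pdom (2*n) \<times> pcod (2*n+1)} regroup"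
  using unitary_regroup[of "\<lambda>n. pdom (2*n)" "\<lambda>n. pcod (2*n+1)", OF closed_dom closed_cod]
  by (simp add: cmv_space_eq)

lemma L_nth:
  assumes p: "(m, y) \<in> M \<times> cmv_space' M N \<Gamma>"
  defines "w \<equiv> \<lambda>n. J (2*n) ((case n of 0 \<Rightarrow> m | Suc j \<Rightarrow> snd (ell2_nth y j)), fst (ell2_nth y n))"
  shows L_eq_ungroup: "cmv_L M N \<Gamma> (m, y) = ungroup (even_rotations (regroup (m, y)))"
    and fst_L: "fst (cmv_L M N \<Gamma> (m, y)) = fst (w 0)"
    and snd_L_nth: "ell2_nth (snd (cmv_L M N \<Gamma> (m, y))) n = (snd (w n), fst (w (Suc n)))"
proof -
  have "regroup (m, y) \<in> {x. \<forall>n. ell2_nth x n \<in> pdom (2*n) \<times> pcod (2*n+1)}"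
    using bounded_ops_mem[OF unitary_bounded[OF closed_csubspace_Times[OF M closed_cmv_space(2)]
          unitary_regroup_cmv] p] .
  then have nth: "ell2_nth (even_rotations (regroup (m, y))) n = w n" for n
    using ell2_nth_map[where F = "\<lambda>n. J (2*n)", OF J_dom_closed J_cod_closed unitary_J_even,
        of "regroup (m, y)" n]
    by (simp add: w_def ell2_nth_regroup)
  show eq: "cmv_L M N \<Gamma> (m, y) = ungroup (even_rotations (regroup (m, y)))"
    unfolding cmv_L_def ungroup_def nth by (simp add: w_def Let_def)
  show "fst (cmv_L M N \<Gamma> (m, y)) = fst (w 0)"
    unfolding eq by (simp add: ungroup_def nth)
  show "ell2_nth (snd (cmv_L M N \<Gamma> (m, y))) n = (snd (w n), fst (w (Suc n)))"
    unfolding eq ell2_nth_snd_ungroup nth by simp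
qed

lemma unitary_L: "unitary (M \<times> cmv_space' M N \<Gamma>) (N \<times> cmv_space M N \<Gamma>) (cmv_L M N \<Gamma>)"
proof (rule unitary_cong)
  have ungroup: "unitary {x. \<forall>n. ell2_nth x n \<in> pcod (2*n) \<times> pdom (2*n+1)} (N \<times> cmv_space M N \<Gamma>) ungroup"
    using unitary_ungroup[of "\<lambda>n. pcod (2*n)" "\<lambda>n. pdom (2*n+1)", OF closed_cod closed_dom]
    by (simp add: cmv_space_eq)
  show closed: "closed_csubspace (M \<times> cmv_space' M N \<Gamma>)"
    by (intro closed_csubspace_Times M closed_cmv_space)
  have "closed_csubspace {x. \<forall>n. ell2_nth x n \<in> pdom (2*n) \<times> pcod (2*n+1)}"
    "closed_csubspace {x. \<forall>n. ell2_nth x n \<in> pcod (2*n) \<times> pdom (2*n+1)}"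
    by (intro closed_csubspace_ell2 J_dom_closed J_cod_closed)+
  then show "unitary (M \<times> cmv_space' M N \<Gamma>) (N \<times> cmv_space M N \<Gamma>)
      (\<lambda>p. ungroup (even_rotations (regroup p)))"
    by (intro unitary_comp[OF closed _ unitary_regroup_cmv]
        unitary_comp[OF _ _ unitary_even_rotations ungroup])
  show "cmv_L M N \<Gamma> p = ungroup (even_rotations (regroup p))" if "p \<in> M \<times> cmv_space' M N \<Gamma>" for p
    using that L_eq_ungroup by (cases p) blast
qed

lemma unitary_U: "unitary (M \<times> cmv_space M N \<Gamma>) (N \<times> cmv_space M N \<Gamma>) (cmv_U M N \<Gamma>)"
  unfolding cmv_U_def comp_def
  by (intro unitary_comp[OF _ _ unitary_map_prod_id[OF M _ unitary_V] unitary_L]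
      closed_csubspace_Times M closed_cmv_space)

lemma unitary_U': "unitary (M \<times> cmv_space' M N \<Gamma>) (N \<times> cmv_space' M N \<Gamma>) (cmv_U' M N \<Gamma>)"
  unfolding cmv_U'_def comp_def
  by (intro unitary_comp[OF _ _ unitary_L unitary_map_prod_id[OF N _ unitary_V]]
      closed_csubspace_Times M N closed_cmv_space)

end


section \<open>Simple conservative systems\<close>

text \<open>
  For a unitary \<open>U\<close>, a set \<open>K\<close> as in this definition spans a subspace that reduces the main
  operator to a unitary operator and is orthogonal to the range of the input operator and contained
  in the kernel of the output operator. Asking for a preimage in \<open>K\<close> instead of invariance under
  the adjoint keeps adjoints of the blocks of \<open>U\<close> out of the computations with CMV matrices.
\<close>

definition completely_nonunitary ::
    "('a::complex_inner \<times> 'h::complex_inner \<Rightarrow> 'b::complex_inner \<times> 'h) \<Rightarrow> 'h set \<Rightarrow> bool"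
  where "completely_nonunitary U H \<longleftrightarrow> (\<forall>K\<subseteq>H.
    (\<forall>h\<in>K. fst (U (0, h)) = 0 \<and> snd (U (0, h)) \<in> K) \<longrightarrow>
    (\<forall>h\<in>K. \<exists>g\<in>K. U (0, g) = (0, h)) \<longrightarrow> K \<subseteq> {0})"

lemma completely_nonunitaryD:
  assumes "completely_nonunitary U H" "K \<subseteq> H"
    and fwd: "\<And>h. h \<in> K \<Longrightarrow> fst (U (0, h)) = 0 \<and> snd (U (0, h)) \<in> K"
    and bwd: "\<And>h. h \<in> K \<Longrightarrow> \<exists>g\<in>K. U (0, g) = (0, h)"
  shows "K \<subseteq> {0}"
  using assms(1)[unfolded completely_nonunitary_def, rule_format, OF assms(2)] fwd bwd by fast

context
  fixes U :: "'a::chilbert_space \<times> 'h::chilbert_space \<Rightarrow> 'b::chilbert_space \<times> 'h"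
    and M :: "'a set" and N :: "'b set" and H :: "'h set"
  assumes M: "closed_csubspace M" and N: "closed_csubspace N" and H: "closed_csubspace H"
    and U: "unitary (M \<times> H) (N \<times> H) U"
begin

lemmas MH = closed_csubspace_Times[OF M H]
lemmas Ub = unitary_bounded[OF MH U]
lemmas M_mem = csubspace_mem[OF closed_csubspaceD(1)[OF M]]
lemmas H_mem = csubspace_mem[OF closed_csubspaceD(1)[OF H]]

lemma U_state: "U (0, h) = (sys_C U h, sys_A U h)"
  and U_input: "U (x, 0) = (sys_D U x, sys_B U x)"
  by (simp_all add: sys_A_def sys_B_def sys_C_def sys_D_def)

lemma U_split:
  assumes "x \<in> M" "h \<in> H"
  shows "U (x, h) = (sys_D U x + sys_C U h, sys_B U x + sys_A U h)"
  using bounded_ops_add[OF Ub, of "(x, 0)" "(0, h)"] assms by (simp add: M_mem H_mem U_state U_input)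

lemma norm_sys_A: "h \<in> H \<Longrightarrow> norm (sys_A U h) \<le> norm h"
  using unitary_norm[OF MH U, of "(0, h)"] M_mem(1)
    norm_snd_le[of "sys_A U h" "sys_C U h"] by (simp add: U_state norm_Pair)

lemma sys_bounded:
  shows sys_A_bounded: "sys_A U \<in> bounded_ops H H"
    and sys_B_bounded: "sys_B U \<in> bounded_ops M H"
    and sys_C_bounded: "sys_C U \<in> bounded_ops H N"
proof -
  have state: "(0, h) \<in> M \<times> H" if "h \<in> H" for h
    using that M_mem(1) by simp
  have input: "(x, 0) \<in> M \<times> H" if "x \<in> M" for x
    using that H_mem(1) by simp
  have norms: "norm (fst (U p)) \<le> norm p" "norm (snd (U p)) \<le> norm p" if "p \<in> M \<times> H" for p
    using unitary_norm[OF MH U that] norm_fst_le[of "fst (U p)" "snd (U p)"]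
      norm_snd_le[of "snd (U p)" "fst (U p)"] by simp_all
  have add: "U (0, g + h) = U (0, g) + U (0, h)" if "g \<in> H" "h \<in> H" for g h
    using bounded_ops_add[OF Ub state[OF that(1)] state[OF that(2)]] by simp
  have scale: "U (0, a *\<^sub>C h) = a *\<^sub>C U (0, h)" if "h \<in> H" for a h
    using bounded_ops_scaleC[OF Ub state[OF that], of a] by (simp add: scaleC_prod_def)
  have add': "U (x + y, 0) = U (x, 0) + U (y, 0)" if "x \<in> M" "y \<in> M" for x y
    using bounded_ops_add[OF Ub input[OF that(1)] input[OF that(2)]] by simp
  have scale': "U (a *\<^sub>C x, 0) = a *\<^sub>C U (x, 0)" if "x \<in> M" for a x
    using bounded_ops_scaleC[OF Ub input[OF that], of a] by (simp add: scaleC_prod_def)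
  have mem: "fst (U p) \<in> N" "snd (U p) \<in> H" if "p \<in> M \<times> H" for p
    using bounded_ops_mem[OF Ub that] by (auto simp: mem_Times_iff)
  show "sys_A U \<in> bounded_ops H H"
  proof (rule bounded_opsI[where K = 1])
    show "norm (sys_A U h) \<le> 1 * norm h" if "h \<in> H" for h
      using norm_sys_A[OF that] by simp
  qed (simp_all add: sys_A_def mem M_mem add scale scaleC_prod_def)
  show "sys_B U \<in> bounded_ops M H"
  proof (rule bounded_opsI[where K = 1])
    show "norm (sys_B U x) \<le> 1 * norm x" if "x \<in> M" for x
      using norms(2)[OF input[OF that]] by (simp add: sys_B_def norm_Pair)
  qed (simp_all add: sys_B_def mem H_mem add' scale' scaleC_prod_def)
  show "sys_C U \<in> bounded_ops H N"
  proof (rule bounded_opsI[where K = 1])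
    show "norm (sys_C U h) \<le> 1 * norm h" if "h \<in> H" for h
      using norms(1)[OF state[OF that]] by (simp add: sys_C_def norm_Pair)
  qed (simp_all add: sys_C_def mem M_mem add scale scaleC_prod_def)
qed

lemma cinner_state_state:
  assumes "g \<in> H" "h \<in> H"
  shows "cinner (sys_C U g) (sys_C U h) + cinner (sys_A U g) (sys_A U h) = cinner g h"
  using unitary_cinner[OF MH U, of "(0, g)" "(0, h)"] assms M_mem(1)
  by (simp add: U_state cinner_prod_def)

text \<open>
  The orthogonal complement of the controllable and observable vectors satisfies the conditions
  on the set \<open>K\<close> in the definition of a completely nonunitary system.
\<close>

lemma simpleI:
  assumes cnu: "completely_nonunitary U H"
  shows "simple U M N H"
proof -
  let ?A = "sys_A U" and ?B = "sys_B U" and ?C = "sys_C U"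
  let ?A' = "adj H H ?A" and ?C' = "adj H N ?C"
  define G where "G = {(?A ^^ k) (?B x) | k x. x \<in> M} \<union> {(?A' ^^ l) (?C' y) | l y. y \<in> N}"
  note A = sys_A_bounded and B = sys_B_bounded and C = sys_C_bounded
  have ctrl: "(?A ^^ k) (?B x) \<in> H" if "x \<in> M" for k x
    by (induction k) (simp_all add: bounded_ops_mem[OF A] bounded_ops_mem[OF B that])
  have obs: "(?A' ^^ l) (?C' y) \<in> H" for l y
    by (induction l) (simp_all add: adj_mem[OF H A] adj_mem[OF H C])
  have ctrlG: "(?A ^^ k) (?B x) \<in> G" if "x \<in> M" for k x
    using that unfolding G_def by blast
  have obsG: "(?A' ^^ l) (?C' y) \<in> G" if "y \<in> N" for l y
    using that unfolding G_def by blast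
  define K where "K = {h\<in>H. \<forall>g\<in>G. cinner h g = 0}"
  have KH: "K \<subseteq> H"
    by (auto simp: K_def)
  have K_ctrl: "cinner h ((?A ^^ k) (?B x)) = 0" if "h \<in> K" "x \<in> M" for h k x
    using that ctrlG by (simp add: K_def)
  have K_obs: "cinner h ((?A' ^^ l) (?C' y)) = 0" if "h \<in> K" "y \<in> N" for h l y
    using that obsG by (simp add: K_def)
  have KI: "h \<in> K" if "h \<in> H" "\<And>k x. x \<in> M \<Longrightarrow> cinner h ((?A ^^ k) (?B x)) = 0"
    "\<And>l y. y \<in> N \<Longrightarrow> cinner h ((?A' ^^ l) (?C' y)) = 0" for h
    using that by (auto simp: K_def G_def)
  have fwd: "fst (U (0, h)) = 0 \<and> snd (U (0, h)) \<in> K" if h: "h \<in> K" for h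
  proof -
    have hH: "h \<in> H"
      using h KH by blast
    have "cinner (?C h) (?C h) = 0"
      using K_obs[OF h bounded_ops_mem[OF C hH], of 0] adj_cinner[OF H C hH, of "?C h"] by simp
    then have Ch: "?C h = 0"
      by (simp add: cinner_eq_zero_iff)
    have "?A h \<in> K"
    proof (rule KI[OF bounded_ops_mem[OF A hH]])
      fix k x assume x: "x \<in> M"
      show "cinner (?A h) ((?A ^^ k) (?B x)) = 0"
      proof (cases k)
        case 0
        have "cinner (U (0, h)) (U (x, 0)) = 0"
          using unitary_cinner[OF MH U, of "(0, h)" "(x, 0)"] x hH M_mem(1) H_mem(1)
          by (simp add: cinner_prod_def)
        then show ?thesis
          by (simp add: 0 U_state U_input Ch cinner_prod_def)
      next
        case (Suc j)
        then show ?thesis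
          using cinner_state_state[OF hH ctrl[OF x, of j]] K_ctrl[OF h x, of j] Ch by simp
      qed
    next
      fix l y assume "y \<in> N"
      then show "cinner (?A h) ((?A' ^^ l) (?C' y)) = 0"
        using K_obs[OF h, of y "Suc l"] by (simp add: adj_cinner[OF H A hH])
    qed
    then show ?thesis
      by (simp add: U_state Ch)
  qed
  have bwd: "\<exists>g\<in>K. U (0, g) = (0, h)" if h: "h \<in> K" for h
  proof -
    have hH: "h \<in> H"
      using h KH by blast
    obtain x g where x: "x \<in> M" and g: "g \<in> H" and eq: "U (x, g) = (0, h)"
      using unitary_surj[OF MH U, of "(0, h)"] hH csubspace_mem(1)[OF closed_csubspaceD(1)[OF N]]
      by auto
    have "cinner x x = cinner (?B x) h"
      using unitary_cinner[OF MH U, of "(x, 0)" "(x, g)"] x g H_mem(1)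
      by (simp add: U_input eq cinner_prod_def)
    also have "\<dots> = 0"
      using K_ctrl[OF h x, of 0] by (simp add: cinner_zero_commute)
    finally have "x = 0"
      by (simp add: cinner_eq_zero_iff)
    with eq have Cg: "?C g = 0" and Ag: "?A g = h"
      by (simp_all add: U_state)
    have "g \<in> K"
    proof (rule KI[OF g])
      fix k x assume x: "x \<in> M"
      show "cinner g ((?A ^^ k) (?B x)) = 0"
        using cinner_state_state[OF g ctrl[OF x, of k]] K_ctrl[OF h x, of "Suc k"] Cg Ag by simp
    next
      fix l y assume y: "y \<in> N"
      show "cinner g ((?A' ^^ l) (?C' y)) = 0"
      proof (cases l)
        case 0
        then show ?thesis using adj_cinner[OF H C g, of y] Cg by simp
      next
        case (Suc j)
        then show ?thesis using adj_cinner[OF H A g] Ag K_obs[OF h y, of j] by simp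
      qed
    qed
    then show ?thesis
      using eq unfolding \<open>x = 0\<close> by (rule bexI[rotated])
  qed
  have K0: "K \<subseteq> {0}"
    by (rule completely_nonunitaryD[OF cnu KH fwd bwd])
  have GH: "G \<subseteq> H"
    using ctrl obs unfolding G_def by blast
  have "closure (cspan G) = H"
  proof (rule closed_csubspace_eqI)
    show "closed_csubspace (closure (cspan G))"
      by (intro closed_csubspace_closure complex_vector.subspace_span)
    show "csubspace H"
      by (rule closed_csubspaceD(1)[OF H])
    show "closure (cspan G) \<subseteq> H"
      using GH H by (intro closure_minimal complex_vector.span_minimal closed_csubspaceD)
    have "G \<subseteq> closure (cspan G)"
      using complex_vector.span_superset closure_subset by blast
    then show "h = 0" if "h \<in> H" "\<And>x. x \<in> closure (cspan G) \<Longrightarrow> cinner h x = 0" for h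
      using that K0 by (force simp: K_def)
  qed
  then show ?thesis
    unfolding simple_def G_def by simp
qed

text \<open>
  With \<open>h = (I - z A)\<^sup>-\<^sup>1 B x\<close> the transfer function is the output of \<open>U\<close> at \<open>(x, z h)\<close>.
\<close>

lemma transfer_function_eqI:
  assumes z: "norm z < 1" and x: "x \<in> M" and h: "h \<in> H" and eq: "U (x, z *\<^sub>C h) = (y, h)"
  shows "transfer_function U H z x = y"
proof -
  note A = sys_A_bounded
  have scale: "sys_A U (z *\<^sub>C h) = z *\<^sub>C sys_A U h" "sys_C U (z *\<^sub>C h) = z *\<^sub>C sys_C U h"
    using bounded_ops_scaleC[OF A h] bounded_ops_scaleC[OF sys_C_bounded h] by auto
  have y: "y = sys_D U x + z *\<^sub>C sys_C U h" and h_eq: "h = sys_B U x + z *\<^sub>C sys_A U h"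
    using U_split[OF x H_mem(3)[OF h, of z]] eq by (auto simp: scale)
  have "\<exists>!g. g \<in> H \<and> g - z *\<^sub>C sys_A U g = sys_B U x"
  proof (rule neumann_solution[OF H _ norm_ge_zero z])
    show bound: "norm (z *\<^sub>C sys_A U g) \<le> cmod z * norm g" if "g \<in> H" for g
      using norm_sys_A[OF that] by (simp add: norm_scaleC mult_left_mono)
    show "(\<lambda>g. z *\<^sub>C sys_A U g) \<in> bounded_ops H H"
    proof (rule bounded_opsI[OF _ _ _ bound])
    qed (auto simp: H_mem bounded_ops_mem[OF A] bounded_ops_add[OF A] bounded_ops_scaleC[OF A]
        scaleC_add_right scaleC_scaleC mult.commute)
    show "sys_B U x \<in> H"
      by (rule bounded_ops_mem[OF sys_B_bounded x])
  qed
  moreover have h': "h - z *\<^sub>C sys_A U h = sys_B U x"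
    by (subst h_eq) simp
  ultimately have unique: "g = h" if "g \<in> H" "g - z *\<^sub>C sys_A U g = sys_B U x" for g
    using that h by blast
  have ex: "sys_B U x \<in> (\<lambda>g. g - z *\<^sub>C sys_A U g) ` H"
    using imageI[OF h, of "\<lambda>g. g - z *\<^sub>C sys_A U g"] unfolding h' .
  have "inv_into H (\<lambda>g. g - z *\<^sub>C sys_A U g) (sys_B U x) = h"
    using inv_into_into[OF ex] f_inv_into_f[OF ex] by (rule unique)
  then show ?thesis
    by (simp add: transfer_function_def y)
qed

lemma simple_conservative_realizationI:
  assumes "completely_nonunitary U H"
    and "\<And>z x. norm z < 1 \<Longrightarrow> x \<in> M \<Longrightarrow> \<exists>h\<in>H. U (x, z *\<^sub>C h) = (\<Theta> z x, h)"
  shows "simple_conservative_realization U M N H \<Theta>"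
  unfolding simple_conservative_realization_def conservative_def is_system_def
  using M N H U Ub simpleI[OF assms(1)] assms(2) transfer_function_eqI by (auto, blast)

end

text \<open>
  Under a unitary change \<open>V\<close> of the state space, the sets \<open>K\<close> in the definition for \<open>U\<close> are
  the preimages of those for \<open>U'\<close>.
\<close>

lemma completely_nonunitary_transfer:
  fixes H :: "'h::chilbert_space set"
  assumes H: "closed_csubspace H" and V: "unitary H H' V" and M0: "0 \<in> M"
    and UH: "\<And>h. h \<in> H \<Longrightarrow> snd (U (0, h)) \<in> H"
    and intertw: "\<And>m h. m \<in> M \<Longrightarrow> h \<in> H \<Longrightarrow> U' (m, V h) = map_prod id V (U (m, h))"
    and cnu: "completely_nonunitary U H"
  shows "completely_nonunitary U' H'"
  unfolding completely_nonunitary_def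
proof (intro allI impI)
  fix K' assume K': "K' \<subseteq> H'" and fwd: "\<forall>h\<in>K'. fst (U' (0, h)) = 0 \<and> snd (U' (0, h)) \<in> K'"
    and bwd: "\<forall>h\<in>K'. \<exists>g\<in>K'. U' (0, g) = (0, h)"
  define K where "K = {h\<in>H. V h \<in> K'}"
  have eq: "U' (0, V h) = (fst (U (0, h)), V (snd (U (0, h))))" if "h \<in> H" for h
    using intertw[OF M0 that] by (simp add: map_prod_def split_beta)
  have "fst (U (0, h)) = 0 \<and> snd (U (0, h)) \<in> K" if "h \<in> K" for h
    using that fwd eq[of h] UH[of h] by (auto simp: K_def)
  moreover have "\<exists>g\<in>K. U (0, g) = (0, h)" if "h \<in> K" for h
  proof -
    obtain g' where g': "g' \<in> K'" "U' (0, g') = (0, V h)"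
      using \<open>h \<in> K\<close> bwd by (auto simp: K_def)
    obtain g where g: "g \<in> H" "V g = g'"
      using unitary_surj[OF H V] g'(1) K' by blast
    have "fst (U (0, g)) = 0" "V (snd (U (0, g))) = V h"
      using eq[OF g(1)] g' g(2) by auto
    then have "U (0, g) = (0, h)"
      using unitary_inj[OF H V UH[OF g(1)], of h] \<open>h \<in> K\<close> by (simp add: K_def prod_eq_iff)
    then show ?thesis
      using g g' by (auto simp: K_def)
  qed
  moreover have "K \<subseteq> H"
    by (auto simp: K_def)
  ultimately have K0: "K \<subseteq> {0}"
    by (intro completely_nonunitaryD[OF cnu])
  show "K' \<subseteq> {0}"
  proof
    fix h' assume h': "h' \<in> K'"
    obtain h where h: "h \<in> H" "V h = h'"
      using unitary_surj[OF H V] h' K' by blast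
    then have "h = 0"
      using K0 h' by (auto simp: K_def)
    then show "h' \<in> {0}"
      using h bounded_ops_zero[OF unitary_bounded[OF H V] closed_csubspaceD(1)[OF H]] by simp
  qed
qed

context choice_sequence
begin

text \<open>
  Suppose that the components before the \<open>n\<close>-th one vanish for all elements of \<open>K\<close>. Then the rotation
  of \<open>\<Gamma> (2 n)\<close> acts on a pair \<open>(0, v)\<close>, and the first entry \<open>D\<^sub>\<Gamma>\<^sub>* v\<close> of the result is either the
  output or a component that vanishes by assumption. So \<open>v = 0\<close>, and the second entry vanishes
  too; it is the first half of the \<open>n\<close>-th component of the image, and every element of \<open>K\<close> is such
  an image. The rotation of \<open>\<Gamma> (2 n + 1)\<close>, which produces \<open>v\<close>, then treats the second half likewise.
\<close>

lemma cmv_U_completely_nonunitary: "completely_nonunitary (cmv_U M N \<Gamma>) (cmv_space M N \<Gamma>)"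
  unfolding completely_nonunitary_def
proof (intro allI impI)
  fix K
  assume KH: "K \<subseteq> cmv_space M N \<Gamma>"
    and fwd: "\<forall>h\<in>K. fst (cmv_U M N \<Gamma> (0, h)) = 0 \<and> snd (cmv_U M N \<Gamma> (0, h)) \<in> K"
    and bwd: "\<forall>h\<in>K. \<exists>g\<in>K. cmv_U M N \<Gamma> (0, g) = (0, h)"
  note Vmem = bounded_ops_mem[OF unitary_bounded[OF closed_cmv_space(1) unitary_V]]
  define w where "w h n = J (2*n) ((case n of 0 \<Rightarrow> 0 | Suc j \<Rightarrow> snd (ell2_nth (cmv_V M N \<Gamma> h) j)),
      fst (ell2_nth (cmv_V M N \<Gamma> h) n))" for h n
  have inL: "(0, cmv_V M N \<Gamma> h) \<in> M \<times> cmv_space' M N \<Gamma>" if "h \<in> K" for h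
    using that KH Vmem csubspace_mem(1)[OF closed_csubspaceD(1)[OF M]] by auto
  have fstU: "fst (cmv_U M N \<Gamma> (0, h)) = fst (w h 0)"
    and sndU: "ell2_nth (snd (cmv_U M N \<Gamma> (0, h))) n = (snd (w h n), fst (w h (Suc n)))"
    if "h \<in> K" for h n
    using fst_L[OF inL[OF that]] snd_L_nth[OF inL[OF that], of n] by (simp_all add: cmv_U_def w_def)
  have zero: "\<forall>h\<in>K. ell2_nth h n = (0, 0)" for n
  proof (induction n rule: less_induct)
    case (less n)
    have fst_y: "fst (ell2_nth (cmv_V M N \<Gamma> h) n) = 0" and w0: "w h n = (0, 0)" if h: "h \<in> K" for h
    proof -
      have in0: "(case n of 0 \<Rightarrow> 0 | Suc j \<Rightarrow> snd (ell2_nth (cmv_V M N \<Gamma> h) j)) = 0"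
        using h KH less by (auto simp: V_nth split: nat.split)
      have "fst (w h n) = 0"
      proof (cases n)
        case 0
        then show ?thesis using fstU[OF h] fwd h by simp
      next
        case (Suc m)
        have "ell2_nth (snd (cmv_U M N \<Gamma> (0, h))) m = (0, 0)"
          using less[of m] fwd h Suc by blast
        then show ?thesis using sndU[OF h, of m] Suc by simp
      qed
      moreover have "fst (ell2_nth (cmv_V M N \<Gamma> h) n) \<in> pcod (Suc (2*n))"
        using inL[OF h] by (auto simp: cmv_space_eq mem_Times_iff)
      ultimately show "fst (ell2_nth (cmv_V M N \<Gamma> h) n) = 0"
        by (intro J_fst_eq_0[of "fst (ell2_nth (cmv_V M N \<Gamma> h) n)" "2*n"]) (simp_all add: w_def in0)
      then show "w h n = (0, 0)"
        by (simp add: w_def in0)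
    qed
    show ?case
    proof
      fix h assume h: "h \<in> K"
      obtain g where g: "g \<in> K" "cmv_U M N \<Gamma> (0, g) = (0, h)"
        using bwd h by blast
      have fst_h: "fst (ell2_nth h n) = 0"
        using sndU[OF g(1), of n] w0[OF g(1)] g(2) by simp
      have "h \<in> cmv_space M N \<Gamma>"
        using h KH by blast
      moreover have "ell2_nth h n = (0, snd (ell2_nth h n))"
        using fst_h by (simp add: prod_eq_iff)
      ultimately have "snd (ell2_nth h n) \<in> pcod (Suc (2*n+1))"
        and "ell2_nth (cmv_V M N \<Gamma> h) n = J (2*n+1) (0, snd (ell2_nth h n))"
        by (auto simp: cmv_space_eq mem_Times_iff V_nth)
      then have "snd (ell2_nth h n) = 0"
        using fst_y[OF h] by (intro J_fst_eq_0[of "snd (ell2_nth h n)" "2*n+1"]) simp_all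
      then show "ell2_nth h n = (0, 0)"
        using fst_h by (simp add: prod_eq_iff)
    qed
  qed
  have "h = 0" if "h \<in> K" for h
    using zero that by (intro ell2_eqI) (simp add: zero_ell2.rep_eq zero_prod_def)
  then show "K \<subseteq> {0}" by blast
qed

lemma V_intertwines: "cmv_U' M N \<Gamma> (m, cmv_V M N \<Gamma> h) = map_prod id (cmv_V M N \<Gamma>) (cmv_U M N \<Gamma> (m, h))"
  by (simp add: cmv_U_def cmv_U'_def)

lemma cmv_U'_completely_nonunitary: "completely_nonunitary (cmv_U' M N \<Gamma>) (cmv_space' M N \<Gamma>)"
proof (rule completely_nonunitary_transfer[OF closed_cmv_space(1) unitary_V])
  show "0 \<in> M"
    by (rule csubspace_mem(1)[OF closed_csubspaceD(1)[OF M]])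
  then show "snd (cmv_U M N \<Gamma> (0, h)) \<in> cmv_space M N \<Gamma>" if "h \<in> cmv_space M N \<Gamma>" for h
    using bounded_ops_mem[OF unitary_bounded[OF closed_csubspace_Times[OF M closed_cmv_space(1)] unitary_U],
        of "(0, h)"] that by (simp add: mem_Times_iff)
qed (rule V_intertwines cmv_U_completely_nonunitary)+

end


section \<open>Transfer functions\<close>

text \<open>
  In terms of the rotation of \<open>\<Theta> 0\<close>, the state \<open>x'\<close> is the argument of \<open>\<Psi> z\<close> in the formula
  of the Schur step.
\<close>

lemma schur_step_rotation:
  fixes S :: "'a::chilbert_space set" and R :: "'b::chilbert_space set"
  assumes S: "closed_csubspace S" and R: "closed_csubspace R" and \<Theta>: "contraction S R (\<Theta> 0)"
    and step: "schur_step S R \<Theta> \<Psi>" and z: "norm z < 1" and x: "x \<in> S"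
  shows "\<exists>x'\<in>defect_space S R (\<Theta> 0).
    elementary_rotation S R (\<Theta> 0) (x, z *\<^sub>C \<Psi> z x') = (\<Theta> z x, x')"
proof -
  interpret hilbert_contraction S R "\<Theta> 0"
    by (intro hilbert_contraction.intro S R \<Theta>)
  let ?H = "defect_space S R (\<Theta> 0)" and ?H' = "defect_adj_space S R (\<Theta> 0)"
  have \<Psi>: "contraction ?H ?H' (\<Psi> z)"
    using step z unfolding schur_step_def schur_class_def by (simp add: dist_norm)
  note \<Psi>b = contractionD(1)[OF \<Psi>]
  have \<Psi>mem: "\<Psi> z v \<in> ?H'" "\<Psi> z v \<in> R" if "v \<in> ?H" for v
    using bounded_ops_mem[OF \<Psi>b that] defect_adj_space_subset by auto
  note H_mem = csubspace_mem[OF closed_csubspaceD(1)[OF closed_defect_space]]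
  let ?F = "\<lambda>v. v + z *\<^sub>C Tadj (\<Psi> z v)"
  have "\<exists>!v. v \<in> ?H \<and> v - - (z *\<^sub>C Tadj (\<Psi> z v)) = D x"
  proof (rule neumann_solution[OF closed_defect_space _ norm_ge_zero z])
    show bound: "norm (- (z *\<^sub>C Tadj (\<Psi> z v))) \<le> cmod z * norm v" if "v \<in> ?H" for v
    proof -
      have "norm (Tadj (\<Psi> z v)) \<le> norm v"
        using contractionD(2)[OF Tadj_contraction \<Psi>mem(2)[OF that]] contractionD(2)[OF \<Psi> that]
        by linarith
      then show ?thesis
        by (simp add: norm_scaleC mult_left_mono)
    qed
    show "(\<lambda>v. - (z *\<^sub>C Tadj (\<Psi> z v))) \<in> bounded_ops ?H ?H"
    proof (rule bounded_opsI[OF _ _ _ bound])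
      show "- (z *\<^sub>C Tadj (\<Psi> z v)) \<in> ?H" if "v \<in> ?H" for v
        by (intro H_mem(3,6) adj_maps_defect_space \<Psi>mem that)
    qed (simp_all add: \<Psi>mem bounded_ops_add[OF \<Psi>b] bounded_ops_add[OF Tadj_bounded] scaleC_add_right
        bounded_ops_scaleC[OF \<Psi>b] bounded_ops_scaleC[OF Tadj_bounded] scaleC_scaleC mult.commute)
    show "D x \<in> ?H"
      by (rule defect_in_defect_space[OF x])
  qed
  then obtain v where v: "v \<in> ?H" "v - - (z *\<^sub>C Tadj (\<Psi> z v)) = D x"
    by blast
  have ex: "D x \<in> ?F ` ?H"
    by (rule image_eqI[OF _ v(1)]) (simp flip: v(2))
  define x' where "x' = inv_into ?H ?F (D x)"
  have x': "x' \<in> ?H"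
    unfolding x'_def by (rule inv_into_into[OF ex])
  have eq: "x' + z *\<^sub>C Tadj (\<Psi> z x') = D x"
    unfolding x'_def by (rule f_inv_into_f[OF ex])
  have "\<Theta> z x = \<Theta> 0 x + z *\<^sub>C Dadj (\<Psi> z x')"
  proof -
    have "z \<in> ball 0 1"
      using z by simp
    then show ?thesis
      using step x unfolding schur_step_def x'_def by blast
  qed
  moreover have "D x - z *\<^sub>C Tadj (\<Psi> z x') = x'"
    unfolding eq[symmetric] by simp
  ultimately show ?thesis
    using x' by (intro bexI[of _ x'])
      (simp_all add: elementary_rotation_def \<Psi>mem bounded_ops_scaleC[OF defect_adj_bounded]
        bounded_ops_scaleC[OF Tadj_bounded])
qed

locale schur_sequence =
  fixes M :: "'a::chilbert_space set" and N :: "'b::chilbert_space set"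
    and \<Theta>s :: "nat \<Rightarrow> complex \<Rightarrow> 'a \<Rightarrow> 'b" and \<Gamma> :: "nat \<Rightarrow> 'a \<Rightarrow> 'b"
  assumes closed_M: "closed_csubspace M" and closed_N: "closed_csubspace N"
    and schur_0: "\<Theta>s 0 \<in> schur_class M N"
    and parameters: "\<And>n. \<Gamma> n = \<Theta>s n 0"
    and steps: "\<And>n. schur_step (par_dom M N \<Gamma> n) (par_cod M N \<Gamma> n) (\<Theta>s n) (\<Theta>s (Suc n))"
begin

lemma iterates_schur_class: "\<Theta>s n \<in> schur_class (par_dom M N \<Gamma> n) (par_cod M N \<Gamma> n)"
proof (cases n)
  case 0
  then show ?thesis using schur_0 by (simp add: par_dom_def par_cod_def)
next
  case (Suc m)
  then show ?thesis
    using steps[of m] by (simp add: schur_step_def parameters par_dom_def par_cod_def Let_def split_beta)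
qed

lemma iterates_contraction: "norm z < 1 \<Longrightarrow> contraction (par_dom M N \<Gamma> n) (par_cod M N \<Gamma> n) (\<Theta>s n z)"
  using iterates_schur_class[of n] by (simp add: schur_class_def dist_norm)

sublocale choice_sequence M N \<Gamma>
  by unfold_locales (simp_all add: closed_M closed_N parameters iterates_contraction)

text \<open>
  The Schur algorithm at the point \<open>z\<close> transports the input \<open>x\<close> through the rotations of all
  \<open>\<Gamma> n\<close>. Since the rotations are isometric, \<open>(norm (xs n))\<^sup>2 - (norm (ys n))\<^sup>2\<close> decreases by
  \<open>(1 - (cmod z)\<^sup>2) * (norm (ys (Suc n)))\<^sup>2\<close> in each step; as it stays nonnegative, both sequences
  are bounded.
\<close>

lemma transported_input:
  assumes z: "norm z < 1" and x: "x \<in> M"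
  obtains xs ys B where "xs 0 = x" "ys 0 = \<Theta>s 0 z x"
    "\<And>n. xs n \<in> pdom n" "\<And>n. ys n \<in> pcod n"
    "\<And>n. J n (xs n, z *\<^sub>C ys (Suc n)) = (ys n, xs (Suc n))"
    "\<And>n. (norm (xs (Suc n)))\<^sup>2 \<le> B" "\<And>n. (norm (ys (Suc n)))\<^sup>2 \<le> B"
proof -
  have "\<exists>xs. \<forall>n. (xs n \<in> pdom n \<and> (n = 0 \<longrightarrow> xs n = x)) \<and>
      J n (xs n, z *\<^sub>C \<Theta>s (Suc n) z (xs (Suc n))) = (\<Theta>s n z (xs n), xs (Suc n))"
  proof (rule dependent_nat_choice)
    show "\<exists>u. u \<in> pdom 0 \<and> (0 = 0 \<longrightarrow> u = x)"
      using x by simp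
    show "\<exists>v. (v \<in> pdom (Suc n) \<and> (Suc n = 0 \<longrightarrow> v = x)) \<and>
        J n (u, z *\<^sub>C \<Theta>s (Suc n) z v) = (\<Theta>s n z u, v)"
      if "u \<in> pdom n \<and> (n = 0 \<longrightarrow> u = x)" for u n
    proof -
      have "contraction (pdom n) (pcod n) (\<Theta>s n 0)"
        by (rule iterates_contraction) simp
      from schur_step_rotation[where x = u, OF closed_dom closed_cod this steps z] that
      show ?thesis
        by (auto simp: par_rotation_def par_Suc parameters)
    qed
  qed
  then obtain xs where xs: "\<And>n. xs n \<in> pdom n" "xs 0 = x"
    "\<And>n. J n (xs n, z *\<^sub>C \<Theta>s (Suc n) z (xs (Suc n))) = (\<Theta>s n z (xs n), xs (Suc n))"
    by metis
  define ys where "ys n = \<Theta>s n z (xs n)" for n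
  have ys: "ys n \<in> pcod n" "norm (ys n) \<le> norm (xs n)" for n
    using bounded_ops_mem[OF contractionD(1)[OF iterates_contraction[OF z]] xs(1)]
      contractionD(2)[OF iterates_contraction[OF z] xs(1)] by (simp_all add: ys_def)
  have rot: "J n (xs n, z *\<^sub>C ys (Suc n)) = (ys n, xs (Suc n))" for n
    using xs(3) by (simp add: ys_def)
  define e where "e n = (norm (xs n))\<^sup>2 - (norm (ys n))\<^sup>2" for n
  define c where "c = 1 - (cmod z)\<^sup>2"
  have c: "0 < c"
    using z by (simp add: c_def power_less_one_iff)
  have e_nonneg: "0 \<le> e n" for n
    using ys(2)[of n] by (simp add: e_def power_mono)
  have e_step: "e n = e (Suc n) + c * (norm (ys (Suc n)))\<^sup>2" for n
  proof -
    have "(xs n, z *\<^sub>C ys (Suc n)) \<in> pdom n \<times> pcod (Suc n)"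
      using xs(1) ys(1) csubspace_mem(3)[OF closed_csubspaceD(1)[OF closed_cod]] by simp
    then have "(norm (ys n, xs (Suc n)))\<^sup>2 = (norm (xs n, z *\<^sub>C ys (Suc n)))\<^sup>2"
      using J_norm rot by metis
    then show ?thesis
      by (simp add: norm_prod_sq e_def c_def norm_scaleC power_mult_distrib algebra_simps)
  qed
  have e_le: "e n \<le> e 0" for n
  proof (induction n)
    case (Suc n)
    moreover have "0 \<le> c * (norm (ys (Suc n)))\<^sup>2"
      using c by simp
    ultimately show ?case
      using e_step[of n] by linarith
  qed simp
  have y_bound: "(norm (ys (Suc n)))\<^sup>2 \<le> e 0 / c" for n
    using e_step[of n] e_nonneg[of "Suc n"] e_le[of n] c by (simp add: pos_le_divide_eq mult.commute)
  have "(norm (xs (Suc n)))\<^sup>2 \<le> e 0 + e 0 / c" for n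
    using e_le[of "Suc n"] y_bound[of n] by (simp add: e_def)
  moreover have "(norm (ys (Suc n)))\<^sup>2 \<le> e 0 + e 0 / c" for n
    using y_bound[of n] e_nonneg[of 0] by linarith
  ultimately show thesis
    using that[of xs ys "e 0 + e 0 / c"] xs ys(1) rot by (simp add: ys_def)
qed

text \<open>
  The components of \<open>h\<close> are the transported vectors, damped by powers of \<open>z\<close> because each of the
  two layers \<open>V\<close> and \<open>L\<close> of the block operator CMV matrix performs every second rotation, and the
  state is multiplied by \<open>z\<close> once per pair of layers.
\<close>

lemma cmv_U_solution:
  assumes z: "norm z < 1" and x: "x \<in> M"
  shows "\<exists>h\<in>cmv_space M N \<Gamma>. cmv_U M N \<Gamma> (x, z *\<^sub>C h) = (\<Theta>s 0 z x, h)"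
proof -
  obtain xs ys B where start: "xs 0 = x" "ys 0 = \<Theta>s 0 z x"
    and mem: "\<And>n. xs n \<in> pdom n" "\<And>n. ys n \<in> pcod n"
    and rot: "\<And>n. J n (xs n, z *\<^sub>C ys (Suc n)) = (ys n, xs (Suc n))"
    and B: "\<And>n. (norm (xs (Suc n)))\<^sup>2 \<le> B" "\<And>n. (norm (ys (Suc n)))\<^sup>2 \<le> B"
    by (rule transported_input[OF z x]) (rule that)
  note pmem = csubspace_mem(3)[OF closed_csubspaceD(1)[OF closed_dom]]
    csubspace_mem(3)[OF closed_csubspaceD(1)[OF closed_cod]]
  have rot_scaled: "J n (a *\<^sub>C xs n, (a * z) *\<^sub>C ys (Suc n)) = (a *\<^sub>C ys n, a *\<^sub>C xs (Suc n))" for a n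
    using bounded_ops_scaleC[OF J_bounded, of "(xs n, z *\<^sub>C ys (Suc n))" n a] mem pmem rot[of n]
    by (simp add: scaleC_prod_def scaleC_scaleC)
  define f where "f n = (z^n *\<^sub>C xs (2*n+1), z^(n+1) *\<^sub>C ys (2*n+2))" for n
  have "summable (\<lambda>n. (norm (f n))\<^sup>2)"
  proof (rule summable_comparison_test')
    show "summable (\<lambda>n. 2 * B * ((cmod z)\<^sup>2)^n)"
      using z by (intro summable_mult summable_geometric) (simp add: power_less_one_iff)
    have "(norm (f n))\<^sup>2 \<le> ((cmod z)\<^sup>2)^n * B + ((cmod z)\<^sup>2)^n * B" for n
    proof -
      have "(cmod z ^ (n+1))\<^sup>2 \<le> (cmod z ^ n)\<^sup>2"
        using z by (intro power_mono power_decreasing) auto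
      then have "(cmod z ^ n)\<^sup>2 * (norm (xs (2*n+1)))\<^sup>2 + (cmod z ^ (n+1))\<^sup>2 * (norm (ys (2*n+2)))\<^sup>2
          \<le> (cmod z ^ n)\<^sup>2 * B + (cmod z ^ n)\<^sup>2 * B"
        using B(1)[of "2*n"] B(2)[of "2*n+1"] by (intro add_mono mult_mono) auto
      then have "(norm (f n))\<^sup>2 \<le> (cmod z ^ n)\<^sup>2 * B + (cmod z ^ n)\<^sup>2 * B"
        by (simp only: norm_prod_sq f_def fst_conv snd_conv norm_scaleC norm_power power_mult_distrib)
      then show ?thesis
        by (simp add: power_mult[symmetric] mult.commute)
    qed
    then show "norm ((norm (f n))\<^sup>2) \<le> 2 * B * ((cmod z)\<^sup>2)^n" for n
      by (simp add: mult_ac)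
  qed
  then have nth: "ell2_nth (Abs_ell2 f) = f"
    by (rule ell2_nth_Abs)
  define h where "h = Abs_ell2 f"
  have h: "h \<in> cmv_space M N \<Gamma>"
    unfolding cmv_space_eq h_def mem_Collect_eq nth f_def
    by (intro allI SigmaI pmem mem)
  have zh: "z *\<^sub>C h \<in> cmv_space M N \<Gamma>"
    by (rule csubspace_mem(3)[OF closed_csubspaceD(1)[OF closed_cmv_space(1)] h])
  let ?v = "cmv_V M N \<Gamma> (z *\<^sub>C h)"
  have v: "ell2_nth ?v n = (z^(n+1) *\<^sub>C ys (2*n+1), z^(n+1) *\<^sub>C xs (2*n+2))" for n
  proof -
    have "ell2_nth (z *\<^sub>C h) n = (z^(n+1) *\<^sub>C xs (2*n+1), (z^(n+1) * z) *\<^sub>C ys (2*n+2))"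
      by (simp add: scaleC_ell2.rep_eq h_def nth f_def scaleC_prod_def scaleC_scaleC mult_ac)
    then show ?thesis
      using rot_scaled[of "2*n+1" "z^(n+1)"] by (simp add: V_nth[OF zh])
  qed
  have inL: "(x, ?v) \<in> M \<times> cmv_space' M N \<Gamma>"
    using x bounded_ops_mem[OF unitary_bounded[OF closed_cmv_space(1) unitary_V] zh] by simp
  define w where "w n = J (2*n) ((case n of 0 \<Rightarrow> x | Suc j \<Rightarrow> snd (ell2_nth ?v j)), fst (ell2_nth ?v n))" for n
  have w: "w n = (z^n *\<^sub>C ys (2*n), z^n *\<^sub>C xs (2*n+1))" for n
  proof -
    have "(case n of 0 \<Rightarrow> x | Suc j \<Rightarrow> snd (ell2_nth ?v j)) = z^n *\<^sub>C xs (2*n)"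
      by (cases n) (simp_all add: v start scaleC_one)
    then show ?thesis
      using rot_scaled[of "2*n" "z^n"] by (simp add: w_def v mult.commute)
  qed
  have "fst (cmv_U M N \<Gamma> (x, z *\<^sub>C h)) = \<Theta>s 0 z x"
    using fst_L[OF inL] w[of 0] by (simp add: cmv_U_def w_def start scaleC_one)
  moreover have "snd (cmv_U M N \<Gamma> (x, z *\<^sub>C h)) = h"
  proof (rule ell2_eqI)
    fix n
    have "ell2_nth (snd (cmv_U M N \<Gamma> (x, z *\<^sub>C h))) n = (snd (w n), fst (w (Suc n)))"
      unfolding w_def using snd_L_nth[OF inL, of n] by (simp add: cmv_U_def)
    also have "\<dots> = f n"
      using w[of n] w[of "Suc n"] by (simp add: f_def)
    finally show "ell2_nth (snd (cmv_U M N \<Gamma> (x, z *\<^sub>C h))) n = ell2_nth h n"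
      by (simp add: h_def nth)
  qed
  ultimately show ?thesis
    using h by (intro bexI[of _ h]) (simp_all add: prod_eq_iff)
qed

lemma cmv_U'_solution:
  assumes z: "norm z < 1" and x: "x \<in> M"
  shows "\<exists>h\<in>cmv_space' M N \<Gamma>. cmv_U' M N \<Gamma> (x, z *\<^sub>C h) = (\<Theta>s 0 z x, h)"
proof -
  obtain h where h: "h \<in> cmv_space M N \<Gamma>" "cmv_U M N \<Gamma> (x, z *\<^sub>C h) = (\<Theta>s 0 z x, h)"
    using cmv_U_solution[OF assms] by blast
  note Vb = unitary_bounded[OF closed_cmv_space(1) unitary_V]
  show ?thesis
  proof (rule bexI)
    show "cmv_U' M N \<Gamma> (x, z *\<^sub>C cmv_V M N \<Gamma> h) = (\<Theta>s 0 z x, cmv_V M N \<Gamma> h)"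
      using V_intertwines[of x "z *\<^sub>C h"] by (simp add: bounded_ops_scaleC[OF Vb h(1)] h(2))
    show "cmv_V M N \<Gamma> h \<in> cmv_space' M N \<Gamma>"
      by (rule bounded_ops_mem[OF Vb h(1)])
  qed
qed

lemma cmv_realizations:
  "simple_conservative_realization (cmv_U M N \<Gamma>) M N (cmv_space M N \<Gamma>) (\<Theta>s 0)"
  "simple_conservative_realization (cmv_U' M N \<Gamma>) M N (cmv_space' M N \<Gamma>) (\<Theta>s 0)"
  by (intro simple_conservative_realizationI closed_M closed_N closed_cmv_space unitary_U unitary_U'
      cmv_U_completely_nonunitary cmv_U'_completely_nonunitary cmv_U_solution cmv_U'_solution; assumption)+

end

lemma par_spaces_shift:
  "par_spaces (par_dom M N \<Gamma> k) (par_cod M N \<Gamma> k) (\<lambda>n. \<Gamma> (n + k)) n = par_spaces M N \<Gamma> (n + k)"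
  by (induction n) (simp_all add: par_dom_def par_cod_def)

lemma schur_sequence_shift:
  assumes "schur_sequence M N \<Theta>s \<Gamma>"
  shows "schur_sequence (par_dom M N \<Gamma> k) (par_cod M N \<Gamma> k) (\<lambda>n. \<Theta>s (n + k)) (\<lambda>n. \<Gamma> (n + k))"
proof -
  interpret schur_sequence M N \<Theta>s \<Gamma> by fact
  have shift: "par_dom (pdom k) (pcod k) (\<lambda>n. \<Gamma> (n + k)) n = pdom (n + k)"
    "par_cod (pdom k) (pcod k) (\<lambda>n. \<Gamma> (n + k)) n = pcod (n + k)" for n
    unfolding par_dom_def[of "pdom k"] par_cod_def[of "pdom k"] par_spaces_shift
    by (simp_all add: par_dom_def par_cod_def)
  show ?thesis
    using iterates_schur_class[of k] steps
    by unfold_locales (simp_all add: closed_dom closed_cod parameters[symmetric] shift)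
qed

theorem theorem5p3:
  fixes M :: "'a::chilbert_space set" and N :: "'b::chilbert_space set"
    and \<Theta> :: "complex \<Rightarrow> 'a \<Rightarrow> 'b"
    and \<Theta>s :: "nat \<Rightarrow> complex \<Rightarrow> 'a \<Rightarrow> 'b"
    and \<Gamma> :: "nat \<Rightarrow> 'a \<Rightarrow> 'b"
  assumes "closed_csubspace M" and "separable_space (top_of_set M)"
    and "closed_csubspace N" and "separable_space (top_of_set N)"
    and "\<Theta> \<in> schur_class M N"
    and "schur_algorithm M N \<Theta> \<Theta>s \<Gamma>"
    and "\<And>n. \<not> isometric (par_dom M N \<Gamma> n) (\<Gamma> n)"
    and "\<And>n. \<not> coisometric (par_dom M N \<Gamma> n) (par_cod M N \<Gamma> n) (\<Gamma> n)"
  shows "simple_conservative_realization (cmv_U M N \<Gamma>) M N (cmv_space M N \<Gamma>) \<Theta> \<and>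
    simple_conservative_realization (cmv_U' M N \<Gamma>) M N (cmv_space' M N \<Gamma>) \<Theta> \<and>
    (\<forall>k\<ge>1.
      simple_conservative_realization
        (cmv_U (par_dom M N \<Gamma> k) (par_cod M N \<Gamma> k) (\<lambda>n. \<Gamma> (n + k)))
        (par_dom M N \<Gamma> k) (par_cod M N \<Gamma> k)
        (cmv_space (par_dom M N \<Gamma> k) (par_cod M N \<Gamma> k) (\<lambda>n. \<Gamma> (n + k)))
        (\<Theta>s k) \<and>
      simple_conservative_realization
        (cmv_U' (par_dom M N \<Gamma> k) (par_cod M N \<Gamma> k) (\<lambda>n. \<Gamma> (n + k)))
        (par_dom M N \<Gamma> k) (par_cod M N \<Gamma> k)
        (cmv_space' (par_dom M N \<Gamma> k) (par_cod M N \<Gamma> k) (\<lambda>n. \<Gamma> (n + k)))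
        (\<Theta>s k))"
proof -
  have \<Theta>: "\<Theta>s 0 = \<Theta>"
    using assms(6) by (simp add: schur_algorithm_def)
  have seq: "schur_sequence M N \<Theta>s \<Gamma>"
    using assms unfolding schur_algorithm_def by (intro schur_sequence.intro) auto
  show ?thesis
    using schur_sequence.cmv_realizations[OF seq]
      schur_sequence.cmv_realizations[OF schur_sequence_shift[OF seq]]
    by (simp add: \<Theta>)
qed

end
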